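(* Let $\alpha,\lambda>0$, $\chi=\alpha\lambda$, and let $\xi$ be a non-arithmetic Lévy process with $\xi_0=0$ and $-\infty<\mathbb{E}[\xi_1]<\infty$. (1) Let $x\neq0$, set $\beta=\alpha\lambda x$, and let $$Z_t=e^{\alpha\xi_t}\left(x+\beta\int_0^te^{\alpha\xi_s}ds\right)^{-1},\quad t\ge0,$$ which starts from $\frac1x$. Then to $Z$ one can associate a semi-stable Ornstein-Uhlenbeck process $(U,\mathbb{Q}_1)$ (started from $1$) such that $$Z_t=x^{-1}\,U^{\alpha}_{\bigtriangledown_t},\qquad t<T_0^U,$$ where $\bigtriangledown_t=x\int_0^tZ_s\,ds$, and the inverse of $\bigtriangledown$ is $\bigtriangleup_t=\int_0^tU_s^{-\alpha}ds$. If $\mathbb{E}[\xi_1]>0$, the identity holds for any $t\ge0$. Consequently, if $x>0$, $Z$ is a Feller process on $(0,\infty)$. (2) Let $q>0$, $0\le l<u\le+\infty$ and $x\in(l,u)$. If $\mathcal{H}$ is a $(q\Delta,(lx,ux))$-harmonic function for $(U,\mathbb{Q}_1)$, then $z\mapsto\mathcal{H}(x z^{1/\alpha})$ is a $(q,(l^\alpha,u^\alpha))$-harmonic function for the process $Z$ starting from $x^{-\alpha}$ (that is, $Z$ as in (1) with $x$ replaced by $x^\alpha$ and $\beta=\alpha\lambda x^\alpha$). Similarly, if $\mathcal{H}$ is a $(q\Delta,(\frac xu,\frac xl))$-harmonic function for $(U,\mathbb{Q}_1)$, then $y\mapsto\mathcal{H}(x y^{-1/\alpha})$ is a $(q,(l^\alpha,u^\alpha))$-harmonic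 function for the process $\widehat{Y}$ starting from $x^\alpha$, where $$\widehat Y_t=e^{-\alpha\xi_t}\left(x^\alpha+\beta\int_0^te^{\alpha\xi_s}ds\right),\qquad \beta=\alpha\lambda x^\alpha,$$ is the Lévy OU process associated to the dual Lévy process $\widehat\xi=-\xi$. (3) Assume that $\xi$ has finite exponential moments of all positive orders, and that $\xi$ is spectrally negative and non-degenerate, so that the inverse function $\phi$ (see context) is defined. Let $q>0$, $x>0$, let $B$ be a Borel subset of the state space, and write $p_r(y)=y^r$. If $\mathcal{H}$ is a $(\lambda\phi(q),B)$-harmonic function for $(U,\mathbb{Q}^{(\phi(q))}_x)$, then $p_{\phi(q)}\mathcal{H}$ is a $(q\Delta,B)$-harmonic function for $(U,\mathbb{Q}_x)$.
   Context: Semi-stable processes: let $\xi$ be a non-arithmetic Lévy process, $-\infty<\mathbb{E}[\xi_1]<\infty$ (this expectation being for $\xi_0=0$). For $x>0$, with $\xi$ started from $\log x$, set $X_t=e^{\xi_{A_t}}$, $A_t=\inf\{u\ge0:V_u>t\}$, $V_u=\int_0^ue^{\alpha\xi_s}ds$ (Lamperti mapping). This is a $\frac1\alpha$-semi-stable positive Markov process started at $x$, with infinite lifetime if $\mathbb{E}[\xi_1]>0$ and considered up to $T_0^X=\inf\{u\ge 0:X_{u-}=0,X_u=0\}$ if $\mathbb{E}[\xi_1]<0$. If $\mathbb{E}[\xi_1]<0$ and there is a unique $\theta>0$ with $\mathbb{E}[e^{\theta\xi_1}]=1$ (expectation for $\xi_0=0$) and $0<\theta<\alpha$, then $X$ denotes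 its recurrent extension to $[0,\infty)$ that hits and leaves $0$ continuously. Semi-stable Ornstein-Uhlenbeck process: $U_t=e^{-\lambda t}X_{e_\chi(t)}$, $e_\chi(t)=\frac{e^{\chi t}-1}{\chi}$; its law started from $x>0$ is $\mathbb{Q}_x$, and $T_0^U=\inf\{u\ge 0:U_{u-}=0,U_u=0\}$ is its first hitting time of $0$. Put $\bigtriangleup_t=\int_0^tU_s^{-\alpha}ds$. Lévy OU process: for a Lévy process $\eta$ with $\eta_0=0$ and $y,\beta\in\mathbb{R}$, $Y_t=e^{\alpha\eta_t}\big(y+\beta\int_0^te^{-\alpha\eta_s}ds\big)$. Harmonic functions: let $B$ be a Borel subset of the state space and $T_B^U$ the first exit time of $U$ from $B$. For $x>0$, a non-negative function $\mathcal{H}$ is $(q\Delta,B)$-harmonic for $(U,\mathbb{Q}_x)$ if $$\mathbb{E}_x\left[e^{-q\bigtriangleup_{T_B^U}}\mathcal{H}(U_{T_B^U})\mathbf{1}_{\{T_B^U<T_0^U\}}\right]=\mathcal{H}(x),$$ with expectation under $\mathbb{Q}_x$. It is $(q,B)$-harmonic for $(U,\mathbb{Q}_x)$ if the same holds with $\bigtriangleup_{T_B^U}$ replaced by $T_B^U$. (The same definitions apply with $\mathbb{Q}_x$ replaced by $\mathbb{Q}_x^{(\gamma)}$ below.) For $W=Z$ or $\widehat Y$ started from $w$, a non-negative $\mathcal{H}$ is $(q,B)$-harmonic for $W$ if $\mathbb{E}\left[e^{-qT_B^W}\mathcal{H}(W_{T_B^W})\mathbf{1}_{\{T_B^W<\infty\}}\right]=\mathcal{H}(w)$,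 where $T_B^W$ is the first exit time of $W$ from $B$. Conventions: $x/0=+\infty$, $x/(+\infty)=0$. Exponents: let $\Psi$ be the characteristic exponent of $\xi$ and $\psi(m)=-\Psi(-im)$ its Laplace exponent, i.e. $\mathbb{E}[e^{m\xi_1}]=e^{\psi(m)}$ for $\xi_0=0$. Finite exponential moments of all positive orders means $\psi(m)<\infty$ for every $m\ge0$. For $\gamma>0$, $\mathbb{Q}_x^{(\gamma)}$ is the law of the semi-stable OU process started at $x$ associated (with the same $\alpha,\lambda$) to the Lévy process with Laplace exponent $\psi_\gamma(u)=\psi(u+\gamma)-\psi(\gamma)$, $u\geq 0$. If $\xi$ is spectrally negative and non-degenerate (in particular $-\xi$ is not a subordinator), $\theta_0$ is the largest root of $\psi(u)=0$, $\psi$ is continuous and increasing on $[\theta_0,\infty)$, and $\phi:[0,\infty)\to[\theta_0,\infty)$ is its inverse. *)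

theory Defs
  imports "HOL-Probability.Probability"
begin

text \<open>
  Processes have type \<open>real \<Rightarrow> 'a \<Rightarrow> real\<close> (time first); only times \<open>t \<ge> 0\<close> matter.
  Path functionals (hitting times, clocks, transforms) take a single path \<open>f :: real \<Rightarrow> real\<close>;
  random times are \<open>ereal\<close>-valued, with \<open>Inf {} = \<infinity>\<close>.
\<close>

section \<open>Levy processes\<close>

definition cadlag_in :: "real set \<Rightarrow> (real \<Rightarrow> real) \<Rightarrow> bool" where
  "cadlag_in E f \<longleftrightarrow> (\<forall>t\<ge>0. f t \<in> E \<and> continuous (at_right t) f) \<and>
     (\<forall>t>0. \<exists>l\<in>E. (f \<longlongrightarrow> l) (at_left t))"

definition levy_process :: "'a measure \<Rightarrow> (real \<Rightarrow> 'a \<Rightarrow> real) \<Rightarrow> bool" where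
  "levy_process M \<xi> \<longleftrightarrow> prob_space M \<and>
     (\<forall>t\<ge>0. \<xi> t \<in> borel_measurable M) \<and>
     (\<forall>\<omega>\<in>space M. cadlag_in UNIV (\<lambda>t. \<xi> t \<omega>)) \<and>
     (AE \<omega> in M. \<xi> 0 \<omega> = 0) \<and>
     (\<forall>s\<ge>0. \<forall>t\<ge>0. distr M borel (\<lambda>\<omega>. \<xi> (s + t) \<omega> - \<xi> s \<omega>) = distr M borel (\<xi> t)) \<and>
     (\<forall>(\<tau>::nat \<Rightarrow> real) n. 0 \<le> \<tau> 0 \<longrightarrow> mono \<tau> \<longrightarrow>
        prob_space.indep_vars M (\<lambda>_. borel) (\<lambda>i \<omega>. \<xi> (\<tau> (Suc i)) \<omega> - \<xi> (\<tau> i) \<omega>) {..<n})"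

text \<open>The lattice condition concerns the whole process, not only \<open>\<xi> 1\<close>: the drift \<open>\<xi> t = t\<close>
  is non-arithmetic, the zero process is arithmetic.\<close>

definition non_arithmetic :: "'a measure \<Rightarrow> (real \<Rightarrow> 'a \<Rightarrow> real) \<Rightarrow> bool" where
  "non_arithmetic M \<xi> \<longleftrightarrow>
     \<not> (\<exists>r>0. \<forall>t\<ge>0. AE \<omega> in M. \<exists>k::int. \<xi> t \<omega> = r * of_int k)"

definition subordinator :: "'a measure \<Rightarrow> (real \<Rightarrow> 'a \<Rightarrow> real) \<Rightarrow> bool" where
  "subordinator M \<eta> \<longleftrightarrow> levy_process M \<eta> \<and> (AE \<omega> in M. mono_on {0..} (\<lambda>t. \<eta> t \<omega>))"

definition spectrally_negative :: "'a measure \<Rightarrow> (real \<Rightarrow> 'a \<Rightarrow> real) \<Rightarrow> bool" where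
  "spectrally_negative M \<xi> \<longleftrightarrow>
     (AE \<omega> in M. \<forall>t>0. \<forall>l. ((\<lambda>s. \<xi> s \<omega>) \<longlongrightarrow> l) (at_left t) \<longrightarrow> \<xi> t \<omega> \<le> l)"

text \<open>As usual for spectrally negative processes, the degenerate cases are negatives of
  subordinators and deterministic drifts.\<close>

definition nondegenerate :: "'a measure \<Rightarrow> (real \<Rightarrow> 'a \<Rightarrow> real) \<Rightarrow> bool" where
  "nondegenerate M \<xi> \<longleftrightarrow> \<not> subordinator M (\<lambda>t \<omega>. - \<xi> t \<omega>) \<and>
     \<not> (\<exists>c. \<forall>t\<ge>0. AE \<omega> in M. \<xi> t \<omega> = c * t)"

definition finite_exp_moments :: "'a measure \<Rightarrow> (real \<Rightarrow> 'a \<Rightarrow> real) \<Rightarrow> bool" where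
  "finite_exp_moments M \<xi> \<longleftrightarrow> (\<forall>m\<ge>0. integrable M (\<lambda>\<omega>. exp (m * \<xi> 1 \<omega>)))"

text \<open>Meaningful for those \<open>m\<close> for which the exponential moment is finite.\<close>

definition laplace_exponent :: "'a measure \<Rightarrow> (real \<Rightarrow> 'a \<Rightarrow> real) \<Rightarrow> real \<Rightarrow> real" where
  "laplace_exponent M \<xi> m = ln (\<integral>\<omega>. exp (m * \<xi> 1 \<omega>) \<partial>M)"

definition has_laplace_exponent ::
    "'a measure \<Rightarrow> (real \<Rightarrow> 'a \<Rightarrow> real) \<Rightarrow> (real \<Rightarrow> real) \<Rightarrow> bool" where
  "has_laplace_exponent M \<xi> \<psi> \<longleftrightarrow>
     (\<forall>u\<ge>0. integrable M (\<lambda>\<omega>. exp (u * \<xi> 1 \<omega>)) \<and> (\<integral>\<omega>. exp (u * \<xi> 1 \<omega>) \<partial>M) = exp (\<psi> u))"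

definition largest_root :: "(real \<Rightarrow> real) \<Rightarrow> real" where
  "largest_root \<psi> = (GREATEST u. 0 \<le> u \<and> \<psi> u = 0)"

definition exponent_inverse :: "(real \<Rightarrow> real) \<Rightarrow> real \<Rightarrow> real" where
  "exponent_inverse \<psi> = inv_into {largest_root \<psi>..} \<psi>"

section \<open>Feller processes\<close>

definition natural_filtration ::
    "'a measure \<Rightarrow> (real \<Rightarrow> 'a \<Rightarrow> real) \<Rightarrow> real \<Rightarrow> 'a measure" where
  "natural_filtration M Z s =
     sigma (space M) (\<Union>r\<in>{0..s}. {Z r -` A \<inter> space M | A. A \<in> sets borel})"

text \<open>
  A Feller semigroup preserves bounded continuous functions and is weakly continuous at time 0.
  (The class of continuous functions vanishing at both ends of \<open>(0, \<infinity>)\<close> is not preserved by the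
  process \<open>recip_OU\<close> below, which comes in from \<open>+\<infinity>\<close>.)
\<close>

definition feller_semigroup :: "real set \<Rightarrow> (real \<Rightarrow> real \<Rightarrow> real measure) \<Rightarrow> bool" where
  "feller_semigroup E P \<longleftrightarrow>
     (\<forall>t\<ge>0. P t \<in> restrict_space borel E \<rightarrow>\<^sub>M prob_algebra (restrict_space borel E)) \<and>
     (\<forall>z\<in>E. P 0 z = return (restrict_space borel E) z) \<and>
     (\<forall>s\<ge>0. \<forall>t\<ge>0. \<forall>z\<in>E. P (s + t) z = Giry_Monad.bind (P s z) (P t)) \<and>
     (\<forall>f::real \<Rightarrow> real. continuous_on E f \<longrightarrow> bounded (f ` E) \<longrightarrow>
        (\<forall>t\<ge>0. continuous_on E (\<lambda>z. \<integral>y. f y \<partial>P t z)) \<and>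
        (\<forall>z\<in>E. ((\<lambda>t. \<integral>y. f y \<partial>P t z) \<longlongrightarrow> f z) (at_right 0)))"

definition feller_process ::
    "'a measure \<Rightarrow> real set \<Rightarrow> (real \<Rightarrow> real \<Rightarrow> real measure) \<Rightarrow> (real \<Rightarrow> 'a \<Rightarrow> real) \<Rightarrow> bool" where
  "feller_process M E P Z \<longleftrightarrow> feller_semigroup E P \<and>
     (\<forall>t\<ge>0. Z t \<in> borel_measurable M) \<and>
     (AE \<omega> in M. cadlag_in E (\<lambda>t. Z t \<omega>)) \<and>
     (\<forall>s\<ge>0. \<forall>t\<ge>0. \<forall>f\<in>borel_measurable borel. bounded (range f) \<longrightarrow>
        (AE \<omega> in M. real_cond_exp M (natural_filtration M Z s) (\<lambda>\<omega>'. f (Z (s + t) \<omega>')) \<omega>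
                     = (\<integral>y. f y \<partial>P t (Z s \<omega>))))"

section \<open>Semi-stable processes and semi-stable Ornstein-Uhlenbeck processes\<close>

text \<open>\<open>T_0 = inf {u \<ge> 0. f(u-) = 0 = f(u)}\<close>, with the convention \<open>f(0-) = f(0)\<close>.\<close>

definition hit_zero :: "(real \<Rightarrow> real) \<Rightarrow> ereal" where
  "hit_zero f = Inf {ereal u | u. 0 \<le> u \<and> (f \<longlongrightarrow> 0) (at u within {0..<u}) \<and> f u = 0}"

definition lamperti_V :: "real \<Rightarrow> (real \<Rightarrow> real) \<Rightarrow> real \<Rightarrow> real" where
  "lamperti_V \<alpha> f u = (LBINT s:{0..u}. exp (\<alpha> * f s))"

definition lamperti_A :: "real \<Rightarrow> (real \<Rightarrow> real) \<Rightarrow> real \<Rightarrow> ereal" where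
  "lamperti_A \<alpha> f t = Inf {ereal u | u. 0 \<le> u \<and> lamperti_V \<alpha> f u > t}"

text \<open>The path is set to 0 from the lifetime \<open>lim\<^bsub>u\<rightarrow>\<infinity>\<^esub> lamperti_V \<alpha> f u\<close> on.\<close>

definition lamperti :: "real \<Rightarrow> (real \<Rightarrow> real) \<Rightarrow> real \<Rightarrow> real" where
  "lamperti \<alpha> f t =
     (if lamperti_A \<alpha> f t = \<infinity> then 0 else exp (f (real_of_ereal (lamperti_A \<alpha> f t))))"

definition lamperti_process ::
    "real \<Rightarrow> (real \<Rightarrow> 'a \<Rightarrow> real) \<Rightarrow> real \<Rightarrow> real \<Rightarrow> 'a \<Rightarrow> real" where
  "lamperti_process \<alpha> \<xi> x t \<omega> = lamperti \<alpha> (\<lambda>s. ln x + \<xi> s \<omega>) t"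

definition recurrent_case :: "'a measure \<Rightarrow> real \<Rightarrow> (real \<Rightarrow> 'a \<Rightarrow> real) \<Rightarrow> bool" where
  "recurrent_case M \<alpha> \<xi> \<longleftrightarrow> (\<integral>\<omega>. \<xi> 1 \<omega> \<partial>M) < 0 \<and>
     (\<exists>\<theta>>0. (\<integral>\<omega>. exp (\<theta> * \<xi> 1 \<omega>) \<partial>M) = 1 \<and> \<theta> < \<alpha> \<and>
        (\<forall>\<theta>'>0. (\<integral>\<omega>. exp (\<theta>' * \<xi> 1 \<omega>) \<partial>M) = 1 \<longrightarrow> \<theta>' = \<theta>))"

definition self_similar_semigroup :: "real \<Rightarrow> (real \<Rightarrow> real \<Rightarrow> real measure) \<Rightarrow> bool" where
  "self_similar_semigroup \<alpha> P \<longleftrightarrow> (\<forall>c>0. \<forall>t\<ge>0. \<forall>y\<ge>0.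
     P t (c * y) = distr (P (c powr (-\<alpha>) * t) y) (restrict_space borel {0..}) (\<lambda>z. c * z))"

text \<open>
  A version, started from \<open>x > 0\<close>, of the recurrent extension that hits and leaves 0 continuously:
  a self-similar Feller (hence strong Markov) process on \<open>[0, \<infinity>)\<close> which follows the Lamperti path
  up to its first hitting time of 0, for which 0 is recurrent but not a trap, and which jumps
  neither into 0 nor out of 0.  By self-similarity of the semigroup, agreement with the Lamperti
  process from one starting point fixes the killed process from every starting point.
\<close>

definition recurrent_extension ::
    "'a measure \<Rightarrow> real \<Rightarrow> (real \<Rightarrow> 'a \<Rightarrow> real) \<Rightarrow> real \<Rightarrow> (real \<Rightarrow> 'a \<Rightarrow> real) \<Rightarrow> bool" where
  "recurrent_extension M \<alpha> \<xi> x X \<longleftrightarrow>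
     (\<exists>P. feller_process M {0..} P X \<and> self_similar_semigroup \<alpha> P) \<and>
     (AE \<omega> in M. \<forall>t\<ge>0. ereal t \<le> hit_zero (\<lambda>s. lamperti_process \<alpha> \<xi> x s \<omega>) \<longrightarrow>
        X t \<omega> = lamperti_process \<alpha> \<xi> x t \<omega>) \<and>
     (AE \<omega> in M. \<forall>s\<ge>0. (\<exists>t\<ge>s. X t \<omega> = 0) \<and> (\<exists>t\<ge>s. X t \<omega> > 0)) \<and>
     (AE \<omega> in M. \<forall>t>0. X t \<omega> = 0 \<longleftrightarrow> ((\<lambda>s. X s \<omega>) \<longlongrightarrow> 0) (at_left t))"

definition semistable_process ::
    "'a measure \<Rightarrow> real \<Rightarrow> (real \<Rightarrow> 'a \<Rightarrow> real) \<Rightarrow> real \<Rightarrow> (real \<Rightarrow> 'a \<Rightarrow> real) \<Rightarrow> bool" where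
  "semistable_process M \<alpha> \<xi> x X \<longleftrightarrow> (\<forall>t\<ge>0. X t \<in> borel_measurable M) \<and>
     (if recurrent_case M \<alpha> \<xi> then recurrent_extension M \<alpha> \<xi> x X
      else (AE \<omega> in M. \<forall>t\<ge>0. X t \<omega> = lamperti_process \<alpha> \<xi> x t \<omega>))"

definition OU_transform :: "real \<Rightarrow> real \<Rightarrow> (real \<Rightarrow> real) \<Rightarrow> real \<Rightarrow> real" where
  "OU_transform \<alpha> lam f t =
     exp (- lam * t) * f ((exp (\<alpha> * lam * t) - 1) / (\<alpha> * lam))"

text \<open>\<open>U\<close> is a version of the semi-stable Ornstein-Uhlenbeck process under the law \<open>Q\<^sub>x\<close>, built on
  the probability space that carries the underlying Levy process \<open>\<xi>\<close>.\<close>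

definition semistable_OU ::
    "'a measure \<Rightarrow> real \<Rightarrow> real \<Rightarrow> (real \<Rightarrow> 'a \<Rightarrow> real) \<Rightarrow> real \<Rightarrow> (real \<Rightarrow> 'a \<Rightarrow> real) \<Rightarrow> bool" where
  "semistable_OU M \<alpha> lam \<xi> x U \<longleftrightarrow>
     (\<exists>X. semistable_process M \<alpha> \<xi> x X \<and>
        (\<forall>\<omega>\<in>space M. \<forall>t\<ge>0. U t \<omega> = OU_transform \<alpha> lam (\<lambda>s. X s \<omega>) t))"

text \<open>\<open>\<Delta>\<^sub>t = \<integral>\<^sub>0\<^sup>t f(s)\<^sup>-\<^sup>\<alpha> ds\<close>\<close>

definition up_clock :: "real \<Rightarrow> (real \<Rightarrow> real) \<Rightarrow> real \<Rightarrow> real" where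
  "up_clock \<alpha> f t = (LBINT s:{0..t}. f s powr (-\<alpha>))"

section \<open>The processes \<open>Y\<close> and \<open>Z\<close>\<close>

definition levy_OU ::
    "real \<Rightarrow> real \<Rightarrow> real \<Rightarrow> (real \<Rightarrow> 'a \<Rightarrow> real) \<Rightarrow> real \<Rightarrow> 'a \<Rightarrow> real" where
  "levy_OU \<alpha> \<beta> y \<eta> t \<omega> =
     exp (\<alpha> * \<eta> t \<omega>) * (y + \<beta> * (LBINT s:{0..t}. exp (- \<alpha> * \<eta> s \<omega>)))"

definition recip_OU ::
    "real \<Rightarrow> real \<Rightarrow> real \<Rightarrow> (real \<Rightarrow> 'a \<Rightarrow> real) \<Rightarrow> real \<Rightarrow> 'a \<Rightarrow> real" where
  "recip_OU \<alpha> \<beta> x \<xi> t \<omega> =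
     exp (\<alpha> * \<xi> t \<omega>) * inverse (x + \<beta> * (LBINT s:{0..t}. exp (\<alpha> * \<xi> s \<omega>)))"

section \<open>Harmonic functions\<close>

definition exit_time :: "real set \<Rightarrow> (real \<Rightarrow> real) \<Rightarrow> ereal" where
  "exit_time B f = Inf {ereal t | t. 0 \<le> t \<and> f t \<notin> B}"

text \<open>
  \<open>E [exp (- q C\<^sub>T) H(W\<^sub>T) 1{T < \<zeta>}] = H(w)\<close>, where \<open>T\<close> is the first exit time of \<open>W\<close> from \<open>B\<close>,
  \<open>S\<close> is the state space, \<open>C\<close> a clock and \<open>\<zeta>\<close> a lifetime, both functionals of the path.  For a
  general Borel set \<open>B\<close> the exit time is measurable only with respect to the completion of \<open>M\<close>;
  the \<open>nn_integral\<close> does not distinguish a measure from its completion (\<open>nn_integral_completion\<close>).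
\<close>

definition harmonic_for ::
    "((real \<Rightarrow> real) \<Rightarrow> real \<Rightarrow> real) \<Rightarrow> ((real \<Rightarrow> real) \<Rightarrow> ereal) \<Rightarrow> real set \<Rightarrow>
     'a measure \<Rightarrow> (real \<Rightarrow> 'a \<Rightarrow> real) \<Rightarrow> real \<Rightarrow> real \<Rightarrow> real set \<Rightarrow> (real \<Rightarrow> real) \<Rightarrow> bool" where
  "harmonic_for C \<zeta> S M W w q B H \<longleftrightarrow>
     (\<forall>y\<in>S. 0 \<le> H y) \<and> H \<in> borel_measurable (restrict_space borel S) \<and>
     (\<integral>\<^sup>+\<omega>. (let f = (\<lambda>t. W t \<omega>); T = exit_time B f; \<tau> = real_of_ereal T in
            if T < \<zeta> f then ennreal (exp (- q * C f \<tau>) * H (f \<tau>)) else 0) \<partial>M) = ennreal (H w)"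

text \<open>\<open>(q\<Delta>, B)\<close>-harmonic for \<open>(U, Q\<^sub>x)\<close>\<close>

definition clock_harmonic ::
    "real \<Rightarrow> 'a measure \<Rightarrow> (real \<Rightarrow> 'a \<Rightarrow> real) \<Rightarrow> real \<Rightarrow> real \<Rightarrow> real set \<Rightarrow> (real \<Rightarrow> real) \<Rightarrow> bool" where
  "clock_harmonic \<alpha> = harmonic_for (up_clock \<alpha>) hit_zero {0..}"

text \<open>\<open>(q, B)\<close>-harmonic for \<open>(U, Q\<^sub>x)\<close>\<close>

definition time_harmonic ::
    "'a measure \<Rightarrow> (real \<Rightarrow> 'a \<Rightarrow> real) \<Rightarrow> real \<Rightarrow> real \<Rightarrow> real set \<Rightarrow> (real \<Rightarrow> real) \<Rightarrow> bool" where
  "time_harmonic = harmonic_for (\<lambda>_ t. t) hit_zero {0..}"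

text \<open>\<open>(q, B)\<close>-harmonic for a process \<open>W\<close> on \<open>(0, \<infinity>)\<close> with infinite lifetime, started from \<open>w\<close>\<close>

definition harmonic ::
    "'a measure \<Rightarrow> (real \<Rightarrow> 'a \<Rightarrow> real) \<Rightarrow> real \<Rightarrow> real \<Rightarrow> real set \<Rightarrow> (real \<Rightarrow> real) \<Rightarrow> bool" where
  "harmonic = harmonic_for (\<lambda>_ t. t) (\<lambda>_. \<infinity>) {0<..}"

text \<open>Power of an extended non-negative real, with \<open>\<infinity>\<^sup>a = \<infinity>\<close> for \<open>a > 0\<close>.\<close>

definition ereal_rpow :: "ereal \<Rightarrow> real \<Rightarrow> ereal" where
  "ereal_rpow u a = (if u = \<infinity> then \<infinity> else ereal (real_of_ereal u powr a))"

end

theory Submission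
  imports Defs
begin

text \<open>
  Write \<open>V\<^sub>u = \<integral>\<^sub>0\<^sup>u exp (\<alpha> \<xi>\<^sub>s) ds\<close> with \<open>\<xi>\<close> started from \<open>ln x\<close>.  At the time
  \<open>\<tau>\<^sub>u = ln (1 + \<alpha> \<lambda> V\<^sub>u) / (\<alpha> \<lambda>)\<close> one has \<open>e\<^sub>\<chi>(\<tau>\<^sub>u) = V\<^sub>u\<close>, so that
  \<open>U(\<tau>\<^sub>u) = exp (\<xi>\<^sub>u) (1 + \<alpha> \<lambda> V\<^sub>u)\<^bsup>-1/\<alpha>\<^esup>\<close>; moreover \<open>\<tau>\<close> maps \<open>[0, \<infinity>)\<close> onto the lifetime
  \<open>[0, T\<^sub>0)\<close>.  Since \<open>d\<tau>\<^sub>u = U(\<tau>\<^sub>u)\<^sup>\<alpha> du\<close>, \<open>\<tau>\<close> is the inverse of the clock \<open>\<Delta>\<close>, and with \<open>U\<close> started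
  from 1 one reads off \<open>Z\<^sub>u = x\<^sup>-\<^sup>1 U(\<tau>\<^sub>u)\<^sup>\<alpha>\<close>.  This gives part (1), and part (2) because exit times correspond under \<open>\<tau>\<close>.
  The Feller property follows from the flow property of \<open>Z\<close> over the independent stationary
  increments of \<open>\<xi>\<close>.

  For part (3), \<open>\<eta>\<close> is the Esscher transform of \<open>\<xi>\<close>: up to time \<open>t\<close> its law has density
  \<open>exp (\<gamma> \<xi>\<^sub>t - q t)\<close> with respect to that of \<open>\<xi>\<close>, where \<open>\<gamma> = \<phi>(q)\<close>.  In terms of the underlying Levy
  process both harmonicity conditions speak of the debut \<open>T\<close> of the same adapted set, and
  \<open>U(\<tau>\<^sub>u)\<^sup>\<gamma> = x\<^sup>\<gamma> exp (\<gamma> \<xi>\<^sub>u) exp (-\<lambda> \<gamma> \<tau>\<^sub>u)\<close> with \<open>\<xi>\<close> started from 0, so the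
  claim is the change of measure at the random time \<open>T\<close>.
\<close>

section \<open>Cadlag paths and time changes\<close>

text \<open>Two obstacles shape the proof. In part (3) the set \<open>B\<close> is only Borel, so
  the exit time is a debut whose measurability rests on the projection theorem and holds only in the
  completion; this is the reason for Souslin schemes and for the repeated passage to Borel versions.
  Moreover \<open>\<xi>\<close> and \<open>\<eta>\<close> may live on unrelated probability spaces,
  linked only by exponential moments at time 1 with arguments \<open>u \<ge> 0\<close>.
  Multiplicativity carries this link to all times, analytic continuation turns it into a relation
  between one-time laws, independence of increments into one between laws of stopped paths, and
  discretisation brings it to a random time. Since the debut may be infinite and the density
  martingale need not be uniformly integrable, no change of measure on the whole path is available;
  Fatou's lemma, used in both directions, replaces optional stopping. Paths are only
  right-continuous, so passages from grid times to arbitrary times run along dyadic points strictly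
  to the right.\<close>

definition dyadic_above :: "nat \<Rightarrow> real \<Rightarrow> real" where
  "dyadic_above n t = (real (nat \<lfloor>2 ^ n * t\<rfloor>) + 1) / 2 ^ n"

text \<open>The strict lower bound keeps the approximants in \<open>at_right t\<close>, the filter
  along which a cadlag path is known to converge to its value at \<open>t\<close>.\<close>

lemma dyadic_above_bounds:
  assumes "0 \<le> t"
  shows "t < dyadic_above n t" "dyadic_above n t \<le> t + 1 / 2 ^ n"
proof -
  have n: "real (nat \<lfloor>2 ^ n * t\<rfloor>) = of_int \<lfloor>2 ^ n * t\<rfloor>" using assms by simp
  show "t < dyadic_above n t"
    unfolding dyadic_above_def n by (simp add: field_simps) linarith
  show "dyadic_above n t \<le> t + 1 / 2 ^ n"
    unfolding dyadic_above_def n by (simp add: field_simps)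
qed

lemma dyadic_above_tendsto:
  assumes "0 \<le> t" shows "(\<lambda>n. dyadic_above n t) \<longlonglongrightarrow> t"
proof (rule tendsto_sandwich[where f="\<lambda>_. t" and h="\<lambda>n. t + 1 / 2 ^ n"])
  have "(\<lambda>n. (1/2::real)^n) \<longlonglongrightarrow> 0" by (rule LIMSEQ_realpow_zero) auto
  then have "(\<lambda>n. t + (1/2)^n) \<longlonglongrightarrow> t + 0" by (rule tendsto_add[OF tendsto_const])
  then show "(\<lambda>n. t + 1 / 2 ^ n) \<longlonglongrightarrow> t" by (simp add: power_one_over)
qed (use assms dyadic_above_bounds in \<open>auto intro!: always_eventually less_imp_le\<close>)

lemma continuous_at_right_dyadic:
  fixes f :: "real \<Rightarrow> real"
  assumes "0 \<le> t" "continuous (at_right t) f"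
  shows "(\<lambda>n. f (dyadic_above n t)) \<longlonglongrightarrow> f t"
proof -
  have "filterlim (\<lambda>n. dyadic_above n t) (at_right t) sequentially"
    unfolding filterlim_at using assms(1) dyadic_above_tendsto dyadic_above_bounds(1)
    by (simp add: order_less_imp_not_eq2)
  moreover have "(f \<longlongrightarrow> f t) (at_right t)" using assms(2) by (simp add: continuous_within)
  ultimately show ?thesis by (rule filterlim_compose[rotated])
qed

lemma cadlag_in_right: "cadlag_in E f \<Longrightarrow> 0 \<le> t \<Longrightarrow> continuous (at_right t) f"
  by (simp add: cadlag_in_def)

lemma cadlag_in_measurable:
  assumes "cadlag_in E f"
  shows "(\<lambda>t. f (max 0 t)) \<in> borel_measurable borel"
proof (rule borel_measurable_LIMSEQ_real)
  fix t :: real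
  show "(\<lambda>n. f (dyadic_above n (max 0 t))) \<longlonglongrightarrow> f (max 0 t)"
    by (rule continuous_at_right_dyadic) (use assms cadlag_in_right in auto)
next
  fix n
  \<comment> \<open>The approximant sees \<open>t\<close> only through an integer, so it is
    measurable whatever \<open>f\<close> is.\<close>
  have "(\<lambda>t::real. f ((real (nat \<lfloor>2 ^ n * max 0 t\<rfloor>) + 1) / 2 ^ n)) =
      (\<lambda>k. f ((real (nat k) + 1) / 2 ^ n)) \<circ> (\<lambda>t. \<lfloor>2 ^ n * max 0 t\<rfloor>)" by auto
  also have "\<dots> \<in> borel_measurable borel"
    by (rule measurable_comp[where N="count_space UNIV"]) auto
  finally show "(\<lambda>t. f (dyadic_above n (max 0 t))) \<in> borel_measurable borel"
    unfolding dyadic_above_def .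
qed

text \<open>Bisection on intervals: boundedness passes to adjacent unions, and near each point the
  right limit and the left limit bound the path on either side.\<close>

lemma cadlag_in_bounded:
  assumes "cadlag_in E f" "0 \<le> T"
  shows "\<exists>C. \<forall>t\<in>{0..T}. \<bar>f t\<bar> \<le> C"
proof -
  \<comment> \<open>The guard \<open>0 \<le> t\<close> sits inside the predicate because intervals
    around 0 reach into negative times, where nothing is known.\<close>
  define P where "P a b \<longleftrightarrow> (\<exists>C. \<forall>t. 0 \<le> t \<longrightarrow> t \<in> {a..b} \<longrightarrow> \<bar>f t\<bar> \<le> C)" for a b
  have "P 0 T"
    using assms(2)
  proof (induction rule: Bolzano)
    case (trans a b c)
    then obtain C1 C2 where C: "\<forall>t. 0 \<le> t \<longrightarrow> t \<in> {a..b} \<longrightarrow> \<bar>f t\<bar> \<le> C1"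
      "\<forall>t. 0 \<le> t \<longrightarrow> t \<in> {b..c} \<longrightarrow> \<bar>f t\<bar> \<le> C2" unfolding P_def by blast
    have "\<bar>f t\<bar> \<le> max C1 C2" if "0 \<le> t" "t \<in> {a..c}" for t
    proof (cases "t \<le> b")
      case True then have "\<bar>f t\<bar> \<le> C1" using C(1) that by auto
      then show ?thesis by simp
    next
      case False then have "\<bar>f t\<bar> \<le> C2" using C(2) that by auto
      then show ?thesis by simp
    qed
    then show ?case unfolding P_def by blast
  next
    case (local x)
    have "(f \<longlongrightarrow> f x) (at_right x)" using cadlag_in_right[OF assms(1)] local
      by (simp add: continuous_within)
    then have "eventually (\<lambda>t. dist (f t) (f x) < 1) (at_right x)" by (rule tendstoD) simp
    then obtain e1 where e1: "e1 > x" "\<And>t. x < t \<Longrightarrow> t < e1 \<Longrightarrow> dist (f t) (f x) < 1"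
      by (auto simp: eventually_at_right_field)
    have "\<exists>e2<x. \<exists>C. \<forall>t. 0 \<le> t \<longrightarrow> e2 < t \<longrightarrow> t < x \<longrightarrow> \<bar>f t\<bar> \<le> C"
    proof (cases "x = 0")
      case True then show ?thesis by (intro exI[of _ "-1"]) auto
    next
      case False
      then have "0 < x" using local by simp
      then obtain l where "(f \<longlongrightarrow> l) (at_left x)" using assms(1) unfolding cadlag_in_def by blast
      then have "eventually (\<lambda>t. dist (f t) l < 1) (at_left x)" by (rule tendstoD) simp
      then obtain e2 where e2: "e2 < x" "\<And>t. e2 < t \<Longrightarrow> t < x \<Longrightarrow> dist (f t) l < 1"
        by (auto simp: eventually_at_left_field)
      have "\<bar>f t\<bar> \<le> \<bar>l\<bar> + 1" if "e2 < t" "t < x" for t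
        using e2(2)[OF that] by (auto simp: dist_real_def)
      then show ?thesis using e2(1) by blast
    qed
    then obtain e2 C where e2: "e2 < x" "\<And>t. 0 \<le> t \<Longrightarrow> e2 < t \<Longrightarrow> t < x \<Longrightarrow> \<bar>f t\<bar> \<le> C" by blast
    have "\<bar>f t\<bar> \<le> max C (\<bar>f x\<bar> + 1)" if "0 \<le> t" "e2 < t" "t < e1" for t
    proof (cases t x rule: linorder_cases)
      case less then have "\<bar>f t\<bar> \<le> C" using e2 that by auto
      then show ?thesis by simp
    next
      case greater then have "\<bar>f t\<bar> \<le> \<bar>f x\<bar> + 1" using e1(2)[of t] that by (auto simp: dist_real_def)
      then show ?thesis by simp
    qed auto
    note bd = this
    have "P a b" if "a \<le> x" "x \<le> b" "b - a < min (e1 - x) (x - e2)" for a b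
      unfolding P_def
    proof (intro exI[of _ "max C (\<bar>f x\<bar> + 1)"] allI impI)
      fix t assume "0 \<le> t" "t \<in> {a..b}"
      then have "e2 < t" "t < e1" using that by auto
      then show "\<bar>f t\<bar> \<le> max C (\<bar>f x\<bar> + 1)" using bd[OF \<open>0 \<le> t\<close>] by blast
    qed
    moreover have "0 < min (e1 - x) (x - e2)" using e1(1) e2(1) by simp
    ultimately show ?case by blast
  qed
  then show ?thesis unfolding P_def by force
qed

text \<open>\<open>max 0\<close> freezes the path at its initial value on negative times, so that
  the claim covers every interval, as the substitution lemmas require of their density.\<close>

lemma cadlag_exp_integrable:
  assumes "cadlag_in E f"
  shows "set_integrable lborel {a..b} (\<lambda>s. exp (c * f (max 0 s)))"
proof -
  obtain C where C: "\<forall>t\<in>{0..max 0 b}. \<bar>f t\<bar> \<le> C" using cadlag_in_bounded[OF assms, of "max 0 b"] by auto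
  have "norm (exp (c * f (max 0 s))) \<le> exp (\<bar>c\<bar> * C)" if "s \<in> {a..b}" for s
  proof -
    have "\<bar>f (max 0 s)\<bar> \<le> C" using C that by auto
    then have "\<bar>c\<bar> * \<bar>f (max 0 s)\<bar> \<le> \<bar>c\<bar> * C" by (intro mult_left_mono) auto
    then have "c * f (max 0 s) \<le> \<bar>c\<bar> * C" by (metis abs_le_D1 abs_mult)
    then show ?thesis by simp
  qed
  note bd = this
  note [measurable] = cadlag_in_measurable[OF assms]
  show ?thesis unfolding set_integrable_def
  proof (rule integrableI_bounded_set[where A="{a..b}" and B="exp (\<bar>c\<bar> * C)"])
    show "emeasure lborel {a..b} < \<infinity>" by (simp add: emeasure_lborel_Icc_eq)
    show "AE s in lborel. s \<in> {a..b} \<longrightarrow> norm (indicat_real {a..b} s *\<^sub>R exp (c * f (max 0 s))) \<le> exp (\<bar>c\<bar> * C)"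
      using bd by (auto simp: indicator_def)
  qed auto
qed

text \<open>The density of the time change is only cadlag, so substitution is not available from the
  fundamental theorem of calculus; it is obtained from the fact that \<open>v \<mapsto> \<integral>\<^sub>0\<^sup>v h\<close> pushes
  \<open>h dv\<close> forward to Lebesgue measure.\<close>

context
  fixes h :: "real \<Rightarrow> real" and T :: real
  assumes h_pos: "\<And>v. 0 < h v"
    and h_int: "\<And>a b. set_integrable lborel {a..b} h"
begin

text \<open>Integrability on the intervals \<open>[-n, n]\<close> makes the truncations measurable,
  and the density is their pointwise limit.\<close>

lemma density_measurable: "h \<in> borel_measurable borel"
proof (rule borel_measurable_LIMSEQ_real)
  fix x :: real
  obtain N where N: "\<bar>x\<bar> \<le> real N" using real_arch_simple by blast
  have "\<forall>\<^sub>F n in sequentially. indicat_real {-real n..real n} x *\<^sub>R h x = h x"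
    using eventually_ge_at_top[of N] by eventually_elim (use N in \<open>auto simp: indicator_def\<close>)
  then show "(\<lambda>n. indicat_real {-real n..real n} x *\<^sub>R h x) \<longlonglongrightarrow> h x"
    by (rule tendsto_eventually)
next
  fix n show "(\<lambda>x. indicat_real {-real n..real n} x *\<^sub>R h x) \<in> borel_measurable borel"
    using borel_measurable_integrable[OF h_int[unfolded set_integrable_def]] by simp
qed

lemma primitive_split:
  assumes "0 \<le> a" "a \<le> b"
  shows "(LBINT v:{0..b}. h v) = (LBINT v:{0..a}. h v) + (LBINT v:{a<..b}. h v)"
    "(LBINT v:{0..b}. h v) = (LBINT v:{0..a}. h v) + (LBINT v:{a..b}. h v)"
proof -
  note [measurable] = density_measurable
  have i: "set_integrable lborel {a<..b} h" by (rule set_integrable_subset[OF h_int[of a b]]) auto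
  have "{0..b} = {0..a} \<union> {a<..b}" using assms by auto
  then show 1: "(LBINT v:{0..b}. h v) = (LBINT v:{0..a}. h v) + (LBINT v:{a<..b}. h v)"
    using set_integral_Un[OF _ h_int[of 0 a] i] by (simp add: disjoint_iff)
  have "AE v in lborel. (v \<in> {a<..b}) = (v \<in> {a..b})"
    using AE_lborel_singleton[of a] by eventually_elim auto
  then have "(LBINT v:{a<..b}. h v) = (LBINT v:{a..b}. h v)"
    by (intro set_integral_cong_set) (auto simp: set_borel_measurable_def)
  with 1 show "(LBINT v:{0..b}. h v) = (LBINT v:{0..a}. h v) + (LBINT v:{a..b}. h v)" by simp
qed

lemma primitive_strict:
  assumes "0 \<le> a" "a < b"
  shows "(LBINT v:{0..a}. h v) < (LBINT v:{0..b}. h v)"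
proof -
  have "0 < (LBINT v:{a..b}. h v)"
  proof -
    note [measurable] = density_measurable
    have "0 \<le> (LBINT v:{a..b}. h v)" unfolding set_lebesgue_integral_def
      using h_pos by (intro integral_nonneg_AE) (auto simp: less_imp_le)
    moreover have "(LBINT v:{a..b}. h v) \<noteq> 0"
    proof
      assume "(LBINT v:{a..b}. h v) = 0"
      then have "AE v in lborel. indicator {a..b} v *\<^sub>R h v = 0"
        unfolding set_lebesgue_integral_def
        by (subst (asm) integral_nonneg_eq_0_iff_AE[OF h_int[of a b, unfolded set_integrable_def]])
          (simp_all add: h_pos less_imp_le)
      then have "AE v in lborel. v \<notin> {a..b}"
      proof eventually_elim
        case (elim v)
        then show ?case using h_pos[of v] by (cases "v \<in> {a..b}") auto
      qed
      then have "emeasure lborel {a..b} = 0" by (subst (asm) AE_iff_measurable[where N="{a..b}"]) auto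
      then show False using assms by (simp add: emeasure_lborel_Icc_eq)
    qed
    ultimately show ?thesis by linarith
  qed
  then show ?thesis using primitive_split(2)[of a b] assms by auto
qed

lemma primitive_zero: "(LBINT v:{0..(0::real)}. h v) = 0"
proof -
  have "AE v in lborel. indicat_real {0..0} v *\<^sub>R h v = 0"
    using AE_lborel_singleton[of 0] by eventually_elim auto
  then show ?thesis unfolding set_lebesgue_integral_def by (rule integral_eq_zero_AE)
qed

lemma primitive_continuous: "continuous_on {0..} (\<lambda>u. LBINT v:{0..u}. h v)"
proof -
  have "continuous_on {0..b} (\<lambda>u. LBINT v:{0..u}. h v)" for b
  proof -
    have "h integrable_on {0..b}" using set_borel_integral_eq_integral(1)[OF h_int[of 0 b]] .
    then have "continuous_on {0..b} (\<lambda>u. integral {0..u} h)" by (rule indefinite_integral_continuous_1)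
    then show ?thesis using set_borel_integral_eq_integral(2)[OF h_int] by simp
  qed
  note c = this
  show ?thesis
    unfolding continuous_on_eq_continuous_within
  proof
    fix x :: real assume x: "x \<in> {0..}"
    have "at x within {0..x+1} = at x within {0..}"
      by (rule at_within_nhd[of _ "{..<x+1}"]) auto
    moreover have "continuous (at x within {0..x+1}) (\<lambda>u. LBINT v:{0..u}. h v)"
      using c[of "x+1"] x by (auto simp: continuous_on_eq_continuous_within)
    ultimately show "continuous (at x within {0..}) (\<lambda>u. LBINT v:{0..u}. h v)" by simp
  qed
qed

lemma primitive_measurable: "(\<lambda>u. LBINT v:{0..u}. h v) \<in> borel_measurable borel"
proof (rule borel_measurable_mono, rule monoI)
  fix a b :: real assume "a \<le> b"
  show "(LBINT v:{0..a}. h v) \<le> (LBINT v:{0..b}. h v)"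
    unfolding set_lebesgue_integral_def
  proof (rule integral_mono)
    fix v show "indicat_real {0..a} v *\<^sub>R h v \<le> indicat_real {0..b} v *\<^sub>R h v"
      using h_pos[of v] \<open>a \<le> b\<close> by (cases "v \<in> {0..a}") (auto simp: indicator_def)
  qed (use h_int[unfolded set_integrable_def] in auto)
qed

lemma primitive_nn:
  assumes "set_integrable lborel A h"
  shows "(\<integral>\<^sup>+v\<in>A. h v \<partial>lborel) = ennreal (LBINT v:A. h v)"
proof -
  have "(\<integral>\<^sup>+v\<in>A. h v \<partial>lborel) = (\<integral>\<^sup>+v. ennreal (indicator A v *\<^sub>R h v) \<partial>lborel)"
    by (intro nn_integral_cong) (auto split: split_indicator)
  also have "\<dots> = ennreal (LBINT v:A. h v)"
    unfolding set_lebesgue_integral_def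
    by (rule nn_integral_eq_integral)
      (use assms h_pos in \<open>simp_all add: set_integrable_def less_imp_le\<close>)
  finally show ?thesis .
qed

text \<open>Finite measures on the line are determined by half-lines \<open>{x<..}\<close>.
  Continuity and strict growth of the primitive turn the preimage of such a half-line into
  \<open>{v0<..T}\<close>, whose mass is a difference of two values of the primitive.\<close>

lemma primitive_distr:
  assumes T: "0 \<le> T"
  shows "distr (density lborel (\<lambda>v. ennreal (h v) * indicator {0..T} v)) borel (\<lambda>u. LBINT v:{0..u}. h v)
     = density lborel (indicator {0..(LBINT v:{0..T}. h v)})" (is "distr ?D borel ?G = ?R")
proof (rule measure_eqI_lessThan)
  note [measurable] = density_measurable primitive_measurable
  have G0: "?G 0 = 0" by (rule primitive_zero)
  have Gmono: "?G a \<le> ?G b" if "0 \<le> a" "a \<le> b" for a b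
    using primitive_strict[of a b] that by (cases "a = b") auto
  have tot: "(\<integral>\<^sup>+v. ennreal (h v) * indicator {0..T} v \<partial>lborel) = ennreal (?G T)"
    using primitive_nn[OF h_int, of 0 T] by simp
  have eq: "emeasure (distr ?D borel ?G) {x<..} = emeasure ?R {x<..}" for x
  proof -
    have L: "emeasure (distr ?D borel ?G) {x<..} = (\<integral>\<^sup>+v. ennreal (h v) * indicator {v\<in>{0..T}. x < ?G v} v \<partial>lborel)"
      using measurable_sets_borel[OF primitive_measurable, of "{x<..}"]
      by (subst emeasure_distr, simp, simp, subst emeasure_density)
        (auto intro!: nn_integral_cong simp: indicator_def)
    have R: "emeasure ?R {x<..} = emeasure lborel ({0..?G T} \<inter> {x<..})"
      by (subst emeasure_density) (auto simp: nn_integral_indicator[symmetric] indicator_inter_arith intro!: nn_integral_cong simp del: nn_integral_indicator)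
    consider "x < 0" | "0 \<le> x" "x < ?G T" | "0 \<le> x" "?G T \<le> x" by linarith
    then show ?thesis
    proof cases
      case 1
      have "{v\<in>{0..T}. x < ?G v} = {0..T}" using 1 Gmono[of 0] G0 by force
      moreover have "{0..?G T} \<inter> {x<..} = {0..?G T}" using 1 by auto
      ultimately show ?thesis using L R tot Gmono[OF order_refl T] G0 by (simp add: emeasure_lborel_Icc_eq)
    next
      case 2
      have "\<exists>v0\<ge>0. v0 \<le> T \<and> ?G v0 = x"
        by (rule IVT') (use 2 assms G0 continuous_on_subset[OF primitive_continuous, of "{0..T}"] in auto)
      then obtain v0 where v0: "0 \<le> v0" "v0 \<le> T" "?G v0 = x" by auto
      have s: "{v\<in>{0..T}. x < ?G v} = {v0<..T}"
      proof safe
        fix v assume "x < ?G v" "v \<in> {0..T}"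
        then show "v \<in> {v0<..T}" using Gmono[of v v0] v0 by (cases "v \<le> v0") auto
      next
        fix v assume "v \<in> {v0<..T}"
        then show "x < ?G v" "v \<in> {0..T}" using primitive_strict[of v0 v] v0 by auto
      qed
      have s2: "{0..?G T} \<inter> {x<..} = {x<..?G T}" using 2 by auto
      have "?G T = x + (LBINT v:{v0<..T}. h v)" using primitive_split(1)[OF v0(1,2)] v0 by simp
      moreover have "{v0<..T} \<subseteq> {v0..T}" by auto
      ultimately show ?thesis using L R s s2 primitive_nn[OF set_integrable_subset[OF h_int[of v0 T], of "{v0<..T}"]] 2 by simp
    next
      case 3
      have "{v\<in>{0..T}. x < ?G v} = {}" using 3 Gmono by fastforce
      moreover have "{0..?G T} \<inter> {x<..} = {}" using 3 by auto
      ultimately show ?thesis using L R by (simp del: Int_greaterThanAtMost)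
    qed
  qed
  then show "\<And>x. emeasure (distr ?D borel ?G) {x<..} = emeasure ?R {x<..}" .
  show "emeasure (distr ?D borel ?G) {x<..} < \<infinity>" for x
  proof -
    have "emeasure (distr ?D borel ?G) {x<..} \<le> emeasure ?D (space ?D)"
      by (subst emeasure_distr) (auto intro!: emeasure_mono)
    also have "\<dots> = ennreal (?G T)" by (subst emeasure_density) (use tot in auto)
    finally show ?thesis by (simp add: order_le_less_trans)
  qed
qed auto

lemma primitive_substitution:
  assumes "0 \<le> T" and [measurable]: "\<phi> \<in> borel_measurable borel"
  shows "(\<integral>\<^sup>+r\<in>{0..(LBINT v:{0..T}. h v)}. \<phi> r \<partial>lborel)
    = (\<integral>\<^sup>+v\<in>{0..T}. ennreal (h v) * \<phi> (LBINT w:{0..v}. h w) \<partial>lborel)"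
proof -
  note [measurable] = density_measurable primitive_measurable
  have "(\<integral>\<^sup>+r\<in>{0..(LBINT v:{0..T}. h v)}. \<phi> r \<partial>lborel) = (\<integral>\<^sup>+r. \<phi> r \<partial>density lborel (indicator {0..(LBINT v:{0..T}. h v)}))"
    by (subst nn_integral_density) (auto simp: mult.commute)
  also have "\<dots> = (\<integral>\<^sup>+v. \<phi> (LBINT w:{0..v}. h w) \<partial>density lborel (\<lambda>v. ennreal (h v) * indicator {0..T} v))"
    by (subst primitive_distr[OF assms(1), symmetric], subst nn_integral_distr) auto
  also have "\<dots> = (\<integral>\<^sup>+v\<in>{0..T}. ennreal (h v) * \<phi> (LBINT w:{0..v}. h w) \<partial>lborel)"
    by (subst nn_integral_density) (auto intro!: nn_integral_cong simp: ac_simps)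
  finally show ?thesis .
qed

end

text \<open>Here \<open>\<psi>\<close> is known only at values of the primitive. On that range it
  equals \<open>g\<close> composed with the inverse of the primitive, and the inverse, extended
  monotonically to the whole line, is Borel; the change of variables is applied to this measurable
  version.\<close>

lemma primitive_substitution_inverse:
  fixes h g \<psi> :: "real \<Rightarrow> real"
  assumes h_pos: "\<And>v. 0 < h v" and h_int: "\<And>a b. set_integrable lborel {a..b} h"
    and T: "0 \<le> T" and [measurable]: "g \<in> borel_measurable borel"
    and g_nonneg: "\<And>v. 0 \<le> v \<Longrightarrow> v \<le> T \<Longrightarrow> 0 \<le> g v"
    and \<psi>: "\<And>v. 0 \<le> v \<Longrightarrow> v \<le> T \<Longrightarrow> \<psi> (LBINT w:{0..v}. h w) = g v"
  shows "(LBINT r:{0..(LBINT v:{0..T}. h v)}. \<psi> r) = (LBINT v:{0..T}. h v * g v)"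
proof -
  define G where "G u = (LBINT v:{0..u}. h v)" for u
  note [measurable] = density_measurable[OF h_pos h_int]
  have G0: "G 0 = 0" unfolding G_def by (rule primitive_zero[OF h_pos h_int])
  have Gstrict: "G a < G b" if "0 \<le> a" "a < b" for a b
    unfolding G_def by (rule primitive_strict[OF h_pos h_int that])
  have Gmono: "G a \<le> G b" if "0 \<le> a" "a \<le> b" for a b
    using Gstrict[of a b] that by (cases "a = b") auto
  define S where "S r = {u. 0 \<le> u \<and> u \<le> T \<and> (u = 0 \<or> G u \<le> r)}" for r
  define Gi where "Gi r = Sup (S r)" for r
  have Smem: "0 \<in> S r" for r using T by (simp add: S_def)
  have Sbdd: "bdd_above (S r)" for r by (rule bdd_aboveI[of _ T]) (simp add: S_def)
  have [measurable]: "Gi \<in> borel_measurable borel"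
  proof (rule borel_measurable_mono, rule monoI)
    fix a b :: real assume "a \<le> b"
    then have "S a \<subseteq> S b" by (auto simp: S_def)
    then show "Gi a \<le> Gi b" unfolding Gi_def using Smem[of a] Sbdd by (intro cSup_subset_mono) auto
  qed
  have GiG: "Gi (G v) = v" if "0 \<le> v" "v \<le> T" for v
  proof -
    have "S (G v) = {0..v}"
    proof (intro set_eqI iffI)
      fix u assume u: "u \<in> S (G v)"
      have "u \<le> v"
      proof (rule ccontr)
        assume "\<not> u \<le> v"
        then have "G v < G u" "u \<noteq> 0" using Gstrict[of v u] that by auto
        then show False using u by (auto simp: S_def)
      qed
      then show "u \<in> {0..v}" using u by (simp add: S_def)
    next
      fix u assume "u \<in> {0..v}" then show "u \<in> S (G v)" using that Gmono[of u v] by (auto simp: S_def)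
    qed
    then show ?thesis using that by (simp add: Gi_def)
  qed
  have rng: "\<exists>v. 0 \<le> v \<and> v \<le> T \<and> G v = r" if "0 \<le> r" "r \<le> G T" for r
  proof (rule IVT')
    show "continuous_on {0..T} G" unfolding G_def
      by (rule continuous_on_subset[OF primitive_continuous[OF h_pos h_int]]) auto
  qed (use that T G0 in auto)
  have gi: "g (Gi r) = \<psi> r \<and> 0 \<le> \<psi> r" if r: "r \<in> {0..G T}" for r
  proof -
    obtain v where v: "0 \<le> v" "v \<le> T" "G v = r" using rng[of r] r by auto
    then show ?thesis using GiG[of v] \<psi>[of v] g_nonneg[of v] by (simp add: G_def)
  qed
  have "(LBINT r:{0..G T}. \<psi> r) = (LBINT r:{0..G T}. g (Gi r))"
    by (rule set_lebesgue_integral_cong) (use gi in auto)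
  also have "\<dots> = enn2real (\<integral>\<^sup>+r. ennreal (indicator {0..G T} r *\<^sub>R g (Gi r)) \<partial>lborel)"
    unfolding set_lebesgue_integral_def
    by (rule integral_eq_nn_integral) (use gi in \<open>auto simp: indicator_def\<close>)
  also have "(\<integral>\<^sup>+r. ennreal (indicator {0..G T} r *\<^sub>R g (Gi r)) \<partial>lborel) = (\<integral>\<^sup>+r\<in>{0..G T}. ennreal (g (Gi r)) \<partial>lborel)"
    by (intro nn_integral_cong) (auto simp: indicator_def)
  also have "\<dots> = (\<integral>\<^sup>+v\<in>{0..T}. ennreal (h v) * ennreal (g (Gi (G v))) \<partial>lborel)"
    unfolding G_def by (rule primitive_substitution[OF h_pos h_int T]) simp
  also have "\<dots> = (\<integral>\<^sup>+v. ennreal (indicator {0..T} v *\<^sub>R (h v * g v)) \<partial>lborel)"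
  proof (intro nn_integral_cong)
    fix v show "ennreal (h v) * ennreal (g (Gi (G v))) * indicator {0..T} v = ennreal (indicator {0..T} v *\<^sub>R (h v * g v))"
      using GiG[of v] g_nonneg[of v] h_pos[of v]
      by (cases "v \<in> {0..T}") (simp_all add: ennreal_mult less_imp_le)
  qed
  also have "enn2real \<dots> = (LBINT v:{0..T}. h v * g v)"
    unfolding set_lebesgue_integral_def
    by (rule integral_eq_nn_integral[symmetric]) (use g_nonneg h_pos in \<open>auto simp: indicator_def less_imp_le\<close>)
  finally show ?thesis unfolding G_def .
qed

lemma ereal_le_realI:
  assumes "\<And>r. t < r \<Longrightarrow> x \<le> ereal r" shows "x \<le> ereal t"
proof (rule ccontr)
  assume "\<not> x \<le> ereal t"
  then have "ereal t < x" by simp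
  then obtain r where "ereal t < ereal r" "ereal r < x" using ereal_dense2 by blast
  then show False using assms[of r] by simp
qed

section \<open>The clock of a Lamperti path and its range\<close>

definition ou_clock :: "real \<Rightarrow> real \<Rightarrow> (real \<Rightarrow> real) \<Rightarrow> real \<Rightarrow> real" where
  "ou_clock \<alpha> lam f u = ln (1 + \<alpha> * lam * lamperti_V \<alpha> f u) / (\<alpha> * lam)"

text \<open>All that later arguments use about a path of U: its values along the clock, and that the
  clock sweeps out exactly the times before the first zero. The Lamperti path and the recurrent
  extension both have these properties, so the two cases merge here.\<close>

definition time_changed_path :: "real \<Rightarrow> real \<Rightarrow> (real \<Rightarrow> real) \<Rightarrow> (real \<Rightarrow> real) \<Rightarrow> bool" where
  "time_changed_path \<alpha> lam f U \<longleftrightarrow>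
     (\<forall>u\<ge>0. U (ou_clock \<alpha> lam f u) = exp (f u) * (1 + \<alpha> * lam * lamperti_V \<alpha> f u) powr (- 1 / \<alpha>)) \<and>
     (\<forall>s\<ge>0. ereal s < hit_zero U \<longleftrightarrow> s \<in> ou_clock \<alpha> lam f ` {0..})"

lemma lamperti_V_max: "lamperti_V \<alpha> f u = (LBINT s:{0..u}. exp (\<alpha> * f (max 0 s)))"
  unfolding lamperti_V_def by (rule set_lebesgue_integral_cong) auto

lemma lamperti_V_nonneg: "0 \<le> lamperti_V \<alpha> f u"
  unfolding lamperti_V_def set_lebesgue_integral_def by (rule integral_nonneg_AE) auto

context
  fixes \<alpha> lam :: real and f :: "real \<Rightarrow> real" and E :: "real set"
  assumes \<alpha>: "0 < \<alpha>" and lam: "0 < lam" and f: "cadlag_in E f"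
begin

lemma lamperti_V_0: "lamperti_V \<alpha> f 0 = 0"
  unfolding lamperti_V_max by (rule primitive_zero[OF _ cadlag_exp_integrable[OF f]]) auto

lemma lamperti_V_strict: "0 \<le> a \<Longrightarrow> a < b \<Longrightarrow> lamperti_V \<alpha> f a < lamperti_V \<alpha> f b"
  unfolding lamperti_V_max by (rule primitive_strict[OF _ cadlag_exp_integrable[OF f]]) auto

lemma lamperti_V_less_iff: "0 \<le> a \<Longrightarrow> 0 \<le> b \<Longrightarrow> lamperti_V \<alpha> f a < lamperti_V \<alpha> f b \<longleftrightarrow> a < b"
  using lamperti_V_strict[of a b] lamperti_V_strict[of b a] by (cases a b rule: linorder_cases) auto

lemma lamperti_V_continuous: "continuous_on {0..} (lamperti_V \<alpha> f)"
  using primitive_continuous[OF _ cadlag_exp_integrable[OF f, where c=\<alpha>]] unfolding lamperti_V_max[abs_def] by simp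

lemma lamperti_V_measurable: "lamperti_V \<alpha> f \<in> borel_measurable borel"
  using primitive_measurable[OF _ cadlag_exp_integrable[OF f, where c=\<alpha>]] unfolding lamperti_V_max[abs_def] by simp

text \<open>\<open>lamperti_V\<close> is continuous and starts from 0, so a missed level lies above
  its whole range.\<close>

lemma lamperti_V_image:
  assumes "t \<notin> lamperti_V \<alpha> f ` {0..}" "0 \<le> t" "0 \<le> u" shows "lamperti_V \<alpha> f u < t"
proof (rule ccontr)
  assume "\<not> lamperti_V \<alpha> f u < t"
  then have "\<exists>v. 0 \<le> v \<and> v \<le> u \<and> lamperti_V \<alpha> f v = t"
    by (intro IVT') (use assms lamperti_V_0 continuous_on_subset[OF lamperti_V_continuous, of "{0..u}"] in auto)
  then show False using assms by auto
qed

lemma chi_V_pos: "0 < 1 + \<alpha> * lam * lamperti_V \<alpha> f u"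
  using \<alpha> lam lamperti_V_nonneg[of \<alpha> f u] by (intro add_pos_nonneg) auto

lemma ou_clock_0: "ou_clock \<alpha> lam f 0 = 0"
  by (simp add: ou_clock_def lamperti_V_0)

lemma ou_clock_less_iff:
  assumes "0 \<le> a" "0 \<le> b" shows "ou_clock \<alpha> lam f a < ou_clock \<alpha> lam f b \<longleftrightarrow> a < b"
proof -
  have "0 < \<alpha> * lam" using \<alpha> lam by simp
  moreover from this have "\<not> \<alpha> * lam < 0" by linarith
  ultimately show ?thesis using lamperti_V_less_iff[OF assms] chi_V_pos \<alpha> lam
    by (simp add: ou_clock_def divide_less_cancel mult_less_cancel_left_pos)
qed

lemma ou_clock_le_iff:
  assumes "0 \<le> a" "0 \<le> b" shows "ou_clock \<alpha> lam f a \<le> ou_clock \<alpha> lam f b \<longleftrightarrow> a \<le> b"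
  using ou_clock_less_iff[OF assms(2,1)] by linarith

lemma ou_clock_nonneg: "0 \<le> u \<Longrightarrow> 0 \<le> ou_clock \<alpha> lam f u"
  using ou_clock_le_iff[of 0 u] ou_clock_0 by simp

lemma ou_clock_continuous: "continuous_on {0..} (ou_clock \<alpha> lam f)"
  unfolding ou_clock_def
  by (intro continuous_intros lamperti_V_continuous) (use \<alpha> lam chi_V_pos in \<open>auto simp: less_imp_neq[THEN not_sym]\<close>)

lemma ou_clock_density:
  "0 < exp (\<alpha> * f (max 0 v)) / (1 + \<alpha> * lam * lamperti_V \<alpha> f (max 0 v))"
  "set_integrable lborel {a..b} (\<lambda>v. exp (\<alpha> * f (max 0 v)) / (1 + \<alpha> * lam * lamperti_V \<alpha> f (max 0 v)))"
proof -
  show "0 < exp (\<alpha> * f (max 0 v)) / (1 + \<alpha> * lam * lamperti_V \<alpha> f (max 0 v))" using chi_V_pos by simp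
  note [measurable] = cadlag_in_measurable[OF f] lamperti_V_measurable
  show "set_integrable lborel {a..b} (\<lambda>v. exp (\<alpha> * f (max 0 v)) / (1 + \<alpha> * lam * lamperti_V \<alpha> f (max 0 v)))"
    unfolding set_integrable_def
  proof (rule Bochner_Integration.integrable_bound[OF cadlag_exp_integrable[OF f, unfolded set_integrable_def, of a b \<alpha>]])
    have "exp (\<alpha> * f (max 0 v)) / (1 + \<alpha> * lam * lamperti_V \<alpha> f (max 0 v)) \<le> exp (\<alpha> * f (max 0 v)) / 1" for v
      using \<alpha> lam lamperti_V_nonneg[of \<alpha> f "max 0 v"] chi_V_pos[of "max 0 v"] by (intro divide_left_mono) auto
    then show "AE v in lborel. norm (indicat_real {a..b} v *\<^sub>R (exp (\<alpha> * f (max 0 v)) / (1 + \<alpha> * lam * lamperti_V \<alpha> f (max 0 v))))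
       \<le> norm (indicat_real {a..b} v *\<^sub>R exp (\<alpha> * f (max 0 v)))"
      using chi_V_pos by (intro AE_I2) (auto simp: indicator_def less_imp_le abs_of_pos)
  qed simp
qed

text \<open>Substitute \<open>r = lamperti_V \<alpha> f v\<close> in the integral of
  \<open>1 / (1 + \<alpha> * lam * r)\<close>. The integrand on the left is thus the density of the
  clock in Levy time.\<close>

lemma ou_clock_integral_max:
  assumes "0 \<le> u"
  shows "(LBINT v:{0..u}. exp (\<alpha> * f (max 0 v)) / (1 + \<alpha> * lam * lamperti_V \<alpha> f (max 0 v))) = ou_clock \<alpha> lam f u"
proof -
  note [measurable] = cadlag_in_measurable[OF f] lamperti_V_measurable
  have "(LBINT r:{0..lamperti_V \<alpha> f u}. 1 / (1 + \<alpha> * lam * r)) =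
     (LBINT v:{0..u}. exp (\<alpha> * f (max 0 v)) * (1 / (1 + \<alpha> * lam * lamperti_V \<alpha> f (max 0 v))))"
    unfolding lamperti_V_max[of \<alpha> f u]
  proof (rule primitive_substitution_inverse)
    show "1 / (1 + \<alpha> * lam * (LBINT w:{0..v}. exp (\<alpha> * f (max 0 w)))) = 1 / (1 + \<alpha> * lam * lamperti_V \<alpha> f (max 0 v))"
      if "0 \<le> v" for v using that by (simp add: lamperti_V_max[of \<alpha> f v])
    show "0 \<le> 1 / (1 + \<alpha> * lam * lamperti_V \<alpha> f (max 0 v))" for v using chi_V_pos[of "max 0 v"] by simp
  qed (use assms cadlag_exp_integrable[OF f] in auto)
  also have "\<dots> = (LBINT v:{0..u}. exp (\<alpha> * f (max 0 v)) / (1 + \<alpha> * lam * lamperti_V \<alpha> f (max 0 v)))" by simp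
  also have "(LBINT r:{0..lamperti_V \<alpha> f u}. 1 / (1 + \<alpha> * lam * r)) = ou_clock \<alpha> lam f u"
  proof -
    let ?F = "\<lambda>r. ln (1 + \<alpha> * lam * r) / (\<alpha> * lam)"
    have pos: "0 < 1 + \<alpha> * lam * r" if "0 \<le> r" for r using that \<alpha> lam by (intro add_pos_nonneg) auto
    have "(LBINT r:{0..lamperti_V \<alpha> f u}. 1 / (1 + \<alpha> * lam * r)) = ?F (lamperti_V \<alpha> f u) - ?F 0"
      unfolding set_lebesgue_integral_def real_scaleR_def
      by (subst mult.commute, rule integral_FTC_Icc_real)
        (use pos \<alpha> lam lamperti_V_nonneg[of \<alpha> f u] in \<open>auto intro!: derivative_eq_intros continuous_intros simp: less_imp_neq[THEN not_sym]\<close>)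
    then show ?thesis by (simp add: ou_clock_def)
  qed
  finally show ?thesis by simp
qed

lemma ou_clock_integral:
  assumes "0 \<le> u"
  shows "(LBINT v:{0..u}. exp (\<alpha> * f v) / (1 + \<alpha> * lam * lamperti_V \<alpha> f v)) = ou_clock \<alpha> lam f u"
  unfolding ou_clock_integral_max[OF assms, symmetric]
  by (rule set_lebesgue_integral_cong) auto

text \<open>Along the clock \<open>U powr (-\<alpha>)\<close> is the reciprocal of the clock's own
  density, so the substituted integrand collapses to 1. The inverse form of the substitution is used
  because \<open>U\<close> is known only on the range of the clock.\<close>

lemma up_clock_ou_clock:
  assumes U: "\<And>v. 0 \<le> v \<Longrightarrow> U (ou_clock \<alpha> lam f v) = exp (f v) * (1 + \<alpha> * lam * lamperti_V \<alpha> f v) powr (- 1 / \<alpha>)"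
    and "0 \<le> u"
  shows "up_clock \<alpha> U (ou_clock \<alpha> lam f u) = u"
proof -
  note [measurable] = cadlag_in_measurable[OF f] lamperti_V_measurable
  let ?h = "\<lambda>v. exp (\<alpha> * f (max 0 v)) / (1 + \<alpha> * lam * lamperti_V \<alpha> f (max 0 v))"
  have "(LBINT r:{0..(LBINT v:{0..u}. ?h v)}. U r powr (-\<alpha>)) = (LBINT v:{0..u}. ?h v * inverse (?h v))"
  proof (rule primitive_substitution_inverse)
    fix v :: real assume v: "0 \<le> v"
    let ?c = "1 + \<alpha> * lam * lamperti_V \<alpha> f v"
    have "(exp (f v) * ?c powr (- 1 / \<alpha>)) powr (-\<alpha>) = exp (f v) powr (-\<alpha>) * (?c powr (- 1 / \<alpha>)) powr (-\<alpha>)"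
      by (simp add: powr_mult)
    also have "(?c powr (- 1 / \<alpha>)) powr (-\<alpha>) = ?c" using \<alpha> chi_V_pos[of v] by (simp add: powr_powr)
    also have "exp (f v) powr (-\<alpha>) = exp (- \<alpha> * f v)" by (simp add: powr_def)
    finally show "U (LBINT v:{0..v}. ?h v) powr (-\<alpha>) = inverse (?h v)"
      using v unfolding ou_clock_integral_max[OF v] U[OF v] by (simp add: exp_minus field_simps)
  qed (use ou_clock_density assms(2) chi_V_pos in \<open>auto simp: less_imp_le\<close>)
  also have "\<dots> = (LBINT v:{0..u}. 1)"
    by (rule set_lebesgue_integral_cong)
      (use chi_V_pos[THEN less_imp_neq, THEN not_sym] in auto)
  also have "\<dots> = u" using assms(2) by (simp add: set_lebesgue_integral_def)
  finally show ?thesis unfolding up_clock_def ou_clock_integral_max[OF assms(2)] .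
qed

lemma lamperti_on_image:
  assumes "0 \<le> u" shows "lamperti \<alpha> f (lamperti_V \<alpha> f u) = exp (f u)"
proof -
  have "lamperti_A \<alpha> f (lamperti_V \<alpha> f u) = ereal u"
    unfolding lamperti_A_def
  proof (rule antisym)
    show "ereal u \<le> Inf {ereal w |w. 0 \<le> w \<and> lamperti_V \<alpha> f u < lamperti_V \<alpha> f w}"
      by (rule Inf_greatest) (use assms lamperti_V_less_iff in \<open>auto intro: less_imp_le\<close>)
    show "Inf {ereal w |w. 0 \<le> w \<and> lamperti_V \<alpha> f u < lamperti_V \<alpha> f w} \<le> ereal u"
    proof (rule ereal_le_realI)
      fix w assume "u < w"
      then show "Inf {ereal w |w. 0 \<le> w \<and> lamperti_V \<alpha> f u < lamperti_V \<alpha> f w} \<le> ereal w"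
        using assms lamperti_V_strict[of u w] by (intro Inf_lower) auto
    qed
  qed
  then show ?thesis by (simp add: lamperti_def)
qed

lemma lamperti_off_image:
  assumes "0 \<le> t" "t \<notin> lamperti_V \<alpha> f ` {0..}" shows "lamperti \<alpha> f t = 0"
proof -
  have "{ereal w |w. 0 \<le> w \<and> t < lamperti_V \<alpha> f w} = {}"
    using lamperti_V_image[OF assms(2,1)] by (auto simp: not_less less_imp_le dest: less_asym)
  then have "lamperti_A \<alpha> f t = \<infinity>" unfolding lamperti_A_def by (simp only: Inf_empty top_ereal_def)
  then show ?thesis by (simp add: lamperti_def)
qed

lemma off_image_mono:
  assumes "0 \<le> t" "t \<notin> lamperti_V \<alpha> f ` {0..}" "t \<le> t'" shows "t' \<notin> lamperti_V \<alpha> f ` {0..}"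
  using lamperti_V_image[OF assms(2,1)] assms(3) by force

lemma hit_zero_lamperti:
  assumes "0 \<le> t" "t \<notin> lamperti_V \<alpha> f ` {0..}"
  shows "hit_zero (lamperti \<alpha> f) \<le> ereal t"
\<comment> \<open>At \<open>t\<close> itself the left limit need not vanish, whereas before every
  later time the path is already 0 on a left neighbourhood.\<close>
proof (rule ereal_le_realI)
  fix r assume r: "t < r"
  have z: "lamperti \<alpha> f s = 0" if "t \<le> s" for s
    using lamperti_off_image[of s] off_image_mono[OF assms that] assms(1) that by auto
  have "eventually (\<lambda>s. lamperti \<alpha> f s = 0) (at r within {0..<r})"
    unfolding eventually_at using r z by (intro exI[of _ "r - t"]) (auto simp: dist_real_def)
  then have "(lamperti \<alpha> f \<longlongrightarrow> 0) (at r within {0..<r})" by (rule tendsto_eventually)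
  then show "hit_zero (lamperti \<alpha> f) \<le> ereal r" unfolding hit_zero_def
    using z[of r] assms(1) r by (intro Inf_lower) auto
qed

lemma hit_zero_lamperti_ge:
  assumes "0 \<le> u" "\<And>v. 0 \<le> v \<Longrightarrow> X (lamperti_V \<alpha> f v) = exp (f v)"
  shows "ereal (lamperti_V \<alpha> f u) \<le> hit_zero X"
  unfolding hit_zero_def
proof (rule Inf_greatest, clarify)
  fix t assume t: "0 \<le> t" "X t = 0"
  have "t \<notin> lamperti_V \<alpha> f ` {0..}" using assms(2) t by force
  then show "ereal (lamperti_V \<alpha> f u) \<le> ereal t" using lamperti_V_image[of t u] t assms(1) by simp
qed

text \<open>\<open>e\<close> is the deterministic time change of the OU transform; it increases
  continuously from 0 and maps the clock to \<open>lamperti_V\<close>, while the factor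
  \<open>exp (- lam * t)\<close> never vanishes. Values and zeros, together with the left limits at
  zeros, therefore carry over from \<open>X\<close> to \<open>U\<close>.\<close>

lemma time_changed_pathI:
  assumes XV: "\<And>u. 0 \<le> u \<Longrightarrow> X (lamperti_V \<alpha> f u) = exp (f u)"
    and hit: "\<And>t. 0 \<le> t \<Longrightarrow> t \<notin> lamperti_V \<alpha> f ` {0..} \<Longrightarrow> hit_zero X \<le> ereal t"
    and U: "\<And>t. 0 \<le> t \<Longrightarrow> U t = OU_transform \<alpha> lam X t"
  shows "time_changed_path \<alpha> lam f U"
proof -
  define ch where "ch = \<alpha> * lam"
  have ch: "0 < ch" using \<alpha> lam by (simp add: ch_def)
  define e where "e t = (exp (ch * t) - 1) / ch" for t
  have e_clock: "e (ou_clock \<alpha> lam f u) = lamperti_V \<alpha> f u" for u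
    using \<alpha> lam chi_V_pos[of u] by (simp add: e_def ou_clock_def ch_def)
  have e_inv: "ln (1 + ch * e t) / ch = t" for t using ch by (simp add: e_def)
  have e_less: "e s < e t \<longleftrightarrow> s < t" for s t using ch by (simp add: e_def divide_less_cancel mult_less_cancel_left_pos)
  have e_nonneg: "0 \<le> e t" if "0 \<le> t" for t using ch that by (simp add: e_def)
  have img: "s \<in> ou_clock \<alpha> lam f ` {0..} \<longleftrightarrow> e s \<in> lamperti_V \<alpha> f ` {0..}" for s
  proof
    assume "e s \<in> lamperti_V \<alpha> f ` {0..}"
    then obtain u where "0 \<le> u" "e s = lamperti_V \<alpha> f u" by auto
    then have "s = ou_clock \<alpha> lam f u" using e_inv[of s] by (simp add: ou_clock_def ch_def)
    then show "s \<in> ou_clock \<alpha> lam f ` {0..}" using \<open>0 \<le> u\<close> by auto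
  qed (auto simp: e_clock)
  have UX: "U t = exp (- lam * t) * X (e t)" if "0 \<le> t" for t
    using U[OF that] by (simp add: OU_transform_def e_def ch_def)
  have 1: "U (ou_clock \<alpha> lam f u) = exp (f u) * (1 + \<alpha> * lam * lamperti_V \<alpha> f u) powr (- 1 / \<alpha>)" if "0 \<le> u" for u
  proof -
    have "exp (- lam * ou_clock \<alpha> lam f u) = (1 + \<alpha> * lam * lamperti_V \<alpha> f u) powr (- 1 / \<alpha>)"
      using chi_V_pos[of u] \<alpha> lam by (auto simp: powr_def ou_clock_def)
    then show ?thesis using UX[OF ou_clock_nonneg[OF that]] XV[OF that] by (simp add: e_clock)
  qed
  have 2: "ereal s < hit_zero U \<longleftrightarrow> s \<in> ou_clock \<alpha> lam f ` {0..}" if s: "0 \<le> s" for s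
  proof
    assume "s \<in> ou_clock \<alpha> lam f ` {0..}"
    then obtain u where u: "0 \<le> u" "s = ou_clock \<alpha> lam f u" by auto
    \<comment> \<open>Comparing with time \<open>u + 1\<close> instead of \<open>u\<close> yields
      the strict inequality.\<close>
    have "ereal (ou_clock \<alpha> lam f (u + 1)) \<le> hit_zero U"
      unfolding hit_zero_def
    proof (rule Inf_greatest, clarify)
      fix t assume t: "0 \<le> t" "U t = 0"
      then have "X (e t) = 0" using UX[OF t(1)] by simp
      then have "e t \<notin> lamperti_V \<alpha> f ` {0..}" using XV by force
      then have "lamperti_V \<alpha> f (u + 1) < e t" using lamperti_V_image[of "e t" "u + 1"] e_nonneg[OF t(1)] u by simp
      then show "ereal (ou_clock \<alpha> lam f (u + 1)) \<le> ereal t" by (simp add: e_clock[symmetric] e_less less_imp_le)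
    qed
    moreover have "s < ou_clock \<alpha> lam f (u + 1)" using u ou_clock_less_iff[of u "u+1"] by simp
    ultimately show "ereal s < hit_zero U" by (meson less_ereal.simps(1) less_le_trans)
  next
    assume less: "ereal s < hit_zero U"
    show "s \<in> ou_clock \<alpha> lam f ` {0..}"
    proof (rule ccontr)
      assume "s \<notin> ou_clock \<alpha> lam f ` {0..}"
      then have hX: "hit_zero X \<le> ereal (e s)" using hit[of "e s"] e_nonneg[OF s] img by simp
      \<comment> \<open>The infimum for \<open>X\<close> need not be attained, so some room between
        \<open>s\<close> and the first zero of \<open>U\<close> is needed. It supplies a zero
        \<open>t\<close> of \<open>X\<close> before \<open>e s'\<close>, and the preimage
        \<open>s2\<close> of \<open>t\<close> is a zero of \<open>U\<close> that comes too
        early.\<close>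
      obtain s' where s': "s < s'" "ereal s' < hit_zero U"
        using less ereal_dense2[OF less] by auto
      have "ereal (e s) < ereal (e s')" using s' e_less by simp
      then have "hit_zero X < ereal (e s')" using hX by (rule le_less_trans[rotated])
      then obtain t where t: "0 \<le> t" "(X \<longlongrightarrow> 0) (at t within {0..<t})" "X t = 0" "t < e s'"
        unfolding hit_zero_def Inf_less_iff by auto
      define s2 where "s2 = ln (1 + ch * t) / ch"
      have "0 < 1 + ch * t" using t(1) ch by (simp add: add_pos_nonneg)
      then have es2: "e s2 = t" using ch by (simp add: e_def s2_def)
      have s2: "0 \<le> s2" using t(1) ch by (simp add: s2_def)
      have "filterlim e (at t within {0..<t}) (at s2 within {0..<s2})"
      proof -
        have "(e \<longlongrightarrow> e s2) (at s2 within {0..<s2})" unfolding e_def using ch by (intro tendsto_intros) auto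
        moreover have "eventually (\<lambda>s. s \<in> {0..<s2}) (at s2 within {0..<s2})"
          by (auto simp: eventually_at_filter)
        then have "eventually (\<lambda>s. e s \<in> {0..<t} \<and> e s \<noteq> t) (at s2 within {0..<s2})"
          by eventually_elim (metis atLeastLessThan_iff es2 e_less e_nonneg less_irrefl)
        ultimately show ?thesis by (simp add: filterlim_at es2)
      qed
      then have "((\<lambda>s. X (e s)) \<longlongrightarrow> 0) (at s2 within {0..<s2})" using t(2) by (rule filterlim_compose[rotated])
      then have "((\<lambda>s. exp (- lam * s) * X (e s)) \<longlongrightarrow> exp (- lam * s2) * 0) (at s2 within {0..<s2})"
        by (intro tendsto_intros)
      moreover have "eventually (\<lambda>s. exp (- lam * s) * X (e s) = U s) (at s2 within {0..<s2})"
        using UX by (auto simp: eventually_at_filter)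
      ultimately have "(U \<longlongrightarrow> 0) (at s2 within {0..<s2})" by (simp add: tendsto_cong)
      moreover have "U s2 = 0" using UX[OF s2] t(3) es2 by simp
      ultimately have "hit_zero U \<le> ereal s2" unfolding hit_zero_def by (intro Inf_lower) (use s2 in auto)
      moreover have "s2 < s'" using t(4) e_less[of s2 s'] es2 by simp
      ultimately show False using s'(2) by (meson ereal_less_eq(3) less_imp_le not_le order_trans)
    qed
  qed
  show ?thesis unfolding time_changed_path_def using 1 2 by simp
qed

lemma time_changed_path_lamperti:
  assumes "\<And>t. 0 \<le> t \<Longrightarrow> X t = lamperti \<alpha> f t"
    and U: "\<And>t. 0 \<le> t \<Longrightarrow> U t = OU_transform \<alpha> lam X t"
  shows "time_changed_path \<alpha> lam f U"
proof (rule time_changed_pathI[where X="lamperti \<alpha> f"])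
  show "U t = OU_transform \<alpha> lam (lamperti \<alpha> f) t" if "0 \<le> t" for t
  proof -
    have "0 \<le> (exp (\<alpha> * lam * t) - 1) / (\<alpha> * lam)" using \<alpha> lam that by simp
    then show ?thesis using U[OF that] assms(1) by (simp add: OU_transform_def)
  qed
qed (auto intro: lamperti_on_image hit_zero_lamperti)

text \<open>The first zero \<open>c\<close> of the Lamperti path lies beyond every value of
  \<open>lamperti_V\<close>. Agreement up to and including \<open>c\<close> gives
  \<open>X c = 0\<close>, and as \<open>X\<close> does not jump into 0, its left limit there
  vanishes, which is what \<open>hit_zero\<close> demands.\<close>

lemma time_changed_path_recurrent:
  assumes lamp: "\<And>t. 0 \<le> t \<Longrightarrow> ereal t \<le> hit_zero (lamperti \<alpha> f) \<Longrightarrow> X t = lamperti \<alpha> f t"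
    and left: "\<And>t. 0 < t \<Longrightarrow> X t = 0 \<Longrightarrow> (X \<longlongrightarrow> 0) (at_left t)"
    and U: "\<And>t. 0 \<le> t \<Longrightarrow> U t = OU_transform \<alpha> lam X t"
  shows "time_changed_path \<alpha> lam f U"
proof (rule time_changed_pathI[OF _ _ U])
  show "X (lamperti_V \<alpha> f u) = exp (f u)" if "0 \<le> u" for u
    using lamp[OF lamperti_V_nonneg hit_zero_lamperti_ge[OF that lamperti_on_image]] lamperti_on_image[OF that] by simp
  fix t assume t: "0 \<le> t" "t \<notin> lamperti_V \<alpha> f ` {0..}"
  have le: "hit_zero (lamperti \<alpha> f) \<le> ereal t" by (rule hit_zero_lamperti[OF t])
  have ge: "ereal (lamperti_V \<alpha> f u) \<le> hit_zero (lamperti \<alpha> f)" if "0 \<le> u" for u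
    by (rule hit_zero_lamperti_ge[OF that lamperti_on_image])
  obtain c where c: "hit_zero (lamperti \<alpha> f) = ereal c"
    using le ge[of 0] by (cases "hit_zero (lamperti \<alpha> f)") auto
  have "0 < c" using ge[of 1] c lamperti_V_strict[of 0 1] lamperti_V_0 by simp
  have "c \<notin> lamperti_V \<alpha> f ` {0..}"
  proof
    assume "c \<in> lamperti_V \<alpha> f ` {0..}"
    then obtain u where "0 \<le> u" "c = lamperti_V \<alpha> f u" by auto
    then show False using ge[of "u+1"] c lamperti_V_strict[of u "u+1"] by simp
  qed
  then have "X c = 0" using lamp[of c] c lamperti_off_image[of c] \<open>0 < c\<close> by simp
  then have "(X \<longlongrightarrow> 0) (at_left c)" using left \<open>0 < c\<close> by simp
  moreover have "at c within {0..<c} \<le> at_left c" by (rule at_le) auto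
  ultimately have "(X \<longlongrightarrow> 0) (at c within {0..<c})" by (rule tendsto_mono[rotated])
  then have "hit_zero X \<le> ereal c" unfolding hit_zero_def using \<open>X c = 0\<close> \<open>0 < c\<close> by (intro Inf_lower) auto
  then show "hit_zero X \<le> ereal t" using le c order_trans by metis
qed

end

text \<open>The clock is a continuous increasing bijection onto the times before
  \<open>hit_zero U\<close>, so infima of exit times correspond. As \<open>B\<close> is arbitrary,
  the infimum need not be attained, and the argument works with exits close to it from the
  right.\<close>

lemma exit_time_time_change:
  assumes \<alpha>: "0 < \<alpha>" and lam: "0 < lam" and f: "cadlag_in E f"
    and tc: "time_changed_path \<alpha> lam f U"
  defines "W \<equiv> \<lambda>u. U (ou_clock \<alpha> lam f u)"
  shows "exit_time B U < hit_zero U \<longleftrightarrow> exit_time B W < \<infinity>"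
    and "exit_time B W < \<infinity> \<Longrightarrow>
      0 \<le> real_of_ereal (exit_time B W) \<and>
      real_of_ereal (exit_time B U) = ou_clock \<alpha> lam f (real_of_ereal (exit_time B W))"
proof -
  let ?D = "ou_clock \<alpha> lam f"
  have hit: "ereal s < hit_zero U \<longleftrightarrow> s \<in> ?D ` {0..}" if "0 \<le> s" for s
    using tc that unfolding time_changed_path_def by blast
  note D = ou_clock_less_iff[OF \<alpha> lam f] ou_clock_le_iff[OF \<alpha> lam f] ou_clock_nonneg[OF \<alpha> lam f]
    ou_clock_0[OF \<alpha> lam f]
  have main: "exit_time B U < hit_zero U \<and> 0 \<le> real_of_ereal (exit_time B W) \<and>
      real_of_ereal (exit_time B U) = ?D (real_of_ereal (exit_time B W))" if fin: "exit_time B W < \<infinity>"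
  proof -
    have "0 \<le> exit_time B W" unfolding exit_time_def by (rule Inf_greatest) auto
    then obtain \<tau> where \<tau>: "exit_time B W = ereal \<tau>" "0 \<le> \<tau>" using fin by (cases "exit_time B W") auto
    have "exit_time B U = ereal (?D \<tau>)"
    proof (rule antisym)
      show "ereal (?D \<tau>) \<le> exit_time B U"
        unfolding exit_time_def[of B U]
      proof (rule Inf_greatest, clarify)
        fix t assume t: "0 \<le> t" "U t \<notin> B"
        show "ereal (?D \<tau>) \<le> ereal t"
        proof (rule ccontr)
          assume "\<not> ereal (?D \<tau>) \<le> ereal t"
          then have "t < ?D \<tau>" by simp
          moreover have "ereal (?D \<tau>) < hit_zero U" using hit[of "?D \<tau>"] D(3)[of \<tau>] \<tau> by simp
          ultimately have "ereal t < hit_zero U" by (meson less_ereal.simps(1) less_trans)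
          then obtain v where v: "0 \<le> v" "t = ?D v" using hit[OF t(1)] by auto
          then have "exit_time B W \<le> ereal v" unfolding exit_time_def using t by (intro Inf_lower) (auto simp: W_def)
          then have "?D \<tau> \<le> t" using \<tau> v D(2) by simp
          then show False using \<open>t < ?D \<tau>\<close> by simp
        qed
      qed
      show "exit_time B U \<le> ereal (?D \<tau>)"
      proof (rule ccontr)
        assume "\<not> exit_time B U \<le> ereal (?D \<tau>)"
        then have lt: "ereal (?D \<tau>) < exit_time B U" by simp
        have "continuous (at \<tau> within {0..}) ?D" using ou_clock_continuous[OF \<alpha> lam f] \<tau>(2) by (simp add: continuous_on_eq_continuous_within)
        then have lim: "(?D \<longlongrightarrow> ?D \<tau>) (at \<tau> within {0..})" by (simp add: continuous_within)
        \<comment> \<open>By continuity the clock stays below \<open>c\<close> shortly after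
          \<open>\<tau>\<close>, while \<open>W\<close> is outside \<open>B\<close> at times
          arbitrarily close to \<open>\<tau>\<close>; each such time gives an exit of
          \<open>U\<close> before \<open>c\<close>.\<close>
        obtain c where c: "?D \<tau> < c" "ereal c < exit_time B U" using ereal_dense2[OF lt] by auto
        have "eventually (\<lambda>v. ?D v < c) (at \<tau> within {0..})" using order_tendstoD(2)[OF lim c(1)] .
        then obtain d where d: "0 < d" "\<And>v. 0 \<le> v \<Longrightarrow> v \<noteq> \<tau> \<Longrightarrow> dist v \<tau> < d \<Longrightarrow> ?D v < c"
          unfolding eventually_at by auto
        have "exit_time B W < ereal (\<tau> + d)" using \<tau> d by simp
        then obtain v where v: "0 \<le> v" "W v \<notin> B" "v < \<tau> + d"
          unfolding exit_time_def Inf_less_iff by auto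
        have "ereal \<tau> \<le> ereal v" unfolding \<tau>(1)[symmetric] exit_time_def using v by (intro Inf_lower) auto
        then have "?D v < c" using d(2)[of v] v c(1) by (cases "v = \<tau>") (auto simp: dist_real_def)
        moreover have "exit_time B U \<le> ereal (?D v)" unfolding exit_time_def using v D(3)[of v] by (intro Inf_lower) (auto simp: W_def)
        ultimately show False using c(2) by (meson ereal_less_eq(3) leD le_less_trans less_imp_le order_trans)
      qed
    qed
    moreover have "ereal (?D \<tau>) < hit_zero U" using hit[of "?D \<tau>"] D(3)[of \<tau>] \<tau> by simp
    ultimately show ?thesis using \<tau> by simp
  qed
  show "exit_time B W < \<infinity> \<Longrightarrow>
      0 \<le> real_of_ereal (exit_time B W) \<and>
      real_of_ereal (exit_time B U) = ou_clock \<alpha> lam f (real_of_ereal (exit_time B W))"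
    using main by blast
  show "exit_time B U < hit_zero U \<longleftrightarrow> exit_time B W < \<infinity>"
  proof
    assume "exit_time B U < hit_zero U"
    then obtain t where t: "0 \<le> t" "U t \<notin> B" "ereal t < hit_zero U"
      unfolding exit_time_def[of B U] Inf_less_iff by auto
    then obtain v where v: "0 \<le> v" "t = ?D v" using hit[OF t(1)] by auto
    then have "exit_time B W \<le> ereal v" unfolding exit_time_def using t by (intro Inf_lower) (auto simp: W_def)
    then show "exit_time B W < \<infinity>" by auto
  qed (use main in blast)
qed

section \<open>Path laws of Levy processes\<close>

text \<open>A right-continuous path is encoded by its values on the positive dyadic rationals and recovered
  as a limit from the right, which makes path functionals measurable on a countable product.\<close>

abbreviation path_space :: "(nat \<times> nat \<Rightarrow> real) measure" where
  "path_space \<equiv> PiM UNIV (\<lambda>_. borel)"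

definition sample :: "(real \<Rightarrow> real) \<Rightarrow> nat \<times> nat \<Rightarrow> real" where
  "sample f = (\<lambda>(n, k). f ((real k + 1) / 2 ^ n))"

definition path :: "(nat \<times> nat \<Rightarrow> real) \<Rightarrow> real \<Rightarrow> real" where
  "path y t = lim (\<lambda>n. y (n, nat \<lfloor>2 ^ n * t\<rfloor>))"

lemma path_sample:
  assumes "0 \<le> t" "continuous (at_right t) f"
  shows "path (sample f) t = f t"
  using continuous_at_right_dyadic[OF assms] unfolding path_def sample_def dyadic_above_def
  by (simp add: limI)

text \<open>At each dyadic level the random time only selects one of countably many coordinates, and
  the limit over the levels is again measurable.\<close>

lemma path_measurable [measurable (raw)]:
  assumes [measurable]: "u \<in> borel_measurable M" "g \<in> M \<rightarrow>\<^sub>M path_space"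
  shows "(\<lambda>x. path (g x) (u x)) \<in> borel_measurable M"
  unfolding path_def
proof (rule borel_measurable_lim_metric)
  fix n
  show "(\<lambda>x. g x (n, nat \<lfloor>2 ^ n * u x\<rfloor>)) \<in> borel_measurable M"
  proof (rule measurable_compose_countable[where f="\<lambda>i x. g x (n, i)" and g="\<lambda>x. nat \<lfloor>2 ^ n * u x\<rfloor>"])
    show "(\<lambda>x. g x (n, i)) \<in> borel_measurable M" for i by measurable
    show "(\<lambda>x. nat \<lfloor>2 ^ n * u x\<rfloor>) \<in> M \<rightarrow>\<^sub>M count_space UNIV" by measurable
  qed
qed

lemma sample_measurable:
  assumes "\<And>t. 0 \<le> t \<Longrightarrow> X t \<in> borel_measurable M"
  shows "(\<lambda>\<omega>. sample (\<lambda>t. X t \<omega>)) \<in> M \<rightarrow>\<^sub>M path_space"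
proof (rule measurable_PiM_single')
  fix i :: "nat \<times> nat"
  show "(\<lambda>\<omega>. sample (\<lambda>t. X t \<omega>) i) \<in> borel_measurable M"
    using assms[of "(real (snd i) + 1) / 2 ^ fst i"] by (simp add: sample_def case_prod_beta)
qed auto

lemma lamperti_V_path_measurable [measurable (raw)]:
  assumes [measurable]: "u \<in> borel_measurable M" "g \<in> M \<rightarrow>\<^sub>M path_space"
  shows "(\<lambda>x. lamperti_V \<alpha> (path (g x)) (u x)) \<in> borel_measurable M"
proof -
  \<comment> \<open>With the upper limit moved into the integrand this is a parameter integral,
    whose measurability is part of Fubini's theorem.\<close>
  have "(\<lambda>x. lamperti_V \<alpha> (path (g x)) (u x)) =
     (\<lambda>x. \<integral>s. (if 0 \<le> s \<and> s \<le> u x then exp (\<alpha> * path (g x) s) else 0) \<partial>lborel)"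
    unfolding lamperti_V_def set_lebesgue_integral_def
    by (intro ext Bochner_Integration.integral_cong) (auto simp: indicator_def)
  also have "\<dots> \<in> borel_measurable M" by measurable
  finally show ?thesis .
qed

lemma lamperti_V_cong: "(\<And>s. 0 \<le> s \<Longrightarrow> s \<le> u \<Longrightarrow> f s = g s) \<Longrightarrow> lamperti_V \<alpha> f u = lamperti_V \<alpha> g u"
  unfolding lamperti_V_def by (rule set_lebesgue_integral_cong) auto

text \<open>The sample of the path stopped at \<open>s\<close> encodes the path up to time
  \<open>s\<close>. Stopping must preserve cadlag paths for \<open>path\<close> to recover the
  stopped path from its sample.\<close>

lemma cadlag_in_stopped:
  assumes "cadlag_in UNIV f" "0 \<le> s"
  shows "cadlag_in UNIV (\<lambda>t. f (min t s))"
  unfolding cadlag_in_def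
proof (intro conjI allI impI)
  fix t :: real assume t: "0 \<le> t"
  show "f (min t s) \<in> UNIV" by simp
  show "continuous (at_right t) (\<lambda>t. f (min t s))"
  proof (cases "t < s")
    case True
    have "eventually (\<lambda>r. f r = f (min r s)) (at_right t)"
      using eventually_at_right_less[of t] eventually_at_right_field[of _ t] True by (auto intro!: exI[of _ s])
    moreover have "(f \<longlongrightarrow> f t) (at_right t)" using cadlag_in_right[OF assms(1) t] by (simp add: continuous_within)
    ultimately have "((\<lambda>r. f (min r s)) \<longlongrightarrow> f t) (at_right t)" by (rule Lim_transform_eventually[rotated])
    then show ?thesis using True by (simp add: continuous_within)
  next
    case False
    then have "eventually (\<lambda>r. f (min r s) = f s) (at_right t)"
      by (auto simp: eventually_at_right_field intro!: exI[of _ "t+1"])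
    then have "((\<lambda>r. f (min r s)) \<longlongrightarrow> f s) (at_right t)" by (rule tendsto_eventually)
    then show ?thesis using False by (simp add: continuous_within)
  qed
next
  fix t :: real assume t: "0 < t"
  show "\<exists>l\<in>UNIV. ((\<lambda>t. f (min t s)) \<longlongrightarrow> l) (at_left t)"
  proof (cases "t \<le> s")
    case True
    obtain l where l: "(f \<longlongrightarrow> l) (at_left t)" using assms(1) t unfolding cadlag_in_def by blast
    have "eventually (\<lambda>r. f r = f (min r s)) (at_left t)"
      using True by (auto simp: eventually_at_left_field intro!: exI[of _ "t-1"])
    with l have "((\<lambda>r. f (min r s)) \<longlongrightarrow> l) (at_left t)" by (rule Lim_transform_eventually)
    then show ?thesis by blast
  next
    case False
    then have "eventually (\<lambda>r. f (min r s) = f s) (at_left t)"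
      by (auto simp: eventually_at_left_field intro!: exI[of _ "s"])
    then have "((\<lambda>r. f (min r s)) \<longlongrightarrow> f s) (at_left t)" by (rule tendsto_eventually)
    then show ?thesis by blast
  qed
qed

text \<open>\<open>levy_process\<close> asks for monotone time sequences on all of
  \<open>nat\<close>, so the sorted list of times is continued by its last entry. Time 0 is included
  to let increments telescope to values of the process.\<close>

lemma finite_times:
  assumes "finite F" "F \<subseteq> {0::real..}"
  obtains \<tau> :: "nat \<Rightarrow> real" and m where "mono \<tau>" "\<tau> 0 = 0" "F \<subseteq> \<tau> ` {..m}"
proof -
  define l where "l = sorted_list_of_set (insert 0 F)"
  have set_l: "set l = insert 0 F" and sl: "sorted l"
    unfolding l_def using assms(1) by (simp_all only: set_sorted_list_of_set sorted_sorted_list_of_set finite_insert)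
  then have ne: "l \<noteq> []" by auto
  define \<tau> where "\<tau> i = l ! (min i (length l - 1))" for i
  have "mono \<tau>"
  proof (rule monoI)
    fix i j :: nat assume "i \<le> j"
    moreover have "min j (length l - 1) < length l" using ne by (simp add: min_less_iff_disj)
    ultimately show "\<tau> i \<le> \<tau> j" unfolding \<tau>_def by (intro sorted_nth_mono[OF sl]) auto
  qed
  moreover have "\<tau> 0 = 0"
  proof -
    have "l ! 0 \<in> insert 0 F" using ne set_l nth_mem[of 0 l] by auto
    then have "0 \<le> l ! 0" using assms(2) by auto
    moreover obtain i where "i < length l" "l ! i = 0" using set_l by (metis in_set_conv_nth insertI1)
    then have "l ! 0 \<le> 0" using sorted_nth_mono[OF sl, of 0 i] by simp
    ultimately show ?thesis by (simp add: \<tau>_def)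
  qed
  moreover have "F \<subseteq> \<tau> ` {..length l}"
  proof
    fix t assume "t \<in> F"
    then obtain i where "i < length l" "l ! i = t" using set_l by (metis in_set_conv_nth insertI2)
    then have "\<tau> i = t" by (simp add: \<tau>_def min_absorb1)
    then show "t \<in> \<tau> ` {..length l}" using \<open>i < length l\<close> by force
  qed
  ultimately show ?thesis by (rule that)
qed

lemma finite_times_grid:
  fixes t :: "'j \<Rightarrow> real"
  assumes "finite J" "0 \<le> s" "\<And>j. j \<in> J \<Longrightarrow> 0 \<le> t j"
  shows "\<exists>(\<tau> :: nat \<Rightarrow> real) m idx. mono \<tau> \<and> \<tau> 0 = 0 \<and> \<tau> m = s \<and> (\<forall>j\<in>J. \<tau> (idx j) = min (t j) s \<and> idx j \<le> m)"
proof -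
  obtain \<tau> :: "nat \<Rightarrow> real" and m0 where \<tau>: "mono \<tau>" "\<tau> 0 = 0" "insert s ((\<lambda>j. min (t j) s) ` J) \<subseteq> \<tau> ` {..m0}"
    by (rule finite_times[of "insert s ((\<lambda>j. min (t j) s) ` J)"]) (use assms in auto)
  then obtain m where m: "\<tau> m = s" by auto
  have "\<exists>i. \<tau> i = min (t j) s \<and> i \<le> m" if "j \<in> J" for j
  proof -
    obtain i where i: "\<tau> i = min (t j) s" using \<tau>(3) \<open>j \<in> J\<close> by force
    show ?thesis
    proof (cases "i \<le> m")
      \<comment> \<open>A time with index beyond \<open>m\<close> is still at most
        \<open>s = \<tau> m\<close>, so monotonicity makes it equal to \<open>\<tau> m\<close>, and
        the index \<open>m\<close> serves.\<close>
      case False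
      then have "\<tau> m \<le> \<tau> i" using monoD[OF \<tau>(1), of m i] by simp
      then have "\<tau> m = min (t j) s" using i m by simp
      then show ?thesis by auto
    qed (use i in auto)
  qed
  then obtain idx where "\<And>j. j \<in> J \<Longrightarrow> \<tau> (idx j) = min (t j) s \<and> idx j \<le> m" by metis
  then show ?thesis using \<tau>(1,2) m by blast
qed

context
  fixes M :: "'a measure" and \<xi> :: "real \<Rightarrow> 'a \<Rightarrow> real"
  assumes levy: "levy_process M \<xi>"
begin

lemma levy_prob_space: "prob_space M" using levy by (simp add: levy_process_def)

lemma levy_measurable: "0 \<le> t \<Longrightarrow> \<xi> t \<in> borel_measurable M" using levy by (simp add: levy_process_def)

lemma levy_cadlag: "\<omega> \<in> space M \<Longrightarrow> cadlag_in UNIV (\<lambda>t. \<xi> t \<omega>)" using levy by (simp add: levy_process_def)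

lemma levy_zero: "AE \<omega> in M. \<xi> 0 \<omega> = 0" using levy by (simp add: levy_process_def)

lemma levy_stationary:
  "0 \<le> s \<Longrightarrow> s \<le> t \<Longrightarrow> distr M borel (\<lambda>\<omega>. \<xi> t \<omega> - \<xi> s \<omega>) = distr M borel (\<xi> (t - s))"
proof -
  assume "0 \<le> s" "s \<le> t"
  have "\<forall>s\<ge>0. \<forall>t\<ge>0. distr M borel (\<lambda>\<omega>. \<xi> (s + t) \<omega> - \<xi> s \<omega>) = distr M borel (\<xi> t)"
    using levy by (simp add: levy_process_def)
  from this[rule_format, of s "t - s"] show ?thesis using \<open>0 \<le> s\<close> \<open>s \<le> t\<close> by simp
qed

lemma levy_indep:
  "0 \<le> \<tau> 0 \<Longrightarrow> mono \<tau> \<Longrightarrow>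
    prob_space.indep_vars M (\<lambda>_. borel) (\<lambda>i \<omega>. \<xi> (\<tau> (Suc i)) \<omega> - \<xi> (\<tau> i) \<omega>) {..<n::nat}"
  using levy by (simp add: levy_process_def)

lemma levy_shift:
  assumes s: "0 \<le> s"
  shows "levy_process M (\<lambda>t \<omega>. \<xi> (s + t) \<omega> - \<xi> s \<omega>)"
  unfolding levy_process_def
proof (intro conjI allI impI ballI)
  show "prob_space M" by (rule levy_prob_space)
  show "(\<lambda>\<omega>. \<xi> (s + t) \<omega> - \<xi> s \<omega>) \<in> borel_measurable M" if "0 \<le> t" for t
    using levy_measurable s that by (intro borel_measurable_diff) auto
  show "AE \<omega> in M. \<xi> (s + 0) \<omega> - \<xi> s \<omega> = 0" by simp
  show "distr M borel (\<lambda>\<omega>. \<xi> (s + (r + t)) \<omega> - \<xi> s \<omega> - (\<xi> (s + r) \<omega> - \<xi> s \<omega>)) = distr M borel (\<lambda>\<omega>. \<xi> (s + t) \<omega> - \<xi> s \<omega>)"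
    if "0 \<le> r" "0 \<le> t" for r t
    using levy_stationary[of "s + r" "s + r + t"] levy_stationary[of s "s + t"] s that by (simp add: add.assoc)
  show "prob_space.indep_vars M (\<lambda>_. borel)
      (\<lambda>i \<omega>. \<xi> (s + \<tau> (Suc i)) \<omega> - \<xi> s \<omega> - (\<xi> (s + \<tau> i) \<omega> - \<xi> s \<omega>)) {..<n}"
    if "0 \<le> \<tau> 0" "mono \<tau>" for \<tau> :: "nat \<Rightarrow> real" and n
    using levy_indep[of "\<lambda>i. s + \<tau> i" n] s that by (simp add: mono_def)
  fix \<omega> assume \<omega>: "\<omega> \<in> space M"
  have c: "cadlag_in UNIV (\<lambda>t. \<xi> t \<omega>)" by (rule levy_cadlag[OF \<omega>])
  show "cadlag_in UNIV (\<lambda>t. \<xi> (s + t) \<omega> - \<xi> s \<omega>)"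
    unfolding cadlag_in_def
  proof (intro conjI allI impI)
    fix t :: real assume t: "0 \<le> t"
    have "((\<lambda>r. \<xi> r \<omega>) \<longlongrightarrow> \<xi> (s + t) \<omega>) (at_right (s + t))"
      using cadlag_in_right[OF c, of "s + t"] s t by (simp add: continuous_within)
    then have "((\<lambda>r. \<xi> (s + r) \<omega>) \<longlongrightarrow> \<xi> (s + t) \<omega>) (at_right t)"
      by (simp add: at_right_to_0[of "s+t"] at_right_to_0[of t] filterlim_filtermap add_ac)
    then show "continuous (at_right t) (\<lambda>t. \<xi> (s + t) \<omega> - \<xi> s \<omega>)"
      by (auto simp: continuous_within intro!: tendsto_intros)
  next
    fix t :: real assume t: "0 < t"
    have "0 < s + t" using s t by simp
    then obtain l where l: "((\<lambda>r. \<xi> r \<omega>) \<longlongrightarrow> l) (at_left (s + t))" using c unfolding cadlag_in_def by blast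
    have "filterlim (\<lambda>r. s + r) (at_left (s + t)) (at_left t)"
      unfolding filterlim_at
      by (auto simp: eventually_at_filter intro!: tendsto_eq_intros)
    with l have "((\<lambda>r. \<xi> (s + r) \<omega>) \<longlongrightarrow> l) (at_left t)" by (rule filterlim_compose)
    then show "\<exists>l\<in>UNIV. ((\<lambda>t. \<xi> (s + t) \<omega> - \<xi> s \<omega>) \<longlongrightarrow> l) (at_left t)"
      by (auto intro!: tendsto_intros)
  qed simp
qed

lemma levy_sample_measurable:
  assumes "0 \<le> s" shows "(\<lambda>\<omega>. sample (\<lambda>t. \<xi> (min t s) \<omega>)) \<in> M \<rightarrow>\<^sub>M path_space"
    "(\<lambda>\<omega>. sample (\<lambda>t. \<xi> t \<omega>)) \<in> M \<rightarrow>\<^sub>M path_space"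
  by (rule sample_measurable, rule levy_measurable, use assms in simp)+

lemma levy_telescope:
  assumes "\<tau> 0 = 0"
  shows "AE \<omega> in M. \<forall>k. \<xi> (\<tau> k) \<omega> = (\<Sum>i<k. \<xi> (\<tau> (Suc i)) \<omega> - \<xi> (\<tau> i) \<omega>)"
  using levy_zero by eventually_elim (simp add: sum_lessThan_telescope[of "\<lambda>i. \<xi> (\<tau> i) _"] assms)

text \<open>The density at the last grid time telescopes into a product with one factor per
  increment. Under the tilted measure the increments are therefore still independent, each carrying
  its own tilt; \<open>\<gamma> = q = 0\<close> gives the untilted process.\<close>

lemma levy_increments_law:
  fixes \<gamma> q :: real and \<tau> :: "nat \<Rightarrow> real"
  defines "L \<equiv> \<lambda>t \<omega>. ennreal (exp (\<gamma> * \<xi> t \<omega> - q * t))"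
  defines "\<nu> \<equiv> \<lambda>t. distr (density M (L t)) borel (\<xi> t)"
  assumes \<nu>: "\<And>t. 0 \<le> t \<Longrightarrow> prob_space (\<nu> t)" and \<tau>: "mono \<tau>" "\<tau> 0 = 0"
  shows "distr (density M (L (\<tau> m))) (PiM {..<m} (\<lambda>_. borel)) (\<lambda>\<omega>. \<lambda>i\<in>{..<m}. \<xi> (\<tau> (Suc i)) \<omega> - \<xi> (\<tau> i) \<omega>) =
     PiM {..<m} (\<lambda>i. \<nu> (\<tau> (Suc i) - \<tau> i))"
proof -
  interpret prob_space M by (rule levy_prob_space)
  have \<tau>0: "0 \<le> \<tau> i" for i using monoD[OF \<tau>(1), of 0 i] \<tau>(2) by simp
  have \<tau>d: "0 \<le> \<tau> (Suc i) - \<tau> i" for i using monoD[OF \<tau>(1), of i "Suc i"] by simp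
  have [measurable]: "\<xi> (\<tau> i) \<in> borel_measurable M" for i by (rule levy_measurable[OF \<tau>0])
  have [measurable]: "\<xi> (\<tau> (Suc i) - \<tau> i) \<in> borel_measurable M" for i by (rule levy_measurable[OF \<tau>d])
  interpret pp: product_prob_space "\<lambda>i. \<nu> (\<tau> (Suc i) - \<tau> i)" "{..<m}"
    by (rule product_prob_spaceI) (rule \<nu>[OF \<tau>d])
  let ?X = "\<lambda>i \<omega>. \<xi> (\<tau> (Suc i)) \<omega> - \<xi> (\<tau> i) \<omega>"
  show ?thesis
  proof (rule pp.PiM_eqI)
    show "sets (distr (density M (L (\<tau> m))) (PiM {..<m} (\<lambda>_. borel)) (\<lambda>\<omega>. \<lambda>i\<in>{..<m}. ?X i \<omega>)) = sets (PiM {..<m} (\<lambda>i. \<nu> (\<tau> (Suc i) - \<tau> i)))"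
      by (auto simp: \<nu>_def intro!: sets_PiM_cong)
    fix A :: "nat \<Rightarrow> real set" assume "\<And>i. i \<in> {..<m} \<Longrightarrow> A i \<in> sets (\<nu> (\<tau> (Suc i) - \<tau> i))"
    then have A[measurable]: "\<And>i. i \<in> {..<m} \<Longrightarrow> A i \<in> sets borel" by (simp add: \<nu>_def)
    \<comment> \<open>Tilt and event are merged into one nonnegative function per increment, to
      which the product formula for independent variables applies.\<close>
    define g where "g i y = exp (\<gamma> * y - q * (\<tau> (Suc i) - \<tau> i)) * indicator (A i) y" for i and y :: real
    have ennreal_g: "ennreal (g i y) = ennreal (exp (\<gamma> * y - q * (\<tau> (Suc i) - \<tau> i))) * indicator (A i) y" for i y
      by (simp add: g_def indicator_def)
    have g[measurable]: "i \<in> {..<m} \<Longrightarrow> g i \<in> borel_measurable borel" for i unfolding g_def by measurable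
    have "emeasure (distr (density M (L (\<tau> m))) (PiM {..<m} (\<lambda>_. borel)) (\<lambda>\<omega>. \<lambda>i\<in>{..<m}. ?X i \<omega>)) (Pi\<^sub>E {..<m} A) =
       (\<integral>\<^sup>+\<omega>. L (\<tau> m) \<omega> * indicator (Pi\<^sub>E {..<m} A) (\<lambda>i\<in>{..<m}. ?X i \<omega>) \<partial>M)"
      unfolding L_def
      by (subst emeasure_distr, (measurable; fail), (auto intro!: sets_PiM_I_finite)[1], subst emeasure_density)
         (auto intro!: nn_integral_cong measurable_sets sets_PiM_I_finite simp: indicator_def)
    also have "\<dots> = (\<integral>\<^sup>+\<omega>. (\<Prod>i<m. ennreal (g i (?X i \<omega>))) \<partial>M)" (is "nn_integral _ ?l = nn_integral _ ?r")
    proof (rule nn_integral_cong_AE)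
      show "AE \<omega> in M. ?l \<omega> = ?r \<omega>"
        using levy_telescope[where \<tau>=\<tau>, OF \<tau>(2)]
      proof eventually_elim
        case (elim \<omega>)
        have "\<gamma> * \<xi> (\<tau> m) \<omega> - q * \<tau> m = (\<Sum>i<m. \<gamma> * ?X i \<omega> - q * (\<tau> (Suc i) - \<tau> i))"
          using elim[rule_format, of m] sum_lessThan_telescope[of \<tau> m] \<tau>(2)
          by (simp add: sum_subtractf sum_distrib_left[symmetric])
        then have "L (\<tau> m) \<omega> = (\<Prod>i<m. ennreal (exp (\<gamma> * ?X i \<omega> - q * (\<tau> (Suc i) - \<tau> i))))"
          by (simp add: L_def exp_sum prod_ennreal)
        moreover have "indicator (Pi\<^sub>E {..<m} A) (\<lambda>i\<in>{..<m}. ?X i \<omega>) = (\<Prod>i<m. indicator (A i) (?X i \<omega>) :: ennreal)"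
        proof (cases "\<forall>i<m. ?X i \<omega> \<in> A i")
          case True then show ?thesis by (auto simp: indicator_def PiE_iff)
        next
          case False
          then obtain i where "i < m" "?X i \<omega> \<notin> A i" by auto
          then have "(\<Prod>i<m. indicator (A i) (?X i \<omega>) :: ennreal) = 0" by (intro prod_zero bexI[of _ i]) auto
          moreover have "(\<lambda>i\<in>{..<m}. ?X i \<omega>) \<notin> Pi\<^sub>E {..<m} A" using \<open>i < m\<close> \<open>?X i \<omega> \<notin> A i\<close> by (auto simp: PiE_iff)
          ultimately show ?thesis by simp
        qed
        ultimately show ?case by (simp add: ennreal_g prod.distrib)
      qed
    qed
    also have "\<dots> = (\<Prod>i<m. \<integral>\<^sup>+\<omega>. ennreal (g i (?X i \<omega>)) \<partial>M)"
    proof (rule indep_vars_nn_integral)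
      have "indep_vars (\<lambda>_. borel) (\<lambda>i. (\<lambda>y. ennreal (g i y)) \<circ> ?X i) {..<m}"
      proof (rule indep_vars_compose[OF levy_indep])
        fix i assume "i \<in> {..<m}"
        note [measurable] = g[OF this]
        show "(\<lambda>y. ennreal (g i y)) \<in> borel_measurable borel" by measurable
      qed (use \<tau> in auto)
      then show "indep_vars (\<lambda>_. borel) (\<lambda>i \<omega>. ennreal (g i (?X i \<omega>))) {..<m}" by (simp add: comp_def)
    qed simp_all
    also have "\<dots> = (\<Prod>i<m. emeasure (\<nu> (\<tau> (Suc i) - \<tau> i)) (A i))"
    proof (rule prod.cong[OF refl])
      fix i assume i: "i \<in> {..<m}"
      note [measurable] = g[OF i] A[OF i]
      let ?d = "\<tau> (Suc i) - \<tau> i"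
      have "(\<integral>\<^sup>+\<omega>. ennreal (g i (?X i \<omega>)) \<partial>M) = (\<integral>\<^sup>+y. ennreal (g i y) \<partial>distr M borel (?X i))"
        by (rule nn_integral_distr[symmetric]) measurable
      also have "distr M borel (?X i) = distr M borel (\<xi> ?d)"
        by (rule levy_stationary) (use \<tau>0 \<tau>d[of i] in auto)
      also have "(\<integral>\<^sup>+y. ennreal (g i y) \<partial>distr M borel (\<xi> ?d)) = (\<integral>\<^sup>+\<omega>. L ?d \<omega> * indicator (A i) (\<xi> ?d \<omega>) \<partial>M)"
        unfolding ennreal_g L_def by (rule nn_integral_distr) measurable
      also have "\<dots> = emeasure (density M (L ?d)) (\<xi> ?d -` A i \<inter> space M)"
        unfolding L_def by (subst emeasure_density) (auto intro!: nn_integral_cong simp: indicator_def)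
      also have "\<dots> = emeasure (\<nu> ?d) (A i)"
        unfolding \<nu>_def L_def by (subst emeasure_distr) simp_all
      finally show "(\<integral>\<^sup>+\<omega>. ennreal (g i (?X i \<omega>)) \<partial>M) = emeasure (\<nu> ?d) (A i)" .
    qed
    finally show "emeasure (distr (density M (L (\<tau> m))) (PiM {..<m} (\<lambda>_. borel)) (\<lambda>\<omega>. \<lambda>i\<in>{..<m}. ?X i \<omega>)) (Pi\<^sub>E {..<m} A) =
      (\<Prod>i\<in>{..<m}. emeasure (\<nu> (\<tau> (Suc i) - \<tau> i)) (A i))" .
  qed auto
qed

text \<open>Sampled values are partial sums of increments. The equivalence is only almost sure
  because \<open>\<xi> 0 = 0\<close> is.\<close>

lemma sample_cylinder_increments:
  fixes J :: "(nat \<times> nat) set"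
  assumes "finite J" "\<tau> 0 = 0"
    and idx: "\<forall>j\<in>J. \<tau> (idx j) = min ((real (snd j) + 1) / 2 ^ fst j) s \<and> idx j \<le> m"
  shows "AE \<omega> in M. sample (\<lambda>t. \<xi> (min t s) \<omega>) \<in> prod_emb UNIV (\<lambda>_. borel) J (Pi\<^sub>E J A) \<longleftrightarrow>
     (\<lambda>i\<in>{..<m}. \<xi> (\<tau> (Suc i)) \<omega> - \<xi> (\<tau> i) \<omega>) \<in> {y \<in> space (PiM {..<m} (\<lambda>_. borel)). \<forall>j\<in>J. (\<Sum>i<idx j. y i) \<in> A j}"
  using levy_telescope[where \<tau>=\<tau>, OF assms(2)]
proof eventually_elim
  case (elim \<omega>)
  have "(\<Sum>i<idx j. (\<lambda>i\<in>{..<m}. \<xi> (\<tau> (Suc i)) \<omega> - \<xi> (\<tau> i) \<omega>) i) = sample (\<lambda>t. \<xi> (min t s) \<omega>) j" if "j \<in> J" for j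
  proof -
    have "(\<Sum>i<idx j. (\<lambda>i\<in>{..<m}. \<xi> (\<tau> (Suc i)) \<omega> - \<xi> (\<tau> i) \<omega>) i) = (\<Sum>i<idx j. \<xi> (\<tau> (Suc i)) \<omega> - \<xi> (\<tau> i) \<omega>)"
      using bspec[OF idx that] by (intro sum.cong) auto
    also have "\<dots> = \<xi> (\<tau> (idx j)) \<omega>" by (rule elim[rule_format, symmetric])
    also have "\<dots> = sample (\<lambda>t. \<xi> (min t s) \<omega>) j" using bspec[OF idx that] by (simp add: sample_def case_prod_beta)
    finally show ?thesis .
  qed
  then show ?case by (auto simp: prod_emb_def PiE_iff space_PiM restrict_def extensional_def)
qed

end

lemma sum_cylinder_measurable:
  assumes "finite J" "\<And>j. j \<in> J \<Longrightarrow> idx j \<le> m" "\<And>j. j \<in> J \<Longrightarrow> A j \<in> sets borel"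
  shows "{y \<in> space (PiM {..<m} (\<lambda>_. borel)). \<forall>j\<in>J. (\<Sum>i<idx j. (y i :: real)) \<in> A j} \<in> sets (PiM {..<m::nat} (\<lambda>_. borel))"
proof (intro sets.sets_Collect_finite_All assms(1))
  fix j assume j: "j \<in> J"
  have [measurable]: "(\<lambda>y. \<Sum>i<idx j. y i) \<in> borel_measurable (PiM {..<m} (\<lambda>_. borel :: real measure))"
    using assms(2)[OF j] by (intro borel_measurable_sum measurable_component_singleton) auto
  note [measurable] = assms(3)[OF j]
  show "{y \<in> space (PiM {..<m} (\<lambda>_. borel)). (\<Sum>i<idx j. (y i :: real)) \<in> A j} \<in> sets (PiM {..<m} (\<lambda>_. borel))"
    by measurable
qed

text \<open>Cylinder sets determine a finite measure on the path space. On a common time grid such a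
  set is an event about increments, whose joint law is a product built from one-time laws, so the
  relation assumed for single times passes to whole paths up to \<open>s\<close>.\<close>

lemma levy_path_law:
  fixes \<gamma> q s :: real
  assumes \<xi>: "levy_process M \<xi>" and \<eta>: "levy_process N \<eta>"
    and tilt: "\<And>t. 0 \<le> t \<Longrightarrow> distr N borel (\<eta> t) = distr (density M (\<lambda>\<omega>. ennreal (exp (\<gamma> * \<xi> t \<omega> - q * t)))) borel (\<xi> t)"
    and s: "0 \<le> s"
  shows "distr N path_space (\<lambda>\<omega>. sample (\<lambda>t. \<eta> (min t s) \<omega>)) =
     distr (density M (\<lambda>\<omega>. ennreal (exp (\<gamma> * \<xi> s \<omega> - q * s)))) path_space (\<lambda>\<omega>. sample (\<lambda>t. \<xi> (min t s) \<omega>))"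
    (is "?P = ?Q")
proof (rule measure_eqI_PiM_infinite)
  interpret N: prob_space N by (rule levy_prob_space[OF \<eta>])
  interpret M: prob_space M by (rule levy_prob_space[OF \<xi>])
  note [measurable] = levy_sample_measurable[OF \<eta> s] levy_sample_measurable[OF \<xi> s] levy_measurable[OF \<xi> s]
  let ?L = "\<lambda>t \<omega>. ennreal (exp (\<gamma> * \<xi> t \<omega> - q * t))"
  have prob\<eta>: "prob_space (distr N borel (\<eta> t))" if "0 \<le> t" for t
    by (rule N.prob_space_distr) (rule levy_measurable[OF \<eta> that])
  show "finite_measure ?P"
    by (rule prob_space.finite_measure, rule N.prob_space_distr) measurable
  fix A and J :: "(nat \<times> nat) set"
  assume J: "finite J" and A: "\<And>i. i \<in> J \<Longrightarrow> A i \<in> sets (borel :: real measure)"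
  have nn: "0 \<le> (real (snd j) + 1) / 2 ^ fst j" for j :: "nat \<times> nat" by simp
  obtain \<tau> :: "nat \<Rightarrow> real" and m idx where \<tau>: "mono \<tau>" "\<tau> 0 = 0" "\<tau> m = s"
    and idx: "\<forall>j\<in>J. \<tau> (idx j) = min ((real (snd j) + 1) / 2 ^ fst j) s \<and> idx j \<le> m"
    using finite_times_grid[OF J s, of "\<lambda>j. (real (snd j) + 1) / 2 ^ fst j", OF nn] by blast
  note \<tau> = \<tau> idx[rule_format]
  define C where "C = {y \<in> space (PiM {..<m} (\<lambda>_. borel)). \<forall>j\<in>J. (\<Sum>i<idx j. y i) \<in> A j}"
  have C[measurable]: "C \<in> sets (PiM {..<m} (\<lambda>_. borel))"
    unfolding C_def by (rule sum_cylinder_measurable) (use J \<tau>(4) A in auto)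
  let ?E = "prod_emb UNIV (\<lambda>_. borel) J (Pi\<^sub>E J A)"
  have E[measurable]: "?E \<in> sets path_space" by (rule sets_PiM_I) (use J A in auto)
  have \<tau>0: "0 \<le> \<tau> i" for i using monoD[OF \<tau>(1), of 0 i] \<tau>(2) by simp
  have meas_inc: "(\<lambda>\<omega>. \<lambda>i\<in>{..<m}. \<xi> (\<tau> (Suc i)) \<omega> - \<xi> (\<tau> i) \<omega>) \<in> M \<rightarrow>\<^sub>M PiM {..<m} (\<lambda>_. borel)"
    by (intro measurable_restrict borel_measurable_diff levy_measurable[OF \<xi>] \<tau>0)
  have meas_inc': "(\<lambda>\<omega>. \<lambda>i\<in>{..<m}. \<eta> (\<tau> (Suc i)) \<omega> - \<eta> (\<tau> i) \<omega>) \<in> N \<rightarrow>\<^sub>M PiM {..<m} (\<lambda>_. borel)"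
    by (intro measurable_restrict borel_measurable_diff levy_measurable[OF \<eta>] \<tau>0)
  note [measurable] = meas_inc meas_inc'
  have "emeasure ?P ?E = emeasure N {\<omega>\<in>space N. sample (\<lambda>t. \<eta> (min t s) \<omega>) \<in> ?E}"
    by (subst emeasure_distr) (auto intro!: arg_cong[where f="emeasure N"])
  also have "\<dots> = emeasure N {\<omega>\<in>space N. (\<lambda>i\<in>{..<m}. \<eta> (\<tau> (Suc i)) \<omega> - \<eta> (\<tau> i) \<omega>) \<in> C}"
  proof (rule emeasure_eq_AE)
    show "AE \<omega> in N. (\<omega> \<in> {\<omega>\<in>space N. sample (\<lambda>t. \<eta> (min t s) \<omega>) \<in> ?E}) = (\<omega> \<in> {\<omega>\<in>space N. (\<lambda>i\<in>{..<m}. \<eta> (\<tau> (Suc i)) \<omega> - \<eta> (\<tau> i) \<omega>) \<in> C})"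
      using sample_cylinder_increments[OF \<eta> J \<tau>(2) idx, of A] by eventually_elim (auto simp: C_def)
  qed measurable
  \<comment> \<open>Writing this side with the density 1, that is with
    \<open>\<gamma> = q = 0\<close>, lets the same lemma on increments serve both processes.\<close>
  also have "\<dots> = emeasure (distr (density N (\<lambda>\<omega>. ennreal (exp (0 * \<eta> (\<tau> m) \<omega> - 0 * \<tau> m)))) (PiM {..<m} (\<lambda>_. borel)) (\<lambda>\<omega>. \<lambda>i\<in>{..<m}. \<eta> (\<tau> (Suc i)) \<omega> - \<eta> (\<tau> i) \<omega>)) C"
    by (simp add: density_1, subst emeasure_distr) (auto intro!: arg_cong[where f="emeasure N"])
  also have "\<dots> = emeasure (PiM {..<m} (\<lambda>i. distr N borel (\<eta> (\<tau> (Suc i) - \<tau> i)))) C"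
    by (subst levy_increments_law[OF \<eta> _ \<tau>(1,2)]) (simp_all add: density_1 prob\<eta>)
  also have "PiM {..<m} (\<lambda>i. distr N borel (\<eta> (\<tau> (Suc i) - \<tau> i))) =
      PiM {..<m} (\<lambda>i. distr (density M (?L (\<tau> (Suc i) - \<tau> i))) borel (\<xi> (\<tau> (Suc i) - \<tau> i)))"
    using monoD[OF \<tau>(1)] by (intro PiM_cong refl tilt) simp
  also have "\<dots> = distr (density M (?L (\<tau> m))) (PiM {..<m} (\<lambda>_. borel)) (\<lambda>\<omega>. \<lambda>i\<in>{..<m}. \<xi> (\<tau> (Suc i)) \<omega> - \<xi> (\<tau> i) \<omega>)"
    by (rule levy_increments_law[OF \<xi> _ \<tau>(1,2), symmetric]) (simp add: tilt[symmetric] prob\<eta>)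
  also have "emeasure \<dots> C = emeasure (density M (?L s)) {\<omega>\<in>space M. (\<lambda>i\<in>{..<m}. \<xi> (\<tau> (Suc i)) \<omega> - \<xi> (\<tau> i) \<omega>) \<in> C}"
    unfolding \<tau>(3) by (subst emeasure_distr) (auto intro!: arg_cong[where f="emeasure _"])
  also have "\<dots> = emeasure (density M (?L s)) {\<omega>\<in>space M. sample (\<lambda>t. \<xi> (min t s) \<omega>) \<in> ?E}"
  proof (rule emeasure_eq_AE)
    have "AE \<omega> in M. (\<omega> \<in> {\<omega>\<in>space M. (\<lambda>i\<in>{..<m}. \<xi> (\<tau> (Suc i)) \<omega> - \<xi> (\<tau> i) \<omega>) \<in> C}) = (\<omega> \<in> {\<omega>\<in>space M. sample (\<lambda>t. \<xi> (min t s) \<omega>) \<in> ?E})"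
      using sample_cylinder_increments[OF \<xi> J \<tau>(2) idx, of A] by eventually_elim (auto simp: C_def)
    then show "AE \<omega> in density M (?L s). (\<omega> \<in> {\<omega>\<in>space M. (\<lambda>i\<in>{..<m}. \<xi> (\<tau> (Suc i)) \<omega> - \<xi> (\<tau> i) \<omega>) \<in> C}) = (\<omega> \<in> {\<omega>\<in>space M. sample (\<lambda>t. \<xi> (min t s) \<omega>) \<in> ?E})"
      by (subst AE_density) auto
  qed auto
  also have "\<dots> = emeasure ?Q ?E"
    by (subst emeasure_distr) (auto intro!: arg_cong[where f="emeasure _"])
  finally show "emeasure ?P ?E = emeasure ?Q ?E" .
qed auto

section \<open>Past and shifted future of a Levy path\<close>

lemma levy_shift_law:
  assumes \<xi>: "levy_process M \<xi>" and s: "0 \<le> s" and t: "0 \<le> t"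
  shows "distr M path_space (\<lambda>\<omega>. sample (\<lambda>r. \<xi> (s + min r t) \<omega> - \<xi> s \<omega>)) =
    distr M path_space (\<lambda>\<omega>. sample (\<lambda>r. \<xi> (min r t) \<omega>))"
proof -
  have "distr M path_space (\<lambda>\<omega>. sample (\<lambda>r. \<xi> (s + min r t) \<omega> - \<xi> s \<omega>)) =
    distr (density M (\<lambda>\<omega>. ennreal (exp (0 * \<xi> t \<omega> - 0 * t)))) path_space (\<lambda>\<omega>. sample (\<lambda>r. \<xi> (min r t) \<omega>))"
  proof (rule levy_path_law[OF \<xi> levy_shift[OF \<xi> s] _ t])
    fix r :: real assume "0 \<le> r"
    then show "distr M borel (\<lambda>\<omega>. \<xi> (s + r) \<omega> - \<xi> s \<omega>) = distr (density M (\<lambda>\<omega>. ennreal (exp (0 * \<xi> r \<omega> - 0 * r)))) borel (\<xi> r)"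
      using levy_stationary[OF \<xi>, of s "s + r"] s by (simp add: density_1)
  qed
  then show ?thesis by (simp add: density_1)
qed

text \<open>Cylinder sets form an intersection-stable generator. Two of them, refined to one grid
  through \<open>s\<close>, become events about the increments before and after the index of
  \<open>s\<close>, that is about disjoint blocks of an independent family.\<close>

lemma levy_indep_path:
  assumes \<xi>: "levy_process M \<xi>" and s: "0 \<le> s" and t: "0 \<le> t"
  shows "prob_space.indep_var M path_space (\<lambda>\<omega>. sample (\<lambda>r. \<xi> (min r s) \<omega>))
     path_space (\<lambda>\<omega>. sample (\<lambda>r. \<xi> (s + min r t) \<omega> - \<xi> s \<omega>))"
proof -
  interpret prob_space M by (rule levy_prob_space[OF \<xi>])
  let ?X = "\<lambda>\<omega>. sample (\<lambda>r. \<xi> (min r s) \<omega>)" and ?Y = "\<lambda>\<omega>. sample (\<lambda>r. \<xi> (s + min r t) \<omega> - \<xi> s \<omega>)"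
  have X[measurable]: "?X \<in> M \<rightarrow>\<^sub>M path_space" by (rule levy_sample_measurable(1)[OF \<xi> s])
  have Y[measurable]: "?Y \<in> M \<rightarrow>\<^sub>M path_space" by (rule levy_sample_measurable(1)[OF levy_shift[OF \<xi> s] t])
  let ?G = "prod_algebra (UNIV :: (nat \<times> nat) set) (\<lambda>_. borel :: real measure)"
  have gen: "{Z -` A \<inter> space M |A. A \<in> sets path_space} = sigma_sets (space M) {Z -` A \<inter> space M |A. A \<in> ?G}" for Z
    unfolding sets_PiM by (rule sigma_sets_vimage_commute) auto
  have stable: "Int_stable {Z -` A \<inter> space M |A. A \<in> ?G}" for Z
  proof (rule Int_stableI, clarify)
    fix A B assume "A \<in> ?G" "B \<in> ?G"
    then have "A \<inter> B \<in> ?G" using Int_stable_prod_algebra by (auto simp: Int_stable_def)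
    moreover have "Z -` A \<inter> space M \<inter> (Z -` B \<inter> space M) = Z -` (A \<inter> B) \<inter> space M" by auto
    ultimately show "\<exists>C. Z -` A \<inter> space M \<inter> (Z -` B \<inter> space M) = Z -` C \<inter> space M \<and> C \<in> ?G" by blast
  qed
  have G_sets: "A \<in> ?G \<Longrightarrow> A \<in> sets path_space" for A unfolding sets_PiM by auto
  have "indep_set {?X -` A \<inter> space M |A. A \<in> ?G} {?Y -` A \<inter> space M |A. A \<in> ?G}"
  proof (rule indep_setI)
    show "{?X -` A \<inter> space M |A. A \<in> ?G} \<subseteq> events" using measurable_sets[OF X G_sets] by auto
    show "{?Y -` A \<inter> space M |A. A \<in> ?G} \<subseteq> events" using measurable_sets[OF Y G_sets] by auto
    fix a b assume "a \<in> {?X -` A \<inter> space M |A. A \<in> ?G}" "b \<in> {?Y -` A \<inter> space M |A. A \<in> ?G}"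
    then obtain E1 E2 where ab: "a = ?X -` E1 \<inter> space M" "b = ?Y -` E2 \<inter> space M" and E: "E1 \<in> ?G" "E2 \<in> ?G" by blast
    obtain J1 A1 where 1: "E1 = prod_emb UNIV (\<lambda>_. borel) J1 (Pi\<^sub>E J1 A1)" "finite J1" "\<And>i. i \<in> J1 \<Longrightarrow> A1 i \<in> sets (borel :: real measure)"
      using E(1) by (rule prod_algebraE) auto
    obtain J2 A2 where 2: "E2 = prod_emb UNIV (\<lambda>_. borel) J2 (Pi\<^sub>E J2 A2)" "finite J2" "\<And>i. i \<in> J2 \<Longrightarrow> A2 i \<in> sets (borel :: real measure)"
      using E(2) by (rule prod_algebraE) auto
    define T where "T j = (real (snd j) + 1) / 2 ^ fst j" for j :: "nat \<times> nat"
    have T: "0 \<le> T j" for j by (simp add: T_def)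
    obtain \<tau> :: "nat \<Rightarrow> real" and m0 where \<tau>: "mono \<tau>" "\<tau> 0 = 0"
      and F: "insert s ((\<lambda>j. min (T j) s) ` J1 \<union> (\<lambda>j. s + min (T j) t) ` J2) \<subseteq> \<tau> ` {..m0}"
      by (rule finite_times[of "insert s ((\<lambda>j. min (T j) s) ` J1 \<union> (\<lambda>j. s + min (T j) t) ` J2)"])
        (use 1(2) 2(2) s t T in auto)
    then obtain m where m: "\<tau> m = s" "m \<le> m0" by auto
    have "\<forall>j\<in>J1. \<exists>i. \<tau> i = min (T j) s \<and> i \<le> m"
    proof
      fix j assume "j \<in> J1"
      then obtain i where i: "\<tau> i = min (T j) s" using F by force
      show "\<exists>i. \<tau> i = min (T j) s \<and> i \<le> m"
      proof (cases "i \<le> m")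
        case False
        then have "\<tau> m \<le> \<tau> i" using monoD[OF \<tau>(1), of m i] by simp
        then have "\<tau> m = min (T j) s" using i m by simp
        then show ?thesis by auto
      qed (use i in auto)
    qed
    then obtain i1 where i1: "\<forall>j\<in>J1. \<tau> (i1 j) = min (T j) s \<and> i1 j \<le> m" by metis
    have "\<forall>j\<in>J2. \<exists>i. \<tau> i = s + min (T j) t \<and> m \<le> i \<and> i \<le> m0"
    proof
      fix j assume "j \<in> J2"
      then obtain i where i: "\<tau> i = s + min (T j) t" "i \<le> m0" using F by force
      show "\<exists>i. \<tau> i = s + min (T j) t \<and> m \<le> i \<and> i \<le> m0"
      proof (cases "m \<le> i")
        case False
        then have "\<tau> i \<le> \<tau> m" using monoD[OF \<tau>(1), of i m] by simp
        then have "\<tau> m = s + min (T j) t" using i m T[of j] t by simp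
        then show ?thesis using m by auto
      qed (use i in auto)
    qed
    then obtain i2 where i2: "\<forall>j\<in>J2. \<tau> (i2 j) = s + min (T j) t \<and> m \<le> i2 j \<and> i2 j \<le> m0" by metis
    let ?inc = "\<lambda>i \<omega>. \<xi> (\<tau> (Suc i)) \<omega> - \<xi> (\<tau> i) \<omega>"
    let ?I1 = "\<lambda>\<omega>. restrict (\<lambda>i. ?inc i \<omega>) {..<m}" and ?I2 = "\<lambda>\<omega>. restrict (\<lambda>i. ?inc i \<omega>) {m..<m0}"
    have ind: "indep_var (PiM {..<m} (\<lambda>_. borel)) ?I1 (PiM {m..<m0} (\<lambda>_. borel)) ?I2"
      by (rule indep_var_restrict[OF levy_indep[OF \<xi> _ \<tau>(1), of m0]]) (use \<tau>(2) m in auto)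
    note [measurable] = indep_var_rv1[OF ind] indep_var_rv2[OF ind]
    define C1 where "C1 = {y \<in> space (PiM {..<m} (\<lambda>_. borel)). \<forall>j\<in>J1. (\<Sum>i<i1 j. y i) \<in> A1 j}"
    define C2 where "C2 = {y \<in> space (PiM {m..<m0} (\<lambda>_. borel)). \<forall>j\<in>J2. (\<Sum>i=m..<i2 j. y i) \<in> A2 j}"
    have C1[measurable]: "C1 \<in> sets (PiM {..<m} (\<lambda>_. borel))"
      unfolding C1_def by (rule sum_cylinder_measurable) (use 1 i1 in auto)
    have C2[measurable]: "C2 \<in> sets (PiM {m..<m0} (\<lambda>_. borel))"
      unfolding C2_def
    proof (intro sets.sets_Collect_finite_All 2(2))
      fix j assume j: "j \<in> J2"
      have [measurable]: "(\<lambda>y. \<Sum>i=m..<i2 j. y i) \<in> borel_measurable (PiM {m..<m0} (\<lambda>_. borel :: real measure))"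
        using i2 j by (intro borel_measurable_sum measurable_component_singleton) auto
      note [measurable] = 2(3)[OF j]
      show "{y \<in> space (PiM {m..<m0} (\<lambda>_. borel)). (\<Sum>i=m..<i2 j. y i) \<in> A2 j} \<in> sets (PiM {m..<m0} (\<lambda>_. borel))"
        by measurable
    qed
    \<comment> \<open>Past values refer to time 0 and so need the almost sure identity
      \<open>\<xi> 0 = 0\<close>; the shifted path consists of increments only, which makes the
      corresponding identity for \<open>b\<close> exact.\<close>
    have a_ae: "AE \<omega> in M. \<omega> \<in> a \<longleftrightarrow> \<omega> \<in> ?I1 -` C1 \<inter> space M"
      using sample_cylinder_increments[OF \<xi> 1(2) \<tau>(2) i1[unfolded T_def], of A1] AE_space
      by eventually_elim (auto simp: ab(1) C1_def 1(1))
    have b_eq: "b = ?I2 -` C2 \<inter> space M"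
    proof -
      have "sample (\<lambda>r. \<xi> (s + min r t) \<omega> - \<xi> s \<omega>) j = (\<Sum>i=m..<i2 j. ?I2 \<omega> i)" if "j \<in> J2" for j \<omega>
      proof -
        have "(\<Sum>i=m..<i2 j. ?I2 \<omega> i) = (\<Sum>i=m..<i2 j. ?inc i \<omega>)" using i2 that by (intro sum.cong) auto
        also have "\<dots> = \<xi> (\<tau> (i2 j)) \<omega> - \<xi> (\<tau> m) \<omega>" using sum_Suc_diff'[of m "i2 j" "\<lambda>i. \<xi> (\<tau> i) \<omega>"] i2 that by auto
        also have "\<dots> = sample (\<lambda>r. \<xi> (s + min r t) \<omega> - \<xi> s \<omega>) j"
          using i2 that m by (simp add: sample_def T_def case_prod_beta)
        finally show ?thesis by simp
      qed
      note eq = this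
      have "\<omega> \<in> b \<longleftrightarrow> \<omega> \<in> ?I2 -` C2 \<inter> space M" for \<omega>
      proof -
        have "\<omega> \<in> b \<longleftrightarrow> \<omega> \<in> space M \<and> (\<forall>j\<in>J2. ?Y \<omega> j \<in> A2 j)"
          by (auto simp: ab(2) 2(1) prod_emb_def PiE_iff)
        also have "\<dots> \<longleftrightarrow> \<omega> \<in> space M \<and> (\<forall>j\<in>J2. (\<Sum>i=m..<i2 j. ?I2 \<omega> i) \<in> A2 j)"
          using eq by simp
        also have "\<dots> \<longleftrightarrow> \<omega> \<in> ?I2 -` C2 \<inter> space M"
          using measurable_space[OF indep_var_rv2[OF ind], of \<omega>] by (auto simp: C2_def)
        finally show ?thesis .
      qed
      then show ?thesis by blast
    qed
    have a_set: "a \<in> events" unfolding ab(1) by (rule measurable_sets[OF X G_sets[OF E(1)]])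
    have b_set: "b \<in> events" unfolding ab(2) by (rule measurable_sets[OF Y G_sets[OF E(2)]])
    have I1_set: "?I1 -` C1 \<inter> space M \<in> events" by measurable
    have I2_set: "?I2 -` C2 \<inter> space M \<in> events" by measurable
    have "prob (a \<inter> b) = prob ((?I1 -` C1 \<inter> space M) \<inter> (?I2 -` C2 \<inter> space M))"
      by (rule measure_eq_AE)
        (use a_ae a_set b_set I1_set I2_set b_eq in \<open>auto elim!: eventually_mono intro!: sets.Int\<close>)
    also have "\<dots> = prob ((\<lambda>x. (?I1 x, ?I2 x)) -` (C1 \<times> C2) \<inter> space M)"
      by (rule arg_cong[where f=prob]) auto
    also have "\<dots> = prob (?I1 -` C1 \<inter> space M) * prob (?I2 -` C2 \<inter> space M)"
      by (rule indep_varD[OF ind C1 C2])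
    also have "prob (?I1 -` C1 \<inter> space M) = prob a"
      by (rule measure_eq_AE) (use a_ae a_set I1_set in \<open>auto elim!: eventually_mono\<close>)
    finally show "prob (a \<inter> b) = prob a * prob b" unfolding b_eq[symmetric] .
  qed
  then have "indep_set (sigma_sets (space M) {?X -` A \<inter> space M |A. A \<in> ?G}) (sigma_sets (space M) {?Y -` A \<inter> space M |A. A \<in> ?G})"
    by (rule indep_set_sigma_sets) (rule stable)+
  moreover have "sigma_sets (space M) {Z -` A \<inter> space M |A. A \<in> sets path_space} = sigma_sets (space M) {Z -` A \<inter> space M |A. A \<in> ?G}" for Z
    unfolding gen by (rule sigma_sets_sigma_sets_eq) auto
  ultimately show ?thesis unfolding indep_var_eq using X Y by simp
qed

lemma levy_path_split:
  assumes \<xi>: "levy_process M \<xi>" and s: "0 \<le> s" and t: "0 \<le> t"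
  defines "X \<equiv> \<lambda>s \<omega>. sample (\<lambda>r. \<xi> (min r s) \<omega>)"
    and "Y \<equiv> \<lambda>\<omega>. sample (\<lambda>r. \<xi> (s + min r t) \<omega> - \<xi> s \<omega>)"
  shows "distr M (path_space \<Otimes>\<^sub>M path_space) (\<lambda>\<omega>. (X s \<omega>, Y \<omega>)) = distr M path_space (X s) \<Otimes>\<^sub>M distr M path_space (X t)"
proof -
  interpret prob_space M by (rule levy_prob_space[OF \<xi>])
  have "distr M path_space (X s) \<Otimes>\<^sub>M distr M path_space Y = distr M (path_space \<Otimes>\<^sub>M path_space) (\<lambda>\<omega>. (X s \<omega>, Y \<omega>))"
    using levy_indep_path[OF assms(1-3)] unfolding indep_var_distribution_eq X_def Y_def by blast
  moreover have "distr M path_space Y = distr M path_space (X t)"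
    unfolding X_def Y_def by (rule levy_shift_law[OF assms(1-3)])
  ultimately show ?thesis by simp
qed

text \<open>The form in which independence and stationarity enter the Markov property: under an
  inner integral the shifted path becomes an independent copy.\<close>

lemma levy_path_split_nn_integral:
  assumes \<xi>: "levy_process M \<xi>" and s: "0 \<le> s" and t: "0 \<le> t"
    and h[measurable]: "h \<in> borel_measurable (path_space \<Otimes>\<^sub>M path_space)"
  shows "(\<integral>\<^sup>+\<omega>. h (sample (\<lambda>r. \<xi> (min r s) \<omega>), sample (\<lambda>r. \<xi> (s + min r t) \<omega> - \<xi> s \<omega>)) \<partial>M) =
    (\<integral>\<^sup>+\<omega>. \<integral>\<^sup>+\<omega>'. h (sample (\<lambda>r. \<xi> (min r s) \<omega>), sample (\<lambda>r. \<xi> (min r t) \<omega>')) \<partial>M \<partial>M)"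
proof -
  let ?X = "\<lambda>s \<omega>. sample (\<lambda>r. \<xi> (min r s) \<omega>)" and ?Y = "\<lambda>\<omega>. sample (\<lambda>r. \<xi> (s + min r t) \<omega> - \<xi> s \<omega>)"
  interpret prob_space M by (rule levy_prob_space[OF \<xi>])
  note [measurable] = levy_sample_measurable(1)[OF \<xi> s] levy_sample_measurable(1)[OF \<xi> t]
    levy_sample_measurable(1)[OF levy_shift[OF \<xi> s] t]
  interpret T: prob_space "distr M path_space (?X t)" by (rule prob_space_distr) measurable
  have "(\<integral>\<^sup>+\<omega>. h (?X s \<omega>, ?Y \<omega>) \<partial>M) = (\<integral>\<^sup>+p. h p \<partial>distr M (path_space \<Otimes>\<^sub>M path_space) (\<lambda>\<omega>. (?X s \<omega>, ?Y \<omega>)))"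
    by (rule nn_integral_distr[symmetric]) measurable
  also have "\<dots> = (\<integral>\<^sup>+p. h p \<partial>(distr M path_space (?X s) \<Otimes>\<^sub>M distr M path_space (?X t)))"
    unfolding levy_path_split[OF \<xi> s t] ..
  also have "\<dots> = (\<integral>\<^sup>+x. \<integral>\<^sup>+y. h (x, y) \<partial>distr M path_space (?X t) \<partial>distr M path_space (?X s))"
    by (rule T.nn_integral_fst[symmetric]) simp
  also have "\<dots> = (\<integral>\<^sup>+\<omega>. \<integral>\<^sup>+y. h (?X s \<omega>, y) \<partial>distr M path_space (?X t) \<partial>M)"
  proof (rule nn_integral_distr)
    have "h \<in> borel_measurable (path_space \<Otimes>\<^sub>M distr M path_space (?X t))"
      using h by (simp add: measurable_cong_sets[OF sets_pair_measure_cong[OF refl sets_distr] refl])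
    then have "(\<lambda>x. \<integral>\<^sup>+y. h (x, y) \<partial>distr M path_space (?X t)) \<in> borel_measurable path_space"
      by (rule T.borel_measurable_nn_integral_fst)
    then show "(\<lambda>x. \<integral>\<^sup>+y. h (x, y) \<partial>distr M path_space (?X t)) \<in> borel_measurable (distr M path_space (?X s))"
      by simp
  qed measurable
  also have "\<dots> = (\<integral>\<^sup>+\<omega>. \<integral>\<^sup>+\<omega>'. h (?X s \<omega>, ?X t \<omega>') \<partial>M \<partial>M)"
    by (intro nn_integral_cong nn_integral_distr) measurable
  finally show ?thesis .
qed

lemma levy_path_split_integral:
  fixes h :: "_ \<Rightarrow> real"
  assumes \<xi>: "levy_process M \<xi>" and s: "0 \<le> s" and t: "0 \<le> t"
    and h[measurable]: "h \<in> borel_measurable (path_space \<Otimes>\<^sub>M path_space)" and bd: "\<And>p. \<bar>h p\<bar> \<le> B"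
  shows "(\<integral>\<omega>. h (sample (\<lambda>r. \<xi> (min r s) \<omega>), sample (\<lambda>r. \<xi> (s + min r t) \<omega> - \<xi> s \<omega>)) \<partial>M) =
    (\<integral>\<omega>. \<integral>\<omega>'. h (sample (\<lambda>r. \<xi> (min r s) \<omega>), sample (\<lambda>r. \<xi> (min r t) \<omega>')) \<partial>M \<partial>M)"
proof -
  let ?X = "\<lambda>s \<omega>. sample (\<lambda>r. \<xi> (min r s) \<omega>)" and ?Y = "\<lambda>\<omega>. sample (\<lambda>r. \<xi> (s + min r t) \<omega> - \<xi> s \<omega>)"
  interpret prob_space M by (rule levy_prob_space[OF \<xi>])
  note [measurable] = levy_sample_measurable(1)[OF \<xi> s] levy_sample_measurable(1)[OF \<xi> t]
    levy_sample_measurable(1)[OF levy_shift[OF \<xi> s] t]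
  interpret T: prob_space "distr M path_space (?X t)" by (rule prob_space_distr) measurable
  interpret S: prob_space "distr M path_space (?X s)" by (rule prob_space_distr) measurable
  interpret P: pair_prob_space "distr M path_space (?X s)" "distr M path_space (?X t)" ..
  have int: "integrable (distr M path_space (?X s) \<Otimes>\<^sub>M distr M path_space (?X t)) h"
    by (rule P.integrable_const_bound[where B=B]) (use bd in \<open>auto simp: measurable_cong_sets[OF sets_pair_measure_cong[OF sets_distr sets_distr] refl]\<close>)
  have "(\<integral>\<omega>. h (?X s \<omega>, ?Y \<omega>) \<partial>M) = (\<integral>p. h p \<partial>distr M (path_space \<Otimes>\<^sub>M path_space) (\<lambda>\<omega>. (?X s \<omega>, ?Y \<omega>)))"
    by (rule integral_distr[symmetric]) measurable
  also have "\<dots> = (\<integral>p. h p \<partial>(distr M path_space (?X s) \<Otimes>\<^sub>M distr M path_space (?X t)))"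
    unfolding levy_path_split[OF \<xi> s t] ..
  also have "\<dots> = (\<integral>x. \<integral>y. h (x, y) \<partial>distr M path_space (?X t) \<partial>distr M path_space (?X s))"
    by (rule P.integral_fst'[OF int, symmetric])
  also have "\<dots> = (\<integral>\<omega>. \<integral>y. h (?X s \<omega>, y) \<partial>distr M path_space (?X t) \<partial>M)"
    by (rule integral_distr) measurable
  also have "\<dots> = (\<integral>\<omega>. \<integral>\<omega>'. h (?X s \<omega>, ?X t \<omega>') \<partial>M \<partial>M)"
    by (intro Bochner_Integration.integral_cong refl integral_distr) measurable
  finally show ?thesis .
qed

section \<open>The Feller property of \<open>Z\<close>\<close>

text \<open>The flow map of Z: position at time \<open>t\<close> when started from \<open>z\<close>
  and driven by the path encoded in \<open>y\<close>. The starting point enters as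
  \<open>1 / z\<close> because \<open>recip_OU\<close> with parameter \<open>x\<close> starts from
  \<open>1 / x\<close>.\<close>

definition recip_path :: "real \<Rightarrow> real \<Rightarrow> real \<Rightarrow> real \<Rightarrow> (nat \<times> nat \<Rightarrow> real) \<Rightarrow> real" where
  "recip_path \<alpha> \<beta> t z y = exp (\<alpha> * path y t) * inverse (1 / z + \<beta> * lamperti_V \<alpha> (path y) t)"

lemma recip_path_measurable [measurable (raw)]:
  assumes [measurable]: "g \<in> M \<rightarrow>\<^sub>M path_space" "z \<in> borel_measurable M"
  shows "(\<lambda>x. recip_path \<alpha> \<beta> t (z x) (g x)) \<in> borel_measurable M"
  unfolding recip_path_def by measurable

lemma recip_path_pos: "0 < z \<Longrightarrow> 0 < \<beta> \<Longrightarrow> 0 < recip_path \<alpha> \<beta> t z y"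
  unfolding recip_path_def using lamperti_V_nonneg[of \<alpha> "path y" t]
  by (intro mult_pos_pos positive_imp_inverse_positive add_pos_nonneg) auto

lemma recip_OU_V: "recip_OU \<alpha> \<beta> x \<xi> t \<omega> = exp (\<alpha> * \<xi> t \<omega>) * inverse (x + \<beta> * lamperti_V \<alpha> (\<lambda>t. \<xi> t \<omega>) t)"
  by (simp add: recip_OU_def lamperti_V_def)

lemma lamperti_V_shift:
  assumes f: "cadlag_in E f" and "0 \<le> s" "0 \<le> t"
  shows "lamperti_V \<alpha> f (s + t) = lamperti_V \<alpha> f s + exp (\<alpha> * f s) * lamperti_V \<alpha> (\<lambda>r. f (s + r) - f s) t"
proof -
  let ?h = "\<lambda>v. exp (\<alpha> * f (max 0 v))"
  have "lamperti_V \<alpha> f (s + t) = lamperti_V \<alpha> f s + (LBINT v:{s..s + t}. ?h v)"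
    unfolding lamperti_V_max by (rule primitive_split(2)[OF _ cadlag_exp_integrable[OF f]]) (use assms in auto)
  also have "(LBINT v:{s..s + t}. ?h v) = (LBINT r:{0..t}. ?h (s + r))"
    unfolding set_lebesgue_integral_def
    by (subst lborel_integral_real_affine[where c=1 and t=s]) (auto intro!: Bochner_Integration.integral_cong simp: indicator_def)
  also have "\<dots> = (LBINT r:{0..t}. exp (\<alpha> * f s) * exp (\<alpha> * (f (s + r) - f s)))"
    by (rule set_lebesgue_integral_cong) (use assms in \<open>auto simp: exp_add[symmetric] algebra_simps\<close>)
  also have "\<dots> = exp (\<alpha> * f s) * lamperti_V \<alpha> (\<lambda>r. f (s + r) - f s) t"
    by (simp add: lamperti_V_def)
  finally show ?thesis .
qed

lemma recip_OU_start:
  assumes \<alpha>: "0 < \<alpha>" and \<xi>: "levy_process M \<xi>"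
  shows "AE \<omega> in M. recip_OU \<alpha> \<beta> x \<xi> 0 \<omega> = 1 / x"
  using levy_zero[OF \<xi>] AE_space
proof eventually_elim
  case (elim \<omega>)
  have "lamperti_V \<alpha> (\<lambda>t. \<xi> t \<omega>) 0 = 0" by (rule lamperti_V_0[OF \<alpha> \<alpha> levy_cadlag[OF \<xi> elim(2)]])
  then show ?case using elim by (simp add: recip_OU_V inverse_eq_divide)
qed

context
  fixes M :: "'a measure" and \<xi> :: "real \<Rightarrow> 'a \<Rightarrow> real" and \<alpha> \<beta> :: real
  assumes \<xi>: "levy_process M \<xi>" and \<alpha>: "0 < \<alpha>" and \<beta>: "0 < \<beta>"
begin

lemma stopped_path:
  assumes "\<omega> \<in> space M" "0 \<le> r" "r \<le> s"
  shows "path (sample (\<lambda>u. \<xi> (min u s) \<omega>)) r = \<xi> r \<omega>"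
    "lamperti_V \<alpha> (path (sample (\<lambda>u. \<xi> (min u s) \<omega>))) r = lamperti_V \<alpha> (\<lambda>t. \<xi> t \<omega>) r"
proof -
  have c: "cadlag_in UNIV (\<lambda>u. \<xi> (min u s) \<omega>)" by (rule cadlag_in_stopped[OF levy_cadlag[OF \<xi> assms(1)]]) (use assms in auto)
  have p: "path (sample (\<lambda>u. \<xi> (min u s) \<omega>)) v = \<xi> v \<omega>" if "0 \<le> v" "v \<le> r" for v
    using path_sample[OF that(1) cadlag_in_right[OF c that(1)]] that assms by simp
  then show "path (sample (\<lambda>u. \<xi> (min u s) \<omega>)) r = \<xi> r \<omega>" using assms by simp
  show "lamperti_V \<alpha> (path (sample (\<lambda>u. \<xi> (min u s) \<omega>))) r = lamperti_V \<alpha> (\<lambda>t. \<xi> t \<omega>) r"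
    by (rule lamperti_V_cong) (rule p)
qed

lemma recip_OU_path:
  assumes "\<omega> \<in> space M" "0 \<le> r" "r \<le> s"
  shows "recip_OU \<alpha> \<beta> (1 / z) \<xi> r \<omega> = recip_path \<alpha> \<beta> r z (sample (\<lambda>u. \<xi> (min u s) \<omega>))"
  using stopped_path[OF assms] by (simp add: recip_OU_V recip_path_def)

lemma recip_OU_pos: "0 < z \<Longrightarrow> 0 < recip_OU \<alpha> \<beta> (1 / z) \<xi> t \<omega>"
  unfolding recip_OU_V using lamperti_V_nonneg[of \<alpha> _ t] \<beta>
  by (intro mult_pos_pos positive_imp_inverse_positive add_pos_nonneg) auto

lemma recip_OU_joint_measurable:
  assumes t: "0 \<le> t"
  shows "(\<lambda>(z, \<omega>). recip_OU \<alpha> \<beta> (1 / z) \<xi> t \<omega>) \<in> borel_measurable (borel \<Otimes>\<^sub>M M)"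
proof -
  note [measurable] = levy_sample_measurable(1)[OF \<xi> t]
  have "(\<lambda>(z, \<omega>). recip_OU \<alpha> \<beta> (1 / z) \<xi> t \<omega>) \<in> borel_measurable (borel \<Otimes>\<^sub>M M) \<longleftrightarrow>
     (\<lambda>p. recip_path \<alpha> \<beta> t (fst p) (sample (\<lambda>u. \<xi> (min u t) (snd p)))) \<in> borel_measurable (borel \<Otimes>\<^sub>M M)"
    by (rule measurable_cong) (auto simp: space_pair_measure recip_OU_path[OF _ t order_refl])
  also have "\<dots>" by measurable
  finally show ?thesis .
qed

lemma recip_OU_measurable: "0 \<le> t \<Longrightarrow> recip_OU \<alpha> \<beta> (1 / z) \<xi> t \<in> borel_measurable M"
  using measurable_compose[OF measurable_Pair1'[of z borel M] recip_OU_joint_measurable] by simp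

lemma recip_OU_measurable_pos:
  assumes "0 < z" "0 \<le> t" shows "recip_OU \<alpha> \<beta> (1 / z) \<xi> t \<in> M \<rightarrow>\<^sub>M restrict_space borel {0<..}"
  by (rule measurable_restrict_space2) (use recip_OU_measurable[OF assms(2)] recip_OU_pos[OF assms(1)] in auto)

text \<open>The reciprocal of Z is affine in its past: the integral up to \<open>s + t\<close>
  splits at \<open>s\<close>, the factor \<open>exp (\<alpha> * \<xi> s \<omega>)\<close> comes out
  of the second piece, and the past survives only through \<open>1 / Z\<close> at time
  \<open>s\<close>.\<close>

lemma recip_OU_flow:
  assumes "\<omega> \<in> space M" "0 \<le> s" "0 \<le> t" "0 < z"
  shows "recip_OU \<alpha> \<beta> (1 / z) \<xi> (s + t) \<omega> =
    recip_path \<alpha> \<beta> t (recip_OU \<alpha> \<beta> (1 / z) \<xi> s \<omega>) (sample (\<lambda>r. \<xi> (s + min r t) \<omega> - \<xi> s \<omega>))"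
proof -
  let ?f = "\<lambda>t. \<xi> t \<omega>"
  let ?g = "\<lambda>r. \<xi> (s + r) \<omega> - \<xi> s \<omega>"
  have f: "cadlag_in UNIV ?f" by (rule levy_cadlag[OF \<xi> assms(1)])
  have g: "cadlag_in UNIV ?g" using levy_cadlag[OF levy_shift[OF \<xi> assms(2)] assms(1)] .
  have gs: "cadlag_in UNIV (\<lambda>r. ?g (min r t))" by (rule cadlag_in_stopped[OF g assms(3)])
  have p: "path (sample (\<lambda>r. ?g (min r t))) v = ?g v" if "0 \<le> v" "v \<le> t" for v
    using path_sample[OF that(1) cadlag_in_right[OF gs that(1)]] that by simp
  have V: "lamperti_V \<alpha> (path (sample (\<lambda>r. ?g (min r t)))) t = lamperti_V \<alpha> ?g t"
    by (rule lamperti_V_cong) (rule p)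
  let ?A = "1 / z + \<beta> * lamperti_V \<alpha> ?f s"
  have A: "0 < ?A" using assms(4) \<beta> lamperti_V_nonneg[of \<alpha> ?f s] by (intro add_pos_nonneg) auto
  have "1 / recip_OU \<alpha> \<beta> (1 / z) \<xi> s \<omega> + \<beta> * lamperti_V \<alpha> ?g t = exp (- \<alpha> * ?f s) * (?A + \<beta> * (exp (\<alpha> * ?f s) * lamperti_V \<alpha> ?g t))"
    using A by (simp add: recip_OU_V exp_minus field_simps)
  also have "\<dots> = exp (- \<alpha> * ?f s) * (1 / z + \<beta> * lamperti_V \<alpha> ?f (s + t))"
    unfolding lamperti_V_shift[OF f assms(2,3)] by (simp add: algebra_simps)
  finally have "recip_path \<alpha> \<beta> t (recip_OU \<alpha> \<beta> (1 / z) \<xi> s \<omega>) (sample (\<lambda>r. ?g (min r t))) =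
      exp (\<alpha> * ?g t) * inverse (exp (- \<alpha> * ?f s) * (1 / z + \<beta> * lamperti_V \<alpha> ?f (s + t)))"
    unfolding recip_path_def using p[of t] V assms by simp
  also have "\<dots> = exp (\<alpha> * ?g t) * exp (\<alpha> * ?f s) * inverse (1 / z + \<beta> * lamperti_V \<alpha> ?f (s + t))"
    by (simp add: exp_minus)
  also have "exp (\<alpha> * ?g t) * exp (\<alpha> * ?f s) = exp (\<alpha> * ?f (s + t))" by (simp add: exp_add[symmetric] algebra_simps)
  finally show ?thesis by (simp add: recip_OU_V)
qed

definition recip_kernel :: "real \<Rightarrow> real \<Rightarrow> real measure" where
  "recip_kernel t z = distr M (restrict_space borel {0<..}) (recip_OU \<alpha> \<beta> (1 / z) \<xi> t)"

lemma recip_kernel_measurable: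
  assumes t: "0 \<le> t"
  shows "recip_kernel t \<in> restrict_space borel {0<..} \<rightarrow>\<^sub>M prob_algebra (restrict_space borel {0<..})"
proof (rule measurable_prob_algebraI)
  interpret prob_space M by (rule levy_prob_space[OF \<xi>])
  show "prob_space (recip_kernel t z)" if "z \<in> space (restrict_space borel {0<..})" for z
    unfolding recip_kernel_def by (rule prob_space_distr) (use that t recip_OU_measurable_pos in \<open>auto simp: space_restrict_space\<close>)
  let ?E = "restrict_space borel {0::real<..}"
  \<comment> \<open>Joint measurability in the starting point and the sample point makes the image
    measure depend measurably on \<open>z\<close>.\<close>
  have "(\<lambda>(z, \<omega>). recip_OU \<alpha> \<beta> (1 / z) \<xi> t \<omega>) \<in> ?E \<Otimes>\<^sub>M M \<rightarrow>\<^sub>M ?E"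
  proof (rule measurable_restrict_space2)
    show "(\<lambda>(z, \<omega>). recip_OU \<alpha> \<beta> (1 / z) \<xi> t \<omega>) \<in> space (?E \<Otimes>\<^sub>M M) \<rightarrow> {0<..}"
      using recip_OU_pos by (auto simp: space_pair_measure space_restrict_space)
    have "(\<lambda>p. (fst p, snd p)) \<in> ?E \<Otimes>\<^sub>M M \<rightarrow>\<^sub>M borel \<Otimes>\<^sub>M M"
      by (intro measurable_Pair measurable_compose[OF measurable_fst] measurable_snd measurable_restrict_space1) simp
    from measurable_compose[OF this recip_OU_joint_measurable[OF t]]
    show "(\<lambda>(z, \<omega>). recip_OU \<alpha> \<beta> (1 / z) \<xi> t \<omega>) \<in> borel_measurable (?E \<Otimes>\<^sub>M M)" by (simp add: case_prod_beta')
  qed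
  moreover have "(\<lambda>_. M) \<in> ?E \<rightarrow>\<^sub>M subprob_algebra M"
    by (intro measurable_const) (simp add: space_subprob_algebra, unfold_locales)
  ultimately show "recip_kernel t \<in> ?E \<rightarrow>\<^sub>M subprob_algebra ?E"
    unfolding recip_kernel_def by (rule measurable_distr2)
qed

lemma recip_kernel_integral:
  fixes f :: "real \<Rightarrow> real"
  assumes "0 \<le> t" "0 < z" "f \<in> borel_measurable (restrict_space borel {0<..})"
  shows "(\<integral>y. f y \<partial>recip_kernel t z) = (\<integral>\<omega>. f (recip_OU \<alpha> \<beta> (1 / z) \<xi> t \<omega>) \<partial>M)"
  unfolding recip_kernel_def by (rule integral_distr) (use recip_OU_measurable_pos assms in auto)

lemma recip_kernel_emeasure:
  assumes t: "0 \<le> t" and z: "0 < z" and A: "A \<in> sets (restrict_space borel {0<..})"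
  shows "emeasure (recip_kernel t z) A = (\<integral>\<^sup>+\<omega>. indicator A (recip_path \<alpha> \<beta> t z (sample (\<lambda>u. \<xi> (min u t) \<omega>))) \<partial>M)"
proof -
  have "emeasure (recip_kernel t z) A = emeasure M (recip_OU \<alpha> \<beta> (1 / z) \<xi> t -` A \<inter> space M)"
    unfolding recip_kernel_def by (rule emeasure_distr[OF recip_OU_measurable_pos[OF z t] A])
  also have "\<dots> = (\<integral>\<^sup>+\<omega>. indicator (recip_OU \<alpha> \<beta> (1 / z) \<xi> t -` A \<inter> space M) \<omega> \<partial>M)"
    by (rule nn_integral_indicator[symmetric]) (rule measurable_sets[OF recip_OU_measurable_pos[OF z t] A])
  also have "\<dots> = (\<integral>\<^sup>+\<omega>. indicator A (recip_path \<alpha> \<beta> t z (sample (\<lambda>u. \<xi> (min u t) \<omega>))) \<partial>M)"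
    by (rule nn_integral_cong) (auto simp: indicator_def recip_OU_path[OF _ t order_refl])
  finally show ?thesis .
qed

text \<open>The flow property writes the value at \<open>s + t\<close> as a function of the stopped
  and the shifted path; averaging the latter as an independent copy is one application of
  \<open>recip_kernel t\<close>.\<close>

lemma recip_kernel_chapman_kolmogorov:
  assumes s: "0 \<le> s" and t: "0 \<le> t" and z: "0 < z"
  shows "recip_kernel (s + t) z = Giry_Monad.bind (recip_kernel s z) (recip_kernel t)"
proof (rule measure_eqI)
  let ?E = "restrict_space borel {0::real<..}"
  have spE: "space ?E = {0<..}" by (simp add: space_restrict_space)
  have k: "recip_kernel t \<in> recip_kernel s z \<rightarrow>\<^sub>M subprob_algebra ?E"
    using measurable_prob_algebraD[OF recip_kernel_measurable[OF t]] unfolding recip_kernel_def by simp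
  have ne: "space (recip_kernel s z) \<noteq> {}" by (simp add: recip_kernel_def spE)
  show "sets (recip_kernel (s + t) z) = sets (recip_kernel s z \<bind> recip_kernel t)"
    using sets_bind[OF sets_kernel[OF k] ne] by (simp add: recip_kernel_def)
  fix A assume "A \<in> sets (recip_kernel (s + t) z)"
  then have A: "A \<in> sets ?E" by (simp add: recip_kernel_def)
  then have A': "A \<in> sets borel" by (simp add: sets_restrict_space_iff)
  have st: "0 \<le> s + t" using s t by simp
  define h where "h p = (indicator A (recip_path \<alpha> \<beta> t (recip_path \<alpha> \<beta> s z (fst p)) (snd p)) :: ennreal)" for p
  have h: "h \<in> borel_measurable (path_space \<Otimes>\<^sub>M path_space)" unfolding h_def using A' by measurable
  have "emeasure (recip_kernel (s + t) z) A = emeasure M (recip_OU \<alpha> \<beta> (1 / z) \<xi> (s + t) -` A \<inter> space M)"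
    unfolding recip_kernel_def by (rule emeasure_distr[OF recip_OU_measurable_pos[OF z st] A])
  also have "\<dots> = (\<integral>\<^sup>+\<omega>. indicator (recip_OU \<alpha> \<beta> (1 / z) \<xi> (s + t) -` A \<inter> space M) \<omega> \<partial>M)"
    by (rule nn_integral_indicator[symmetric]) (rule measurable_sets[OF recip_OU_measurable_pos[OF z st] A])
  also have "\<dots> = (\<integral>\<^sup>+\<omega>. h (sample (\<lambda>r. \<xi> (min r s) \<omega>), sample (\<lambda>r. \<xi> (s + min r t) \<omega> - \<xi> s \<omega>)) \<partial>M)"
    by (rule nn_integral_cong) (simp add: h_def indicator_def recip_OU_flow[OF _ s t z] recip_OU_path[OF _ s order_refl])
  also have "\<dots> = (\<integral>\<^sup>+\<omega>. \<integral>\<^sup>+\<omega>'. h (sample (\<lambda>r. \<xi> (min r s) \<omega>), sample (\<lambda>r. \<xi> (min r t) \<omega>')) \<partial>M \<partial>M)"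
    by (rule levy_path_split_nn_integral[OF \<xi> s t h])
  also have "\<dots> = (\<integral>\<^sup>+\<omega>. emeasure (recip_kernel t (recip_OU \<alpha> \<beta> (1 / z) \<xi> s \<omega>)) A \<partial>M)"
    by (rule nn_integral_cong) (simp add: recip_kernel_emeasure[OF t recip_path_pos[OF z \<beta>] A] h_def recip_OU_path[OF _ s order_refl])
  also have "\<dots> = (\<integral>\<^sup>+w. emeasure (recip_kernel t w) A \<partial>recip_kernel s z)"
    unfolding recip_kernel_def[of s]
    by (rule nn_integral_distr[symmetric, OF recip_OU_measurable_pos[OF z s]])
      (use measurable_emeasure_kernel[OF k A] in \<open>simp add: recip_kernel_def[of s]\<close>)
  also have "\<dots> = emeasure (recip_kernel s z \<bind> recip_kernel t) A"
    by (rule emeasure_bind[OF ne k A, symmetric])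
  finally show "emeasure (recip_kernel (s + t) z) A = emeasure (recip_kernel s z \<bind> recip_kernel t) A" .
qed

lemma recip_kernel_zero:
  assumes z: "0 < z" shows "recip_kernel 0 z = return (restrict_space borel {0<..}) z"
proof -
  interpret prob_space M by (rule levy_prob_space[OF \<xi>])
  let ?E = "restrict_space borel {0::real<..}"
  have zE: "z \<in> space ?E" using z by (simp add: space_restrict_space)
  have "recip_kernel 0 z = distr M ?E (\<lambda>_. z)"
    unfolding recip_kernel_def
    by (rule distr_cong_AE) (use recip_OU_start[OF \<alpha> \<xi>, of \<beta> "1 / z"] recip_OU_measurable_pos[OF z] zE in auto)
  also have "\<dots> = return ?E z" by (rule distr_const[OF zE])
  finally show ?thesis .
qed

lemma recip_OU_continuous_right:
  assumes "\<omega> \<in> space M" "0 \<le> t" "0 < z"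
  shows "((\<lambda>t. recip_OU \<alpha> \<beta> (1 / z) \<xi> t \<omega>) \<longlongrightarrow> recip_OU \<alpha> \<beta> (1 / z) \<xi> t \<omega>) (at_right t)"
proof -
  let ?f = "\<lambda>t. \<xi> t \<omega>"
  have f: "cadlag_in UNIV ?f" by (rule levy_cadlag[OF \<xi> assms(1)])
  have 1: "(?f \<longlongrightarrow> ?f t) (at_right t)" using cadlag_in_right[OF f assms(2)] by (simp add: continuous_within)
  have "(lamperti_V \<alpha> ?f \<longlongrightarrow> lamperti_V \<alpha> ?f t) (at t within {0..})"
    using lamperti_V_continuous[OF \<alpha> \<alpha> f] assms(2) by (simp add: continuous_on)
  moreover have "at_right t \<le> at t within {0..}" by (rule at_le) (use assms(2) in auto)
  ultimately have 2: "(lamperti_V \<alpha> ?f \<longlongrightarrow> lamperti_V \<alpha> ?f t) (at_right t)" by (rule tendsto_mono[rotated])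
  have "0 < 1 / z + \<beta> * lamperti_V \<alpha> ?f t" using assms(3) \<beta> lamperti_V_nonneg[of \<alpha> ?f t] by (intro add_pos_nonneg) auto
  then show ?thesis unfolding recip_OU_V by (intro tendsto_intros 1 2) auto
qed

lemma recip_OU_cadlag:
  assumes "\<omega> \<in> space M" "0 < z"
  shows "cadlag_in {0<..} (\<lambda>t. recip_OU \<alpha> \<beta> (1 / z) \<xi> t \<omega>)"
  unfolding cadlag_in_def
proof (intro conjI allI impI)
  show "recip_OU \<alpha> \<beta> (1 / z) \<xi> t \<omega> \<in> {0<..}" for t using recip_OU_pos[OF assms(2)] by simp
  show "continuous (at_right t) (\<lambda>t. recip_OU \<alpha> \<beta> (1 / z) \<xi> t \<omega>)" if "0 \<le> t" for t
    using recip_OU_continuous_right[OF assms(1) that assms(2)] by (simp add: continuous_within)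
  fix t :: real assume t: "0 < t"
  let ?f = "\<lambda>t. \<xi> t \<omega>"
  have f: "cadlag_in UNIV ?f" by (rule levy_cadlag[OF \<xi> assms(1)])
  obtain l where 1: "(?f \<longlongrightarrow> l) (at_left t)" using f t unfolding cadlag_in_def by blast
  have "isCont (lamperti_V \<alpha> ?f) t"
    using continuous_on_interior[OF lamperti_V_continuous[OF \<alpha> \<alpha> f], of t] t by (simp add: interior_Ici)
  then have 2: "(lamperti_V \<alpha> ?f \<longlongrightarrow> lamperti_V \<alpha> ?f t) (at_left t)"
    by (simp add: isCont_def filterlim_at_split)
  have p: "0 < 1 / z + \<beta> * lamperti_V \<alpha> ?f t" using assms(2) \<beta> lamperti_V_nonneg[of \<alpha> ?f t] by (intro add_pos_nonneg) auto
  have "((\<lambda>t. recip_OU \<alpha> \<beta> (1 / z) \<xi> t \<omega>) \<longlongrightarrow> exp (\<alpha> * l) * inverse (1 / z + \<beta> * lamperti_V \<alpha> ?f t)) (at_left t)"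
    unfolding recip_OU_V using p by (intro tendsto_intros 1 2) auto
  moreover have "exp (\<alpha> * l) * inverse (1 / z + \<beta> * lamperti_V \<alpha> ?f t) \<in> {0<..}" using p by simp
  ultimately show "\<exists>l\<in>{0<..}. ((\<lambda>t. recip_OU \<alpha> \<beta> (1 / z) \<xi> t \<omega>) \<longlongrightarrow> l) (at_left t)" by blast
qed

text \<open>Dominated convergence on the one space that carries all starting points: for fixed
  \<open>\<omega>\<close> the value is continuous in \<open>z\<close> and right-continuous in time,
  and almost surely it starts from \<open>z\<close>.\<close>

lemma recip_kernel_continuous:
  fixes f :: "real \<Rightarrow> real"
  assumes f: "continuous_on {0<..} f" "bounded (f ` {0<..})"
  shows "0 \<le> t \<Longrightarrow> continuous_on {0<..} (\<lambda>z. \<integral>y. f y \<partial>recip_kernel t z)"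
    "0 < z \<Longrightarrow> ((\<lambda>t. \<integral>y. f y \<partial>recip_kernel t z) \<longlongrightarrow> f z) (at_right 0)"
proof -
  interpret prob_space M by (rule levy_prob_space[OF \<xi>])
  obtain B where B: "\<And>y. 0 < y \<Longrightarrow> \<bar>f y\<bar> \<le> B" using f(2) unfolding bounded_iff by auto
  have fm: "f \<in> borel_measurable (restrict_space borel {0<..})" by (rule borel_measurable_continuous_on_restrict[OF f(1)])
  have meas: "(\<lambda>\<omega>. f (recip_OU \<alpha> \<beta> (1 / z) \<xi> t \<omega>)) \<in> borel_measurable M" if "0 < z" "0 \<le> t" for z t
    by (rule measurable_compose[OF recip_OU_measurable_pos[OF that] fm])
  have fc: "isCont f y" if "0 < y" for y by (rule continuous_on_interior[OF f(1)]) (use that in \<open>simp add: interior_open\<close>)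
  show "continuous_on {0<..} (\<lambda>z. \<integral>y. f y \<partial>recip_kernel t z)" if t: "0 \<le> t"
    unfolding continuous_on_sequentially
  proof (intro allI ballI impI, elim conjE)
    fix X :: "nat \<Rightarrow> real" and z assume z: "z \<in> {0<..}" and X: "\<forall>n. X n \<in> {0<..}" "X \<longlonglongrightarrow> z"
    have "(\<lambda>n. \<integral>\<omega>. f (recip_OU \<alpha> \<beta> (1 / X n) \<xi> t \<omega>) \<partial>M) \<longlonglongrightarrow> (\<integral>\<omega>. f (recip_OU \<alpha> \<beta> (1 / z) \<xi> t \<omega>) \<partial>M)"
    proof (rule integral_dominated_convergence[where w="\<lambda>_. B"])
      show "AE \<omega> in M. (\<lambda>n. f (recip_OU \<alpha> \<beta> (1 / X n) \<xi> t \<omega>)) \<longlonglongrightarrow> f (recip_OU \<alpha> \<beta> (1 / z) \<xi> t \<omega>)"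
      proof (rule AE_I2)
        fix \<omega>
        have "0 < 1 / z + \<beta> * lamperti_V \<alpha> (\<lambda>t. \<xi> t \<omega>) t"
          using z \<beta> lamperti_V_nonneg[of \<alpha> "\<lambda>t. \<xi> t \<omega>" t] by (intro add_pos_nonneg) auto
        then have "(\<lambda>n. recip_OU \<alpha> \<beta> (1 / X n) \<xi> t \<omega>) \<longlonglongrightarrow> recip_OU \<alpha> \<beta> (1 / z) \<xi> t \<omega>"
          unfolding recip_OU_V using z by (intro tendsto_intros X(2)) auto
        then show "(\<lambda>n. f (recip_OU \<alpha> \<beta> (1 / X n) \<xi> t \<omega>)) \<longlonglongrightarrow> f (recip_OU \<alpha> \<beta> (1 / z) \<xi> t \<omega>)"
          using z by (intro isCont_tendsto_compose[OF fc] recip_OU_pos) auto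
      qed
    qed (use z X t meas B recip_OU_pos in auto)
    then show "((\<lambda>z. \<integral>y. f y \<partial>recip_kernel t z) \<circ> X) \<longlonglongrightarrow> (\<integral>y. f y \<partial>recip_kernel t z)"
      using z X recip_kernel_integral[OF t _ fm] by (simp add: comp_def)
  qed
  show "((\<lambda>t. \<integral>y. f y \<partial>recip_kernel t z) \<longlongrightarrow> f z) (at_right 0)" if z: "0 < z"
    unfolding tendsto_at_iff_sequentially
  proof (intro allI impI)
    fix X :: "nat \<Rightarrow> real" assume X: "\<forall>i. X i \<in> {0<..} - {0}" "X \<longlonglongrightarrow> 0"
    have X0: "0 < X n" for n using X(1) by auto
    have "(\<lambda>n. \<integral>\<omega>. f (recip_OU \<alpha> \<beta> (1 / z) \<xi> (X n) \<omega>) \<partial>M) \<longlonglongrightarrow> (\<integral>\<omega>. f z \<partial>M)"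
    proof (rule integral_dominated_convergence[where w="\<lambda>_. B"])
      show "AE \<omega> in M. (\<lambda>n. f (recip_OU \<alpha> \<beta> (1 / z) \<xi> (X n) \<omega>)) \<longlonglongrightarrow> f z"
        using recip_OU_start[OF \<alpha> \<xi>, of \<beta> "1 / z"] AE_space
      proof eventually_elim
        case (elim \<omega>)
        have "filterlim X (at_right 0) sequentially" unfolding filterlim_at using X(2) X0 by (auto simp: less_imp_neq[THEN not_sym])
        then have "(\<lambda>n. recip_OU \<alpha> \<beta> (1 / z) \<xi> (X n) \<omega>) \<longlonglongrightarrow> z"
          using filterlim_compose[OF recip_OU_continuous_right[OF elim(2) order_refl z]] elim(1) by simp
        then show ?case by (rule isCont_tendsto_compose[OF fc[OF z]])
      qed
      show "(\<lambda>\<omega>. f (recip_OU \<alpha> \<beta> (1 / z) \<xi> (X n) \<omega>)) \<in> borel_measurable M" for n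
        using meas[OF z] X0[of n] by simp
    qed (use B recip_OU_pos[OF z] in auto)
    then show "((\<lambda>t. \<integral>y. f y \<partial>recip_kernel t z) \<circ> X) \<longlonglongrightarrow> f z"
      using recip_kernel_integral[OF _ z fm] X0 prob_space by (simp add: comp_def less_imp_le)
  qed
qed

text \<open>The natural filtration of Z is coarser than the past of \<open>\<xi>\<close>: each of
  its events is an event of the path stopped at \<open>s\<close>. Independence of the future is
  applied to these, while the candidate \<open>g (Z s)\<close> is measurable with respect to Z
  alone.\<close>

lemma recip_OU_markov:
  fixes f :: "real \<Rightarrow> real"
  assumes s: "0 \<le> s" and t: "0 \<le> t" and z: "0 < z" and f[measurable]: "f \<in> borel_measurable borel" and bd: "bounded (range f)"
  defines "Z \<equiv> recip_OU \<alpha> \<beta> (1 / z) \<xi>"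
  shows "AE \<omega> in M. real_cond_exp M (natural_filtration M Z s) (\<lambda>\<omega>'. f (Z (s + t) \<omega>')) \<omega> = (\<integral>y. f y \<partial>recip_kernel t (Z s \<omega>))"
proof -
  interpret prob_space M by (rule levy_prob_space[OF \<xi>])
  let ?F = "natural_filtration M Z s"
  let ?X = "\<lambda>s \<omega>. sample (\<lambda>r. \<xi> (min r s) \<omega>)"
  obtain B where B: "\<And>y. \<bar>f y\<bar> \<le> B" using bd unfolding bounded_iff by auto
  have Zm: "Z r \<in> borel_measurable M" if "0 \<le> r" for r unfolding Z_def by (rule recip_OU_measurable[OF that])
  have gen_sub: "(\<Union>r\<in>{0..s}. {Z r -` A \<inter> space M |A. A \<in> sets borel}) \<subseteq> sets M"
    using measurable_sets[OF Zm] by fastforce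
  have space_F: "space ?F = space M" unfolding natural_filtration_def by (rule space_measure_of) (use gen_sub sets.space_closed in blast)
  have sets_F: "sets ?F = sigma_sets (space M) (\<Union>r\<in>{0..s}. {Z r -` A \<inter> space M |A. A \<in> sets borel})"
    unfolding natural_filtration_def by (rule sets_measure_of) (use gen_sub sets.space_closed in blast)
  have sub: "subalgebra M ?F"
    unfolding subalgebra_def sets_F space_F using sets.sigma_sets_subset[OF gen_sub] by simp
  interpret finite_measure_subalgebra M ?F by unfold_locales (rule sub)
  have Z_path: "Z r \<omega> = recip_path \<alpha> \<beta> r z (?X s \<omega>)" if "\<omega> \<in> space M" "0 \<le> r" "r \<le> s" for r \<omega>
    unfolding Z_def by (rule recip_OU_path[OF that])
  have F_path: "\<exists>C\<in>sets path_space. A = ?X s -` C \<inter> space M" if "A \<in> sets ?F" for A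
  proof -
    let ?V = "vimage_algebra (space M) (?X s) path_space"
    have V: "sets ?V = {?X s -` C \<inter> space M |C. C \<in> sets path_space}"
      by (rule sets_vimage_algebra2) (simp add: space_PiM)
    have "(\<Union>r\<in>{0..s}. {Z r -` A \<inter> space M |A. A \<in> sets borel}) \<subseteq> sets ?V"
    proof clarify
      fix r A assume r: "r \<in> {0..s}" and A: "A \<in> sets (borel :: real measure)"
      have "recip_path \<alpha> \<beta> r z -` A \<inter> space path_space \<in> sets path_space"
        by (rule measurable_sets[OF _ A]) measurable
      moreover have "Z r -` A \<inter> space M = ?X s -` (recip_path \<alpha> \<beta> r z -` A \<inter> space path_space) \<inter> space M"
        using Z_path r by (auto simp: space_PiM)
      ultimately show "Z r -` A \<inter> space M \<in> sets ?V" unfolding V by blast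
    qed
    from sets.sigma_sets_subset[OF this] that show ?thesis unfolding sets_F by (auto simp: V)
  qed
  note [measurable] = levy_sample_measurable(1)[OF \<xi> s] levy_sample_measurable(1)[OF \<xi> t]
  \<comment> \<open>Written with \<open>recip_path\<close>, the kernel integral makes sense for
    every real \<open>w\<close>, which yields a Borel function on the whole line; \<open>Z s\<close>
    visits positive values only.\<close>
  define g where "g w = (\<integral>\<omega>'. f (recip_path \<alpha> \<beta> t w (?X t \<omega>')) \<partial>M)" for w
  have g[measurable]: "g \<in> borel_measurable borel" unfolding g_def by measurable
  have gB: "\<bar>g w\<bar> \<le> B" for w
  proof -
    have "norm (g w) \<le> (\<integral>\<omega>'. norm (f (recip_path \<alpha> \<beta> t w (?X t \<omega>'))) \<partial>M)" unfolding g_def by (rule integral_norm_bound)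
    also have "\<dots> \<le> (\<integral>\<omega>'. B \<partial>M)"
      by (rule integral_mono) (use B in \<open>auto intro!: integrable_const_bound[where B=B]\<close>)
    finally show ?thesis by (simp add: prob_space)
  qed
  have gk: "(\<integral>y. f y \<partial>recip_kernel t (Z s \<omega>)) = g (Z s \<omega>)" for \<omega>
  proof -
    have "0 < Z s \<omega>" unfolding Z_def by (rule recip_OU_pos[OF z])
    then have "(\<integral>y. f y \<partial>recip_kernel t (Z s \<omega>)) = (\<integral>\<omega>'. f (recip_OU \<alpha> \<beta> (1 / Z s \<omega>) \<xi> t \<omega>') \<partial>M)"
      by (intro recip_kernel_integral[OF t] measurable_restrict_space1) auto
    also have "\<dots> = g (Z s \<omega>)" unfolding g_def
      by (rule Bochner_Integration.integral_cong) (auto simp: recip_OU_path[OF _ t order_refl])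
    finally show ?thesis .
  qed
  have Zst: "Z (s + t) \<in> borel_measurable M" "Z s \<in> borel_measurable M" using Zm s t by auto
  note [measurable] = Zst
  have ZF: "Z s \<in> borel_measurable ?F"
  proof (rule measurableI)
    fix A assume "A \<in> sets (borel :: real measure)"
    then have "Z s -` A \<inter> space M \<in> (\<Union>r\<in>{0..s}. {Z r -` A \<inter> space M |A. A \<in> sets borel})"
      using s by (intro UN_I[of s]) auto
    then show "Z s -` A \<inter> space ?F \<in> sets ?F" unfolding sets_F space_F by (rule sigma_sets.Basic)
  qed simp
  have "AE \<omega> in M. real_cond_exp M ?F (\<lambda>\<omega>'. f (Z (s + t) \<omega>')) \<omega> = g (Z s \<omega>)"
  proof (rule real_cond_exp_charact)
    show "integrable M (\<lambda>\<omega>. f (Z (s + t) \<omega>))" by (rule integrable_const_bound[where B=B]) (use B in auto)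
    show "integrable M (\<lambda>\<omega>. g (Z s \<omega>))" by (rule integrable_const_bound[where B=B]) (use gB in auto)
    show "(\<lambda>\<omega>. g (Z s \<omega>)) \<in> borel_measurable ?F" by (rule measurable_compose[OF ZF g])
    fix A assume "A \<in> sets ?F"
    then obtain C where C[measurable]: "C \<in> sets path_space" and A: "A = ?X s -` C \<inter> space M" using F_path by blast
    define h where "h p = indicator C (fst p) * f (recip_path \<alpha> \<beta> t (recip_path \<alpha> \<beta> s z (fst p)) (snd p))" for p
    have h: "h \<in> borel_measurable (path_space \<Otimes>\<^sub>M path_space)" unfolding h_def by measurable
    have hB: "\<bar>h p\<bar> \<le> max B 0" for p using B by (auto simp: h_def indicator_def intro: le_max_iff_disj[THEN iffD2])
    have "(\<integral>\<omega>\<in>A. f (Z (s + t) \<omega>) \<partial>M) = (\<integral>\<omega>. h (?X s \<omega>, sample (\<lambda>r. \<xi> (s + min r t) \<omega> - \<xi> s \<omega>)) \<partial>M)"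
      unfolding set_lebesgue_integral_def
      by (rule Bochner_Integration.integral_cong)
        (auto simp: h_def A indicator_def Z_def recip_OU_flow[OF _ s t z] recip_OU_path[OF _ s order_refl])
    also have "\<dots> = (\<integral>\<omega>. \<integral>\<omega>'. h (?X s \<omega>, ?X t \<omega>') \<partial>M \<partial>M)"
      by (rule levy_path_split_integral[OF \<xi> s t h hB])
    also have "\<dots> = (\<integral>\<omega>\<in>A. g (Z s \<omega>) \<partial>M)"
      unfolding set_lebesgue_integral_def
      by (rule Bochner_Integration.integral_cong)
        (auto simp: h_def A indicator_def g_def Z_path[OF _ s order_refl])
    finally show "(\<integral>\<omega>\<in>A. f (Z (s + t) \<omega>) \<partial>M) = (\<integral>\<omega>\<in>A. g (Z s \<omega>) \<partial>M)" .
  qed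
  then show ?thesis unfolding gk .
qed

lemma recip_OU_feller:
  assumes z: "0 < z"
  shows "feller_process M {0<..} recip_kernel (recip_OU \<alpha> \<beta> (1 / z) \<xi>)"
proof -
  have "AE \<omega> in M. cadlag_in {0<..} (\<lambda>t. recip_OU \<alpha> \<beta> (1 / z) \<xi> t \<omega>)"
    by (rule AE_I2) (rule recip_OU_cadlag[OF _ z])
  then show ?thesis
  unfolding feller_process_def feller_semigroup_def
  using recip_kernel_measurable recip_kernel_zero recip_kernel_chapman_kolmogorov recip_kernel_continuous
    recip_OU_measurable recip_OU_markov[OF _ _ z]
  by (intro conjI allI impI ballI) (simp_all only: greaterThan_iff)
qed

end

section \<open>Measurable projection\<close>

text \<open>\<open>souslin_op\<close> is the Souslin operation on rectangles with closed real side.  A product-measurable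
  set is of this form; compactness of \<open>{f. \<forall>i. f i \<le> b i}\<close> and of \<open>[l, u]\<close> lets its
  projection be approximated from inside by measurable sets.\<close>

definition souslin_scheme :: "'a measure \<Rightarrow> (nat \<Rightarrow> (nat \<Rightarrow> nat) \<Rightarrow> real set) \<Rightarrow> (nat \<Rightarrow> (nat \<Rightarrow> nat) \<Rightarrow> 'a set) \<Rightarrow> bool" where
  "souslin_scheme M K F \<longleftrightarrow> (\<forall>n f. closed (K n f)) \<and> (\<forall>n f. F n f \<in> sets M) \<and>
     (\<forall>n f g. (\<forall>i<n. f i = g i) \<longrightarrow> K n f = K n g \<and> F n f = F n g)"

definition souslin_op :: "'a measure \<Rightarrow> (nat \<Rightarrow> (nat \<Rightarrow> nat) \<Rightarrow> real set) \<Rightarrow> (nat \<Rightarrow> (nat \<Rightarrow> nat) \<Rightarrow> 'a set) \<Rightarrow> (real \<times> 'a) set" where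
  "souslin_op M K F = {(t, \<omega>). \<omega> \<in> space M \<and> (\<exists>f. \<forall>n. t \<in> K n f \<and> \<omega> \<in> F n f)}"

definition souslin_set :: "'a measure \<Rightarrow> (real \<times> 'a) set \<Rightarrow> bool" where
  "souslin_set M A \<longleftrightarrow> (\<exists>K F. souslin_scheme M K F \<and> A = souslin_op M K F)"

lemma souslin_op_iff:
  "p \<in> souslin_op M K F \<longleftrightarrow> snd p \<in> space M \<and> (\<exists>f. \<forall>n. fst p \<in> K n f \<and> snd p \<in> F n f)"
  by (simp add: souslin_op_def case_prod_beta)

lemma souslin_schemeD:
  assumes "souslin_scheme M K F"
  shows "closed (K n f)" "F n f \<in> sets M" "\<forall>i<n. f i = g i \<Longrightarrow> K n f = K n g" "\<forall>i<n. f i = g i \<Longrightarrow> F n f = F n g"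
  using assms unfolding souslin_scheme_def by blast+

lemma souslin_set_rectangle:
  assumes "closed K" "F \<in> sets M" shows "souslin_set M (K \<times> F)"
  unfolding souslin_set_def
proof (intro exI conjI)
  show "souslin_scheme M (\<lambda>_ _. K) (\<lambda>_ _. F)" unfolding souslin_scheme_def using assms by simp
  show "K \<times> F = souslin_op M (\<lambda>_ _. K) (\<lambda>_ _. F)"
    unfolding souslin_op_def using sets.sets_into_space[OF assms(2)] by auto
qed

text \<open>The first entry of a branch names a member of the union, the rest is a branch of its
  scheme. Level 0 is trivial, so that level \<open>Suc m\<close> may depend on \<open>f 0\<close>
  and the next \<open>m\<close> entries, \<open>Suc m\<close> in all.\<close>

lemma souslin_set_UN:
  assumes "\<And>k::nat. souslin_set M (A k)" shows "souslin_set M (\<Union>k. A k)"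
proof -
  obtain K F where KF: "\<And>k. souslin_scheme M (K k) (F k)" and A: "\<And>k. A k = souslin_op M (K k) (F k)"
    using assms unfolding souslin_set_def by metis
  define K' where "K' n f = (case n of 0 \<Rightarrow> UNIV | Suc m \<Rightarrow> K (f 0) m (\<lambda>i. f (Suc i)))" for n and f :: "nat \<Rightarrow> nat"
  define F' where "F' n f = (case n of 0 \<Rightarrow> space M | Suc m \<Rightarrow> F (f 0) m (\<lambda>i. f (Suc i)))" for n and f :: "nat \<Rightarrow> nat"
  have "souslin_scheme M K' F'"
    unfolding souslin_scheme_def
  proof (intro conjI allI impI)
    fix n :: nat and f g :: "nat \<Rightarrow> nat" assume fg: "\<forall>i<n. f i = g i"
    have "K' n f = K' n g \<and> F' n f = F' n g"
    proof (cases n)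
      case (Suc m)
      have "f 0 = g 0" using fg Suc by simp
      moreover have "\<forall>i<m. f (Suc i) = g (Suc i)" using fg Suc by simp
      ultimately show ?thesis using souslin_schemeD(3,4)[OF KF[of "g 0"], of m "\<lambda>i. f (Suc i)" "\<lambda>i. g (Suc i)"] Suc
        by (simp add: K'_def F'_def)
    qed (simp add: K'_def F'_def)
    then show "K' n f = K' n g" "F' n f = F' n g" by auto
  qed (use souslin_schemeD(1,2)[OF KF] in \<open>auto simp: K'_def F'_def split: nat.split\<close>)
  moreover have "(\<Union>k. A k) = souslin_op M K' F'"
  proof (intro set_eqI iffI)
    fix p assume "p \<in> (\<Union>k. A k)"
    then obtain k where "p \<in> A k" by blast
    then obtain f where f: "snd p \<in> space M" "\<And>n. fst p \<in> K k n f \<and> snd p \<in> F k n f"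
      unfolding A souslin_op_iff by blast
    have "fst p \<in> K' n (case_nat k f) \<and> snd p \<in> F' n (case_nat k f)" for n
      using f by (cases n) (auto simp: K'_def F'_def)
    then show "p \<in> souslin_op M K' F'" unfolding souslin_op_iff using f(1) by blast
  next
    fix p assume "p \<in> souslin_op M K' F'"
    then obtain f where *: "snd p \<in> space M" "\<And>n. fst p \<in> K' n f \<and> snd p \<in> F' n f"
      unfolding souslin_op_iff by blast
    have "fst p \<in> K (f 0) n (\<lambda>i. f (Suc i)) \<and> snd p \<in> F (f 0) n (\<lambda>i. f (Suc i))" for n
      using *(2)[of "Suc n"] by (simp add: K'_def F'_def)
    then have "p \<in> A (f 0)" unfolding A souslin_op_iff using *(1) by blast
    then show "p \<in> (\<Union>k. A k)" by blast
  qed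
  ultimately show ?thesis unfolding souslin_set_def by blast
qed

text \<open>This makes the interleaving below legitimate: at level \<open>prod_encode (k, n)\<close>
  the entries \<open>prod_encode (k, i)\<close> with \<open>i < n\<close> have already been
  read.\<close>

lemma prod_encode_strict: "i < n \<Longrightarrow> prod_encode (k, i) < prod_encode (k, n)"
proof -
  have "triangle a \<le> triangle b" if "a \<le> b" for a b using that by (induction rule: dec_induct) auto
  moreover have "triangle a < triangle (Suc a)" for a by simp
  ultimately have "triangle a < triangle b" if "a < b" for a b
    using that by (meson Suc_leI less_le_trans)
  then show "i < n \<Longrightarrow> prod_encode (k, i) < prod_encode (k, n)" by (simp add: prod_encode_def)
qed

text \<open>Through the pairing function one branch codes a branch for each factor, and each level
  tests one condition of one factor.\<close>

lemma souslin_set_INT: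
  assumes "\<And>k::nat. souslin_set M (A k)" shows "souslin_set M (\<Inter>k. A k)"
proof -
  obtain K F where KF: "\<And>k. souslin_scheme M (K k) (F k)" and A: "\<And>k. A k = souslin_op M (K k) (F k)"
    using assms unfolding souslin_set_def by metis
  define dk where "dk j = fst (prod_decode j)" for j
  define dn where "dn j = snd (prod_decode j)" for j
  have j: "prod_encode (dk j, dn j) = j" for j by (simp add: dk_def dn_def)
  define K' where "K' j f = K (dk j) (dn j) (\<lambda>i. f (prod_encode (dk j, i)))" for j and f :: "nat \<Rightarrow> nat"
  define F' where "F' j f = F (dk j) (dn j) (\<lambda>i. f (prod_encode (dk j, i)))" for j and f :: "nat \<Rightarrow> nat"
  have pe: "K' (prod_encode (k, n)) f = K k n (\<lambda>i. f (prod_encode (k, i)))"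
    "F' (prod_encode (k, n)) f = F k n (\<lambda>i. f (prod_encode (k, i)))" for k n f
    by (simp_all add: K'_def F'_def dk_def dn_def)
  have "souslin_scheme M K' F'"
    unfolding souslin_scheme_def
  proof (intro conjI allI impI)
    fix j :: nat and f g :: "nat \<Rightarrow> nat" assume fg: "\<forall>i<j. f i = g i"
    have "\<forall>i<dn j. f (prod_encode (dk j, i)) = g (prod_encode (dk j, i))"
      using fg prod_encode_strict[of _ "dn j" "dk j"] j[of j] by simp
    from souslin_schemeD(3,4)[OF KF this] show "K' j f = K' j g" "F' j f = F' j g" unfolding K'_def F'_def by auto
  qed (use souslin_schemeD(1,2)[OF KF] in \<open>auto simp: K'_def F'_def\<close>)
  moreover have "(\<Inter>k. A k) = souslin_op M K' F'"
  proof (intro set_eqI iffI)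
    fix p assume p: "p \<in> (\<Inter>k. A k)"
    have "\<exists>f. \<forall>n. fst p \<in> K k n f \<and> snd p \<in> F k n f" for k
    proof -
      have "p \<in> A k" using p by simp
      then show ?thesis unfolding A souslin_op_iff by blast
    qed
    then obtain f where f: "\<And>k n. fst p \<in> K k n (f k) \<and> snd p \<in> F k n (f k)" by metis
    have "p \<in> A 0" using p by simp
    then have 1: "snd p \<in> space M" unfolding A souslin_op_iff by blast
    define f' where "f' j = f (dk j) (dn j)" for j
    have "fst p \<in> K' j f' \<and> snd p \<in> F' j f'" for j
      using f[where k="dk j" and n="dn j"] unfolding K'_def F'_def f'_def by (simp add: dk_def dn_def)
    then show "p \<in> souslin_op M K' F'" unfolding souslin_op_iff using 1 by blast
  next
    fix p assume "p \<in> souslin_op M K' F'"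
    then obtain f where *: "snd p \<in> space M" "\<And>n. fst p \<in> K' n f \<and> snd p \<in> F' n f"
      unfolding souslin_op_iff by blast
    have "fst p \<in> K k n (\<lambda>i. f (prod_encode (k, i))) \<and> snd p \<in> F k n (\<lambda>i. f (prod_encode (k, i)))" for k n
      using *(2)[of "prod_encode (k, n)"] by (simp add: pe)
    then have "p \<in> A k" for k unfolding A souslin_op_iff using *(1) by blast
    then show "p \<in> (\<Inter>k. A k)" by blast
  qed
  ultimately show ?thesis unfolding souslin_set_def by blast
qed

lemma souslin_set_Un:
  assumes "souslin_set M A" "souslin_set M B" shows "souslin_set M (A \<union> B)"
proof -
  have "A \<union> B = (\<Union>k. if k = (0::nat) then A else B)" by (auto split: if_splits)
  moreover have "souslin_set M (\<Union>k. if k = (0::nat) then A else B)" by (rule souslin_set_UN) (use assms in simp)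
  ultimately show ?thesis by simp
qed

text \<open>Souslin sets are not closed under complement, so the induction carries a set together
  with its complement. In the union step one half uses countable unions and the other countable
  intersections.\<close>

lemma souslin_set_borel_rectangle:
  fixes S :: "real set"
  assumes S: "S \<in> sets borel" and F: "F \<in> sets M"
  shows "souslin_set M (S \<times> F) \<and> souslin_set M ((- S) \<times> F)"
proof -
  have "S \<in> sigma_sets UNIV (range (\<lambda>a. {..a}))" using S unfolding borel_eq_atMost by simp
  then show ?thesis
  proof induction
    case (Basic S)
    then obtain a where a: "S = {..a}" by auto
    \<comment> \<open>Schemes have closed real sides, so the open half-line is exhausted by closed
      ones.\<close>
    have "(- S) \<times> F = (\<Union>n::nat. {a + 1 / (real n + 1)..} \<times> F)"
    proof (intro set_eqI iffI)
      fix p assume "p \<in> (- S) \<times> F"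
      then have p: "a < fst p" "snd p \<in> F" using a by auto
      then obtain n where "inverse (real (Suc n)) < fst p - a" using reals_Archimedean[of "fst p - a"] by auto
      then have "fst p \<in> {a + 1 / (real n + 1)..}" by (simp add: inverse_eq_divide add.commute)
      then show "p \<in> (\<Union>n::nat. {a + 1 / (real n + 1)..} \<times> F)" using p by (auto simp: mem_Times_iff)
    next
      fix p assume "p \<in> (\<Union>n::nat. {a + 1 / (real n + 1)..} \<times> F)"
      then obtain n :: nat where "a + 1 / (real n + 1) \<le> fst p" "snd p \<in> F" by auto
      moreover have "0 < 1 / (real n + 1)" by simp
      ultimately have "a < fst p" "snd p \<in> F" by linarith+
      then show "p \<in> (- S) \<times> F" using a by (auto simp: mem_Times_iff)
    qed
    moreover have "souslin_set M (\<Union>n::nat. {a + 1 / (real n + 1)..} \<times> F)"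
      by (intro souslin_set_UN souslin_set_rectangle F) simp
    ultimately show ?case using souslin_set_rectangle[OF _ F, of "{..a}"] a by simp
  next
    case Empty
    then show ?case using souslin_set_rectangle[OF _ F, of "{}"] souslin_set_rectangle[OF _ F, of UNIV] by simp
  next
    case (Compl S)
    then show ?case by (simp add: Compl_eq_Diff_UNIV[symmetric])
  next
    case (Union S)
    have "(\<Union>i. S i) \<times> F = (\<Union>i. S i \<times> F)" by auto
    moreover have "(- (\<Union>i. S i)) \<times> F = (\<Inter>i. (- S i) \<times> F)" by auto
    ultimately show ?case using Union souslin_set_UN[of M "\<lambda>i. S i \<times> F"] souslin_set_INT[of M "\<lambda>i. (- S i) \<times> F"] by simp
  qed
qed

text \<open>Again a set and its complement in the strip run through the induction together.\<close>

lemma souslin_set_measurable: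
  assumes "A \<in> sets (borel \<Otimes>\<^sub>M M)" shows "souslin_set M A"
proof -
  have U: "souslin_set M (UNIV \<times> F)" if "F \<in> sets M" for F by (rule souslin_set_rectangle) (use that in auto)
  have "A \<in> sigma_sets (UNIV \<times> space M) {a \<times> b |a b. a \<in> sets (borel :: real measure) \<and> b \<in> sets M}"
    using assms unfolding sets_pair_measure by simp
  then have "souslin_set M A \<and> souslin_set M (UNIV \<times> space M - A)"
  proof induction
    case (Basic A)
    then obtain S F where A: "A = S \<times> F" and SF: "S \<in> sets (borel :: real measure)" "F \<in> sets M" by auto
    have "UNIV \<times> space M - A = ((- S) \<times> F) \<union> (UNIV \<times> (space M - F))"
      unfolding A using sets.sets_into_space[OF SF(2)] by auto
    moreover have "souslin_set M (((- S) \<times> F) \<union> (UNIV \<times> (space M - F)))"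
      using souslin_set_borel_rectangle[OF SF] U[of "space M - F"] SF by (intro souslin_set_Un) auto
    ultimately show ?case using souslin_set_borel_rectangle[OF SF] A by simp
  next
    case Empty
    then show ?case using U[of "{}"] U[of "space M"] by simp
  next
    case (Compl A)
    have "A \<subseteq> UNIV \<times> space M"
      using Compl.hyps sigma_sets_into_sp[of "{a \<times> b |a b. a \<in> sets (borel :: real measure) \<and> b \<in> sets M}" "UNIV \<times> space M" A]
        sets.sets_into_space by blast
    then have "UNIV \<times> space M - (UNIV \<times> space M - A) = A" by blast
    then show ?case using Compl.IH by simp
  next
    case (Union A)
    have "UNIV \<times> space M - (\<Union>i. A i) = (\<Inter>i. UNIV \<times> space M - A i)" by auto
    then show ?case using Union souslin_set_UN[of M A] souslin_set_INT[of M "\<lambda>i. UNIV \<times> space M - A i"] by simp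
  qed
  then show ?thesis by blast
qed

section \<open>Inner approximation of projections by compactness\<close>

lemma compact_bounded_seq: "compact {f :: nat \<Rightarrow> nat. \<forall>i. f i \<le> b i}"
proof -
  have "compactin (product_topology (\<lambda>_. euclidean) UNIV) (PiE UNIV (\<lambda>i. {..b i}))"
    by (simp add: compactin_PiE finite_imp_compact)
  then have "compact (PiE UNIV (\<lambda>i. {..b i}))" unfolding euclidean_product_topology by simp
  moreover have "PiE UNIV (\<lambda>i. {..b i}) = {f. \<forall>i. f i \<le> b i}" by (auto simp: PiE_iff)
  ultimately show ?thesis by simp
qed

lemma open_initial_segment:
  fixes n :: nat shows "open {g :: nat \<Rightarrow> nat. \<forall>i<n. g i = f i}"
proof -
  have "{g :: nat \<Rightarrow> nat. \<forall>i<n. g i = f i} = (\<Inter>i\<in>{..<n}. (\<lambda>g. g i) -` {f i})" by auto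
  moreover have "open ((\<lambda>g :: nat \<Rightarrow> nat. g i) -` {f i})" for i
    by (rule open_vimage[OF discrete_topology_class.open_discrete]) (rule continuous_on_product_coordinates)
  ultimately show ?thesis by (metis (no_types, lifting) finite_lessThan open_INT)
qed

text \<open>A capacitability argument. Outer measure is continuous along increasing sequences, so
  the entries of the branches can be bounded one after another while the outer measure stays above
  \<open>c\<close>. Branches below the resulting bound \<open>b\<close> form a compact set, and the
  conditions of finite level cut out measurable sets that decrease to a subset of the
  projection.\<close>

lemma (in finite_measure) souslin_projection_inner:
  assumes KF: "souslin_scheme M K F"
    and c: "c < outer_measure_of M {\<omega>\<in>space M. \<exists>t\<in>{l..u::real}. (t, \<omega>) \<in> souslin_op M K F}"
  shows "\<exists>L\<in>sets M. L \<subseteq> {\<omega>\<in>space M. \<exists>t\<in>{l..u}. (t, \<omega>) \<in> souslin_op M K F} \<and> c \<le> emeasure M L"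
proof -
  define D where "D k b = {\<omega>\<in>space M. \<exists>t\<in>{l..u}. \<exists>f. (\<forall>i<k. f i \<le> b i) \<and> (\<forall>n. t \<in> K n f \<and> \<omega> \<in> F n f)}"
    for k and b :: "nat \<Rightarrow> nat"
  have D0: "D 0 b = {\<omega>\<in>space M. \<exists>t\<in>{l..u}. (t, \<omega>) \<in> souslin_op M K F}" for b
    by (auto simp: D_def souslin_op_def)
  have D_step: "\<exists>j. c < outer_measure_of M (D (Suc k) (b(k := j)))" if "c < outer_measure_of M (D k b)" for k b
  proof -
    let ?A = "\<lambda>j. D (Suc k) (b(k := j))"
    have "incseq ?A"
    proof (intro incseq_SucI subsetI)
      fix j \<omega> assume "\<omega> \<in> ?A j"
      then obtain t f where *: "\<omega> \<in> space M" "t \<in> {l..u}" "\<forall>i<Suc k. f i \<le> (b(k := j)) i" "\<forall>n. t \<in> K n f \<and> \<omega> \<in> F n f"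
        unfolding D_def by auto
      have "\<forall>i<Suc k. f i \<le> (b(k := Suc j)) i" using *(3) by (auto split: if_splits dest: spec intro: le_SucI)
      then show "\<omega> \<in> ?A (Suc j)" unfolding D_def using * by blast
    qed
    moreover have "?A j \<subseteq> space M" for j by (auto simp: D_def)
    moreover have "(\<Union>j. ?A j) = D k b"
    proof (intro set_eqI iffI)
      fix \<omega> assume "\<omega> \<in> D k b"
      then obtain t f where *: "\<omega> \<in> space M" "t \<in> {l..u}" "\<forall>i<k. f i \<le> b i" "\<forall>n. t \<in> K n f \<and> \<omega> \<in> F n f"
        unfolding D_def by auto
      then have "\<forall>i<Suc k. f i \<le> (b(k := f k)) i" by (simp add: less_Suc_eq)
      then have "\<omega> \<in> ?A (f k)" unfolding D_def using * by blast
      then show "\<omega> \<in> (\<Union>j. ?A j)" by blast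
    next
      fix \<omega> assume "\<omega> \<in> (\<Union>j. ?A j)"
      then obtain j t f where *: "\<omega> \<in> space M" "t \<in> {l..u}" "\<forall>i<Suc k. f i \<le> (b(k := j)) i" "\<forall>n. t \<in> K n f \<and> \<omega> \<in> F n f"
        unfolding D_def by auto
      have "\<forall>i<k. f i \<le> b i" using *(3) by (metis fun_upd_other less_SucI nat_neq_iff)
      then show "\<omega> \<in> D k b" unfolding D_def using * by blast
    qed
    ultimately have "(SUP j. outer_measure_of M (?A j)) = outer_measure_of M (D k b)"
      using SUP_outer_measure_of_incseq[of ?A M] by simp
    then show ?thesis using that by (metis (no_types, lifting) less_SUP_iff)
  qed
  \<comment> \<open>Step \<open>k\<close> alters only entry \<open>k\<close>, so the successive
    bounds stabilise entrywise to the diagonal \<open>b\<close>.\<close>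
  have "\<exists>B. \<forall>k. c < outer_measure_of M (D k (B k)) \<and> (\<exists>j. B (Suc k) = (B k)(k := j))"
  proof (rule dependent_nat_choice)
    show "\<exists>b. c < outer_measure_of M (D 0 b)" using c D0 by simp
    fix b k assume "c < outer_measure_of M (D k b)"
    from D_step[OF this] show "\<exists>b'. c < outer_measure_of M (D (Suc k) b') \<and> (\<exists>j. b' = b(k := j))" by blast
  qed
  then obtain B where B: "\<And>k. c < outer_measure_of M (D k (B k))" "\<And>k. \<exists>j. B (Suc k) = (B k)(k := j)"
    by blast
  define b where "b i = B (Suc i) i" for i
  have Bb: "i < k \<Longrightarrow> B k i = b i" for i k
  proof (induction k)
    case (Suc k)
    obtain j where "B (Suc k) = (B k)(k := j)" using B(2) by blast
    then show ?case using Suc by (cases "i = k") (auto simp: b_def)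
  qed simp
  have Db: "c < outer_measure_of M (D k b)" for k
  proof -
    have "D k (B k) = D k b" unfolding D_def using Bb by (auto simp: cong: conj_cong)
    then show ?thesis using B(1)[of k] by simp
  qed
  \<comment> \<open>All entries are bounded, but only the conditions up to level \<open>N\<close>
    are imposed. These involve the first \<open>N\<close> entries, so finitely many branches suffice
    and \<open>L N\<close> is measurable, which the projection itself need not be.\<close>
  define L where "L N = {\<omega>\<in>space M. \<exists>t\<in>{l..u}. \<exists>f. (\<forall>i. f i \<le> b i) \<and> (\<forall>n\<le>N. t \<in> K n f \<and> \<omega> \<in> F n f)}" for N
  have L_sets: "L N \<in> sets M" for N
  proof -
    let ?S = "{f. \<forall>i. (i \<in> {..<N} \<longrightarrow> f i \<in> {..Max (b ` {..N})}) \<and> (i \<notin> {..<N} \<longrightarrow> f i = (0::nat))}"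
    let ?S' = "{f \<in> ?S. \<forall>i. f i \<le> b i}"
    have fin: "finite ?S'" using finite_set_of_finite_funs[of "{..<N}" "{..Max (b ` {..N})}" 0] by simp
    have "L N = (\<Union>f\<in>?S'. if {l..u} \<inter> (\<Inter>n\<in>{..N}. K n f) = {} then {} else (\<Inter>n\<in>{..N}. F n f))"
      (is "_ = ?R")
    proof (intro set_eqI iffI)
      fix \<omega> assume "\<omega> \<in> L N"
      then obtain t f where *: "t \<in> {l..u}" "\<forall>i. f i \<le> b i" "\<forall>n\<le>N. t \<in> K n f \<and> \<omega> \<in> F n f"
        unfolding L_def by auto
      \<comment> \<open>Padding with 0 respects every bound and leaves the levels up to
        \<open>N\<close> unchanged.\<close>
      define g where "g i = (if i < N then f i else 0)" for i
      have "K n g = K n f" "F n g = F n f" if "n \<le> N" for n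
        using souslin_schemeD(3,4)[OF KF, of n g f] that by (auto simp: g_def)
      then have 1: "\<forall>n\<le>N. t \<in> K n g \<and> \<omega> \<in> F n g" using *(3) by simp
      have "f i \<le> Max (b ` {..N})" if "i < N" for i
      proof -
        have "b i \<le> Max (b ` {..N})" using that by (intro Max_ge) auto
        then show ?thesis using *(2) order_trans by blast
      qed
      then have "g \<in> ?S'" using *(2) by (auto simp: g_def)
      moreover have "{l..u} \<inter> (\<Inter>n\<in>{..N}. K n g) \<noteq> {}" using 1 *(1) by auto
      ultimately show "\<omega> \<in> ?R" using 1 by (intro UN_I[of g]) auto
    next
      fix \<omega> assume "\<omega> \<in> ?R"
      then obtain f where f: "\<forall>i. f i \<le> b i" "{l..u} \<inter> (\<Inter>n\<in>{..N}. K n f) \<noteq> {}" "\<omega> \<in> (\<Inter>n\<in>{..N}. F n f)"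
        by (auto split: if_splits)
      then obtain t where "t \<in> {l..u}" "\<forall>n\<le>N. t \<in> K n f" by blast
      moreover have "\<omega> \<in> F 0 f" using f(3) by blast
      moreover have "\<omega> \<in> space M" using calculation sets.sets_into_space[OF souslin_schemeD(2)[OF KF, of 0 f]] by blast
      ultimately show "\<omega> \<in> L N" unfolding L_def using f by blast
    qed
    also have "\<dots> \<in> sets M"
      using souslin_schemeD(2)[OF KF] by (intro sets.finite_UN fin) (auto intro!: sets.finite_INT)
    finally show ?thesis .
  qed
  have L_dec: "decseq L" unfolding L_def by (intro decseq_SucI subsetI) (use le_SucI in blast)
  have cL: "c \<le> emeasure M (L N)" for N
  proof -
    have "D N b \<subseteq> L N"
    proof
      fix \<omega> assume "\<omega> \<in> D N b"
      then obtain t f where *: "\<omega> \<in> space M" "t \<in> {l..u}" "\<forall>i<N. f i \<le> b i" "\<forall>n. t \<in> K n f \<and> \<omega> \<in> F n f"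
        unfolding D_def by auto
      define g where "g i = (if i < N then f i else 0)" for i
      have "K n g = K n f" "F n g = F n f" if "n \<le> N" for n
        using souslin_schemeD(3,4)[OF KF, of n g f] that by (auto simp: g_def)
      then have "\<forall>n\<le>N. t \<in> K n g \<and> \<omega> \<in> F n g" using *(4) by simp
      moreover have "\<forall>i. g i \<le> b i" using *(3) by (auto simp: g_def)
      ultimately show "\<omega> \<in> L N" unfolding L_def using *(1,2) by blast
    qed
    then have "c < outer_measure_of M (L N)" using Db[of N] outer_measure_of_mono less_le_trans by blast
    then show ?thesis using L_sets by simp
  qed
  have "(\<Inter>N. L N) \<in> sets M" using L_sets by (intro sets.countable_INT) auto
  moreover have "c \<le> emeasure M (\<Inter>N. L N)"
  proof -
    have "(INF N. emeasure M (L N)) = emeasure M (\<Inter>N. L N)"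
      by (rule INF_emeasure_decseq) (use L_sets L_dec in \<open>auto simp: image_subset_iff\<close>)
    then show ?thesis using INF_greatest[of UNIV c "\<lambda>N. emeasure M (L N)"] cL by simp
  qed
  \<comment> \<open>Any finite set of levels is met by some bounded branch and some time.
    Compactness of bounded branches times \<open>[l, u]\<close> and closedness of each level
    condition give one pair meeting all levels.\<close>
  moreover have "(\<Inter>N. L N) \<subseteq> {\<omega>\<in>space M. \<exists>t\<in>{l..u}. (t, \<omega>) \<in> souslin_op M K F}"
  proof
    fix \<omega> assume \<omega>: "\<omega> \<in> (\<Inter>N. L N)"
    then have sp: "\<omega> \<in> space M" by (auto simp: L_def)
    let ?Q = "{f. \<forall>i. f i \<le> b i} \<times> {l..u}"
    let ?C = "\<lambda>n. {(f, t). t \<in> K n f \<and> \<omega> \<in> F n f}"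
    have "?Q \<inter> (\<Inter>n\<in>UNIV. ?C n) \<noteq> {}"
    proof (rule compact_imp_fip_image)
      show "compact ?Q" by (rule compact_Times[OF compact_bounded_seq compact_Icc])
      fix n :: nat
      show "closed (?C n)"
        unfolding closed_def
      proof (subst open_subopen, rule ballI)
        fix p assume "p \<in> - ?C n"
        then obtain f t where p: "p = (f, t)" "t \<notin> K n f \<or> \<omega> \<notin> F n f" by (cases p) auto
        let ?V = "{g. \<forall>i<n. g i = f i} \<times> (if \<omega> \<in> F n f then - K n f else UNIV)"
        have "open ?V" using souslin_schemeD(1)[OF KF, of n f] open_initial_segment[of n f]
          by (intro open_Times) (auto simp: closed_def)
        moreover have "p \<in> ?V" using p by auto
        moreover have "?V \<subseteq> - ?C n"
        proof
          fix r assume r: "r \<in> ?V"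
          then have "K n (fst r) = K n f" "F n (fst r) = F n f"
            using souslin_schemeD(3,4)[OF KF, of n "fst r" f] by auto
          then show "r \<in> - ?C n" using r by (auto split: if_splits)
        qed
        ultimately show "\<exists>T. open T \<and> p \<in> T \<and> T \<subseteq> - ?C n" by blast
      qed
    next
      fix I' :: "nat set" assume fin: "finite I'"
      then obtain N where N: "\<forall>n\<in>I'. n \<le> N" using finite_nat_set_iff_bounded_le by blast
      have "\<omega> \<in> L N" using \<omega> by blast
      then obtain t f where "t \<in> {l..u}" "\<forall>i. f i \<le> b i" "\<forall>n\<le>N. t \<in> K n f \<and> \<omega> \<in> F n f"
        unfolding L_def by auto
      then have "(f, t) \<in> ?Q \<inter> (\<Inter>n\<in>I'. ?C n)" using N by auto
      then show "?Q \<inter> (\<Inter>n\<in>I'. ?C n) \<noteq> {}" by blast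
    qed
    then obtain p where p: "p \<in> ?Q" "p \<in> (\<Inter>n\<in>UNIV. ?C n)" by blast
    have 1: "snd p \<in> {l..u}" using p(1) by (simp only: mem_Times_iff)
    have "snd p \<in> K n (fst p) \<and> \<omega> \<in> F n (fst p)" for n
    proof -
      have "p \<in> ?C n" using p(2) by (rule INT_D) simp
      then show ?thesis by (simp add: case_prod_beta)
    qed
    then have "(snd p, \<omega>) \<in> souslin_op M K F" unfolding souslin_op_iff using sp by auto
    then show "\<omega> \<in> {\<omega>\<in>space M. \<exists>t\<in>{l..u}. (t, \<omega>) \<in> souslin_op M K F}" using sp 1 by blast
  qed
  ultimately show ?thesis by blast
qed

text \<open>The projection lies between measurable subsets and a measurable hull of equal measure,
  so it differs from a measurable set by part of a null set. Times are confined to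
  \<open>[l, u]\<close> for the compactness behind the inner approximation.\<close>

theorem (in finite_measure) measurable_projection:
  assumes "A \<in> sets (borel \<Otimes>\<^sub>M M)"
  shows "{\<omega>\<in>space M. \<exists>t\<in>{l..u::real}. (t, \<omega>) \<in> A} \<in> sets (completion M)" (is "?P \<in> _")
proof -
  obtain K F where KF: "souslin_scheme M K F" and A: "A = souslin_op M K F"
    using souslin_set_measurable[OF assms] unfolding souslin_set_def by blast
  have "?P \<subseteq> space M" by auto
  then obtain E where E: "E \<in> sets M" "?P \<subseteq> E" "outer_measure_of M ?P = emeasure M E"
    using outer_measure_of_attain[of ?P M] by blast
  have "\<exists>L. L \<in> sets M \<and> L \<subseteq> ?P \<and> measure M E - 1 / (real k + 1) \<le> measure M L" for k :: nat
  proof (cases "0 < measure M E - 1 / (real k + 1)")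
    case True
    then have "ennreal (measure M E - 1 / (real k + 1)) < outer_measure_of M ?P"
      unfolding E(3) emeasure_eq_measure by (simp add: ennreal_less_iff)
    from souslin_projection_inner[OF KF this[unfolded A]]
    obtain L where "L \<in> sets M" "L \<subseteq> ?P" "ennreal (measure M E - 1 / (real k + 1)) \<le> emeasure M L"
      unfolding A by blast
    then show ?thesis by (intro exI[of _ L]) (simp add: emeasure_eq_measure ennreal_le_iff)
  next
    case False
    then show ?thesis by (intro exI[of _ "{}"]) auto
  qed
  then have "\<forall>k::nat. \<exists>L. L \<in> sets M \<and> L \<subseteq> ?P \<and> measure M E - 1 / (real k + 1) \<le> measure M L" by (rule allI)
  from choice[OF this] obtain L where L: "\<And>k::nat. L k \<in> sets M \<and> L k \<subseteq> ?P \<and> measure M E - 1 / (real k + 1) \<le> measure M (L k)" by blast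
  let ?L = "\<Union>k. L k"
  have Ls: "?L \<in> sets M" using L by (intro sets.countable_UN) auto
  have LP: "?L \<subseteq> ?P" using L by blast
  have "measure M E \<le> measure M ?L"
  proof (rule LIMSEQ_le_const2)
    have "(\<lambda>k. measure M E - inverse (real (Suc k))) \<longlonglongrightarrow> measure M E - 0"
      by (intro tendsto_diff tendsto_const LIMSEQ_inverse_real_of_nat)
    then show "(\<lambda>k. measure M E - 1 / (real k + 1)) \<longlonglongrightarrow> measure M E"
      by (simp add: inverse_eq_divide add.commute)
    have "measure M E - 1 / (real k + 1) \<le> measure M ?L" for k
    proof -
      have "measure M (L k) \<le> measure M ?L" using L Ls by (intro finite_measure_mono) auto
      then show ?thesis using L[of k] by linarith
    qed
    then show "\<exists>N. \<forall>n\<ge>N. measure M E - 1 / (real n + 1) \<le> measure M ?L" by blast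
  qed
  then have "measure M (E - ?L) = 0"
  proof -
    have "?L \<subseteq> E" using LP E(2) by (rule subset_trans)
    then have "measure M (E - ?L) = measure M E - measure M ?L" "measure M ?L \<le> measure M E"
      using finite_measure_Diff[OF E(1) Ls] finite_measure_mono[OF _ E(1)] by auto
    then show ?thesis using \<open>measure M E \<le> measure M ?L\<close> by simp
  qed
  then have "E - ?L \<in> null_sets M" using E(1) Ls by (intro null_setsI) (auto simp: emeasure_eq_measure)
  moreover have "?P = ?L \<union> (?P - ?L)" using LP by blast
  moreover have "?P - ?L \<subseteq> E - ?L" using E(2) by blast
  ultimately show ?thesis using Ls by (intro sets_completionI)
qed

section \<open>Laplace exponents and the Esscher transform\<close>

text \<open>Expand \<open>exp (w * x)\<close> and integrate term by term. The majorant
  \<open>exp (a * x + norm w * |x|)\<close> is at most the sum of two exponentials with rates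
  \<open>a - norm w\<close> and \<open>a + norm w\<close>; both are nonnegative since
  \<open>norm w < a\<close>, so both moments are available.\<close>

lemma exp_power_series_integral:
  fixes w :: complex
  assumes M: "prob_space M" "sets M = sets borel" and int: "\<And>u. 0 \<le> u \<Longrightarrow> integrable M (\<lambda>x. exp (u * x))"
    and w: "norm w < a"
  shows "(\<lambda>n. of_real ((\<integral>x. x ^ n * exp (a * x) \<partial>M) / fact n) * w ^ n) sums (\<integral>x. exp ((of_real a + w) * of_real x) \<partial>M)"
proof -
  interpret prob_space M by fact
  have [measurable_cong]: "sets M = sets borel" by fact
  have a: "0 < a" using w norm_ge_zero[of w] by linarith
  let ?b = "\<lambda>x. exp (a * x + norm w * \<bar>x\<bar>)"
  have b: "integrable M ?b"
  proof (rule Bochner_Integration.integrable_bound)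
    show "integrable M (\<lambda>x. exp ((a - norm w) * x) + exp ((a + norm w) * x))"
      by (intro Bochner_Integration.integrable_add int) (use w a in auto)
    show "AE x in M. norm (?b x) \<le> norm (exp ((a - norm w) * x) + exp ((a + norm w) * x))"
    proof (rule AE_I2)
      fix x :: real
      have "a * x + norm w * \<bar>x\<bar> = (if 0 \<le> x then (a + norm w) * x else (a - norm w) * x)"
        by (simp add: algebra_simps)
      then show "norm (?b x) \<le> norm (exp ((a - norm w) * x) + exp ((a + norm w) * x))"
        by (auto simp: abs_of_pos add_pos_pos)
    qed
  qed measurable
  define f where "f n x = (w * of_real x) ^ n /\<^sub>R fact n * of_real (exp (a * x))" for n and x :: real
  have f_meas[measurable]: "f n \<in> borel_measurable M" for n unfolding f_def by measurable
  have nf: "norm (f n x) = (norm w * \<bar>x\<bar>) ^ n /\<^sub>R fact n * exp (a * x)" for n x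
    by (simp add: f_def norm_mult norm_power)
  have nf_sums: "(\<lambda>n. norm (f n x)) sums ?b x" for x
    unfolding nf using sums_mult2[OF exp_converges[of "norm w * \<bar>x\<bar>"], of "exp (a * x)"]
    by (simp add: exp_add mult.commute)
  have f_sums: "(\<lambda>n. f n x) sums exp ((of_real a + w) * of_real x)" for x
    unfolding f_def using sums_mult2[OF exp_converges[of "w * of_real x"], of "of_real (exp (a * x))"]
    by (simp add: exp_of_real[symmetric] exp_add[symmetric] algebra_simps)
  have nf_le: "norm (f n x) \<le> ?b x" for n x
    using sum_le_suminf[OF sums_summable[OF nf_sums[of x]], of "{n}"] sums_unique[OF nf_sums[of x]] by simp
  have fi: "integrable M (f n)" for n
    by (rule Bochner_Integration.integrable_bound[OF b]) (use nf_le in auto)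
  have sm: "summable (\<lambda>n. \<integral>x. norm (f n x) \<partial>M)"
  proof (rule summableI_nonneg_bounded)
    fix n
    have "(\<Sum>i<n. \<integral>x. norm (f i x) \<partial>M) = (\<integral>x. (\<Sum>i<n. norm (f i x)) \<partial>M)"
      by (rule Bochner_Integration.integral_sum[symmetric]) (rule integrable_norm[OF fi])
    also have "\<dots> \<le> (\<integral>x. ?b x \<partial>M)"
    proof (rule integral_mono)
      show "integrable M (\<lambda>x. \<Sum>i<n. norm (f i x))" by (intro Bochner_Integration.integrable_sum integrable_norm fi)
      show "(\<Sum>i<n. norm (f i x)) \<le> ?b x" for x
        using sum_le_suminf[OF sums_summable[OF nf_sums[of x]], of "{..<n}"] sums_unique[OF nf_sums[of x]] by simp
    qed (rule b)
    finally show "(\<Sum>i<n. \<integral>x. norm (f i x) \<partial>M) \<le> (\<integral>x. ?b x \<partial>M)" .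
  qed simp
  have "(\<lambda>n. \<integral>x. f n x \<partial>M) sums (\<integral>x. (\<Sum>n. f n x) \<partial>M)"
    by (rule sums_integral[OF fi _ sm]) (use nf_sums in \<open>auto intro: sums_summable\<close>)
  moreover have "(\<integral>x. f n x \<partial>M) = of_real ((\<integral>x. x ^ n * exp (a * x) \<partial>M) / fact n) * w ^ n" for n
  proof -
    have "(\<integral>x. f n x \<partial>M) = (\<integral>x. of_real (x ^ n * exp (a * x)) * (w ^ n / fact n) \<partial>M)"
      by (rule Bochner_Integration.integral_cong)
        (auto simp: f_def power_mult_distrib scaleR_conv_of_real field_simps)
    also have "\<dots> = (\<integral>x. complex_of_real (x ^ n * exp (a * x)) \<partial>M) * (w ^ n / fact n)" by simp
    also have "(\<integral>x. complex_of_real (x ^ n * exp (a * x)) \<partial>M) = of_real (\<integral>x. x ^ n * exp (a * x) \<partial>M)"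
      by (rule integral_complex_of_real)
    finally show ?thesis by simp
  qed
  ultimately show ?thesis using sums_unique[OF f_sums, symmetric] by simp
qed

text \<open>Once the coefficients below \<open>n\<close> vanish, the series divided by
  \<open>w ^ n\<close> is still 0 off the origin, and its limit at the origin is coefficient
  \<open>n\<close>.\<close>

lemma power_series_eq_zero:
  fixes d :: "nat \<Rightarrow> real"
  assumes a: "0 < a" and d: "\<And>w. \<bar>w\<bar> < a \<Longrightarrow> (\<lambda>n. d n * w ^ n) sums 0"
  shows "d n = 0"
proof (induction n rule: less_induct)
  case (less n)
  have "((\<lambda>_. 0) \<longlongrightarrow> d (0 + n)) (at (0::real))"
  proof (rule powser_limit_0_strong[OF a])
    fix w :: real assume w: "w \<noteq> 0" "norm w < a"
    have "(\<lambda>i. d (i + n) * w ^ (i + n)) sums 0"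
      using d[of w] w less sums_iff_shift[of "\<lambda>i. d i * w ^ i" n 0] by simp
    from sums_divide[OF this, of "w ^ n"] show "(\<lambda>i. d (i + n) * w ^ i) sums 0"
      using w by (simp add: power_add)
  qed
  then show ?case using tendsto_unique[OF _ tendsto_const[of 0] , of "at (0::real)"] by fastforce
qed

text \<open>The power series at \<open>a > 0\<close> have real coefficients, so agreement on a real interval carries over to the
  complex disc around \<open>a\<close>; the discs cover the right half plane, whose boundary values are the
  characteristic functions.\<close>

lemma laplace_transform_unique:
  assumes M: "prob_space M" "sets M = sets borel" "\<And>u. 0 \<le> u \<Longrightarrow> integrable M (\<lambda>x. exp (u * x))"
    and N: "prob_space N" "sets N = sets borel" "\<And>u. 0 \<le> u \<Longrightarrow> integrable N (\<lambda>x. exp (u * x))"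
    and eq: "\<And>u. 0 \<le> u \<Longrightarrow> (\<integral>x. exp (u * x) \<partial>M) = (\<integral>x. exp (u * x) \<partial>N)"
  shows "M = (N :: real measure)"
proof -
  interpret M: real_distribution M using M by (auto simp: real_distribution_def real_distribution_axioms_def sets_eq_imp_space_eq)
  interpret N: real_distribution N using N by (auto simp: real_distribution_def real_distribution_axioms_def sets_eq_imp_space_eq)
  define c where "c K a n = (\<integral>x. x ^ n * exp (a * x) \<partial>K) / fact n" for K :: "real measure" and a n
  have real_sums: "(\<lambda>n. c K a n * w ^ n) sums (\<integral>x. exp ((a + w) * x) \<partial>K)"
    if "prob_space K" "sets K = sets borel" "\<And>u. 0 \<le> u \<Longrightarrow> integrable K (\<lambda>x. exp (u * x))" "\<bar>w\<bar> < a" for K a and w :: real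
  proof -
    have "(\<lambda>n. complex_of_real (c K a n * w ^ n)) sums (\<integral>x. exp ((of_real a + of_real w) * of_real x) \<partial>K)"
      using exp_power_series_integral[OF that(1-3), of "of_real w" a] that(4) by (simp add: c_def)
    also have "(\<integral>x. exp ((of_real a + of_real w) * of_real x) \<partial>K) = (\<integral>x. complex_of_real (exp ((a + w) * x)) \<partial>K)"
      by (simp add: exp_of_real[symmetric])
    also have "\<dots> = of_real (\<integral>x. exp ((a + w) * x) \<partial>K)" by (rule integral_complex_of_real)
    finally show ?thesis unfolding sums_of_real_iff .
  qed
  have c_eq: "c M a = c N a" if a: "0 < a" for a
  proof -
    have "c M a n - c N a n = 0" for n
    proof (rule power_series_eq_zero[OF a])
      fix w :: real assume w: "\<bar>w\<bar> < a"
      have "(\<lambda>n. c M a n * w ^ n - c N a n * w ^ n) sums ((\<integral>x. exp ((a + w) * x) \<partial>M) - (\<integral>x. exp ((a + w) * x) \<partial>N))"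
        by (intro sums_diff real_sums M N w)
      then show "(\<lambda>n. (c M a n - c N a n) * w ^ n) sums 0"
        using eq[of "a + w"] w by (simp add: left_diff_distrib)
    qed
    then show ?thesis by (simp add: fun_eq_iff)
  qed
  have half_plane: "(\<integral>x. exp (z * of_real x) \<partial>M) = (\<integral>x. exp (z * of_real x) \<partial>N)" if z: "0 < Re z" for z
  proof -
    \<comment> \<open>This is \<open>|z|^2 / Re z\<close>, chosen so that
      \<open>|z - a|^2 = a^2 - a * Re z\<close>; the disc of radius \<open>a\<close> around
      \<open>a\<close> then contains \<open>z\<close>.\<close>
    define a where "a = (Re z)\<^sup>2 / Re z + (Im z)\<^sup>2 / Re z"
    have a: "0 < a" using z by (simp add: a_def add_pos_nonneg)
    have "(norm (z - of_real a))\<^sup>2 = (Re z - a)\<^sup>2 + (Im z)\<^sup>2" by (simp add: cmod_power2)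
    also have "\<dots> = a\<^sup>2 - a * Re z"
      using z by (simp add: a_def power2_eq_square field_simps)
    also have "\<dots> < a\<^sup>2" using a z by simp
    finally have n: "norm (z - of_real a) < a" using a by (metis less_imp_le power2_less_imp_less)
    have "(\<integral>x. exp ((of_real a + (z - of_real a)) * of_real x) \<partial>M) = (\<integral>x. exp ((of_real a + (z - of_real a)) * of_real x) \<partial>N)"
      using exp_power_series_integral[OF M n] exp_power_series_integral[OF N n] c_eq[OF a]
      by (simp add: c_def fun_eq_iff sums_iff)
    then show ?thesis by simp
  qed
  \<comment> \<open>Characteristic functions are reached by letting the real part
    \<open>1 / (n + 1)\<close> shrink to 0; as it stays in \<open>(0, 1]\<close>, the majorant
    \<open>1 + exp x\<close> serves all \<open>n\<close>.\<close>
  have lim: "(\<lambda>n. \<integral>x. exp (Complex (inverse (real (Suc n))) t * of_real x) \<partial>K) \<longlonglongrightarrow> char K t"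
    if "prob_space K" "sets K = sets borel" "\<And>u. 0 \<le> u \<Longrightarrow> integrable K (\<lambda>x. exp (u * x))" for K t
    unfolding char_def
  proof (rule integral_dominated_convergence[where w="\<lambda>x. exp (0 * x) + exp (1 * x)"])
    have [measurable_cong]: "sets K = sets borel" by fact
    show "integrable K (\<lambda>x. exp (0 * x) + exp (1 * x))" by (intro Bochner_Integration.integrable_add that(3)) auto
    show "(\<lambda>x. exp (Complex (inverse (real (Suc n))) t * of_real x)) \<in> borel_measurable K" for n
      by measurable
    show "(\<lambda>x. iexp (t * x)) \<in> borel_measurable K" by measurable
    show "AE x in K. (\<lambda>n. exp (Complex (inverse (real (Suc n))) t * of_real x)) \<longlonglongrightarrow> iexp (t * x)"
    proof (rule AE_I2)
      fix x :: real
      have "(\<lambda>n. Complex (inverse (real (Suc n))) t) \<longlonglongrightarrow> Complex 0 t"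
        by (intro tendsto_Complex LIMSEQ_inverse_real_of_nat tendsto_const)
      then have "(\<lambda>n. exp (Complex (inverse (real (Suc n))) t * of_real x)) \<longlonglongrightarrow> exp (Complex 0 t * of_real x)"
        by (intro tendsto_exp tendsto_mult tendsto_const)
      moreover have "Complex 0 t * of_real x = \<i> * complex_of_real (t * x)" by (simp add: complex_eq_iff)
      ultimately show "(\<lambda>n. exp (Complex (inverse (real (Suc n))) t * of_real x)) \<longlonglongrightarrow> iexp (t * x)" by simp
    qed
    show "AE x in K. norm (exp (Complex (inverse (real (Suc n))) t * of_real x)) \<le> exp (0 * x) + exp (1 * x)" for n
    proof (rule AE_I2)
      fix x :: real
      have "norm (exp (Complex (inverse (real (Suc n))) t * of_real x)) = exp (inverse (real (Suc n)) * x)" by simp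
      also have "\<dots> \<le> exp (0 * x) + exp (1 * x)"
      proof (cases "0 \<le> x")
        case True
        have "inverse (real (Suc n)) \<le> 1" by (simp add: inverse_le_1_iff)
        then have "inverse (real (Suc n)) * x \<le> 1 * x" using True by (intro mult_right_mono)
        then have "exp (inverse (real (Suc n)) * x) \<le> exp (1 * x)" by (simp only: exp_le_cancel_iff)
        then show ?thesis by (simp add: add_increasing)
      next
        case False
        then have "inverse (real (Suc n)) * x \<le> 0 * x" by (simp add: mult_nonneg_nonpos)
        then have "exp (inverse (real (Suc n)) * x) \<le> exp (0 * x)" by (simp only: exp_le_cancel_iff)
        then show ?thesis by (simp add: add_increasing2)
      qed
      finally show "norm (exp (Complex (inverse (real (Suc n))) t * of_real x)) \<le> exp (0 * x) + exp (1 * x)" .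
    qed
  qed
  have "char M t = char N t" for t
  proof (rule LIMSEQ_unique[OF lim[OF M]])
    have "(\<integral>x. exp (Complex (inverse (real (Suc n))) t * of_real x) \<partial>M) = (\<integral>x. exp (Complex (inverse (real (Suc n))) t * of_real x) \<partial>N)" for n
      by (rule half_plane) simp
    then show "(\<lambda>n. \<integral>x. exp (Complex (inverse (real (Suc n))) t * of_real x) \<partial>M) \<longlonglongrightarrow> char N t"
      using lim[OF N, of t] by simp
  qed
  then show ?thesis by (intro Levy_uniqueness ext) (unfold_locales)
qed

section \<open>Exponential moments at all times from those at time 1\<close>

context
  fixes M :: "'a measure" and \<xi> :: "real \<Rightarrow> 'a \<Rightarrow> real" and u c :: real
  assumes \<xi>: "levy_process M \<xi>" and u1: "(\<integral>\<^sup>+\<omega>. ennreal (exp (u * \<xi> 1 \<omega>)) \<partial>M) = ennreal (exp c)"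
begin

lemma levy_exp_add:
  assumes s: "0 \<le> s" and t: "0 \<le> t"
  shows "(\<integral>\<^sup>+\<omega>. ennreal (exp (u * \<xi> (s + t) \<omega>)) \<partial>M) =
    (\<integral>\<^sup>+\<omega>. ennreal (exp (u * \<xi> s \<omega>)) \<partial>M) * (\<integral>\<^sup>+\<omega>. ennreal (exp (u * \<xi> t \<omega>)) \<partial>M)"
proof -
  interpret prob_space M by (rule levy_prob_space[OF \<xi>])
  define \<tau> where "\<tau> i = (if i = 0 then 0 else if i = 1 then s else s + t)" for i :: nat
  have "mono \<tau>" by (rule monoI) (use s t in \<open>auto simp: \<tau>_def\<close>)
  let ?I = "\<lambda>i \<omega>. \<xi> (\<tau> (Suc i)) \<omega> - \<xi> (\<tau> i) \<omega>"
  have ind: "indep_vars (\<lambda>_. borel) ?I {..<2}" by (rule levy_indep[OF \<xi> _ \<open>mono \<tau>\<close>]) (simp add: \<tau>_def)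
  have [measurable]: "\<xi> s \<in> borel_measurable M" "\<xi> t \<in> borel_measurable M" "\<xi> (s + t) \<in> borel_measurable M"
    using levy_measurable[OF \<xi>] s t by auto
  have "(\<integral>\<^sup>+\<omega>. ennreal (exp (u * \<xi> (s + t) \<omega>)) \<partial>M) = (\<integral>\<^sup>+\<omega>. (\<Prod>i\<in>{..<2}. ennreal (exp (u * ?I i \<omega>))) \<partial>M)" (is "nn_integral _ ?l = nn_integral _ ?r")
  proof (rule nn_integral_cong_AE)
    show "AE \<omega> in M. ?l \<omega> = ?r \<omega>"
      using levy_zero[OF \<xi>]
      by eventually_elim
        (simp add: \<tau>_def numeral_2_eq_2 lessThan_Suc ennreal_mult[symmetric] exp_add[symmetric] algebra_simps)
  qed
  also have "\<dots> = (\<Prod>i\<in>{..<2}. \<integral>\<^sup>+\<omega>. ennreal (exp (u * ?I i \<omega>)) \<partial>M)"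
  proof (rule indep_vars_nn_integral)
    have "indep_vars (\<lambda>_. borel) (\<lambda>i. (\<lambda>y. ennreal (exp (u * y))) \<circ> ?I i) {..<2}"
      by (rule indep_vars_compose[OF ind]) measurable
    then show "indep_vars (\<lambda>_. borel) (\<lambda>i \<omega>. ennreal (exp (u * ?I i \<omega>))) {..<2}" by (simp add: comp_def)
  qed simp_all
  also have "\<dots> = (\<integral>\<^sup>+\<omega>. ennreal (exp (u * (\<xi> s \<omega> - \<xi> 0 \<omega>))) \<partial>M) * (\<integral>\<^sup>+\<omega>. ennreal (exp (u * (\<xi> (s + t) \<omega> - \<xi> s \<omega>))) \<partial>M)"
    by (simp add: numeral_2_eq_2 lessThan_Suc \<tau>_def mult.commute)
  also have "(\<integral>\<^sup>+\<omega>. ennreal (exp (u * (\<xi> s \<omega> - \<xi> 0 \<omega>))) \<partial>M) = (\<integral>\<^sup>+\<omega>. ennreal (exp (u * \<xi> s \<omega>)) \<partial>M)"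
    by (rule nn_integral_cong_AE) (use levy_zero[OF \<xi>] in eventually_elim, simp)
  also have "(\<integral>\<^sup>+\<omega>. ennreal (exp (u * (\<xi> (s + t) \<omega> - \<xi> s \<omega>))) \<partial>M) = (\<integral>\<^sup>+y. ennreal (exp (u * y)) \<partial>distr M borel (\<lambda>\<omega>. \<xi> (s + t) \<omega> - \<xi> s \<omega>))"
    by (rule nn_integral_distr[symmetric]) measurable
  also have "distr M borel (\<lambda>\<omega>. \<xi> (s + t) \<omega> - \<xi> s \<omega>) = distr M borel (\<xi> t)"
    using levy_stationary[OF \<xi>, of s "s + t"] s t by simp
  also have "(\<integral>\<^sup>+y. ennreal (exp (u * y)) \<partial>distr M borel (\<xi> t)) = (\<integral>\<^sup>+\<omega>. ennreal (exp (u * \<xi> t \<omega>)) \<partial>M)"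
    by (rule nn_integral_distr) measurable
  finally show ?thesis .
qed

text \<open>Multiplicativity settles dyadic times by taking roots. Right-continuity and Fatou's
  lemma give the upper bound at \<open>t\<close>. The lower bound comes from splitting an integer
  \<open>m \<ge> t\<close> into \<open>t\<close> and \<open>m - t\<close>, the latter obeying the
  upper bound. Nonnegative integrals avoid presupposing that the moment at \<open>t\<close> is
  finite.\<close>

lemma levy_exp_moment:
  assumes t: "0 \<le> t"
  shows "(\<integral>\<^sup>+\<omega>. ennreal (exp (u * \<xi> t \<omega>)) \<partial>M) = ennreal (exp (c * t))"
proof -
  interpret prob_space M by (rule levy_prob_space[OF \<xi>])
  define g where "g t = (\<integral>\<^sup>+\<omega>. ennreal (exp (u * \<xi> t \<omega>)) \<partial>M)" for t
  have m[measurable]: "0 \<le> t \<Longrightarrow> \<xi> t \<in> borel_measurable M" for t by (rule levy_measurable[OF \<xi>])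
  have add: "g (s + t) = g s * g t" if "0 \<le> s" "0 \<le> t" for s t
    unfolding g_def by (rule levy_exp_add[OF that])
  have g0: "g 0 = 1"
  proof -
    have "g 0 = (\<integral>\<^sup>+\<omega>. 1 \<partial>M)" unfolding g_def
      by (rule nn_integral_cong_AE) (use levy_zero[OF \<xi>] in eventually_elim, simp)
    then show ?thesis by (simp add: emeasure_space_1)
  qed
  have mult: "g (real n * t) = g t ^ n" if "0 \<le> t" for n t
  proof (induction n)
    case (Suc n)
    then show ?case using add[of "t" "real n * t"] that by (simp add: algebra_simps)
  qed (simp add: g0)
  have g1: "g 1 = ennreal (exp c)" using u1 by (simp add: g_def)
  have rat: "g (real k * (1 / 2 ^ n)) = ennreal (exp (c * (real k * (1 / 2 ^ n))))" for k n
  proof -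
    have p: "g (1 / 2 ^ n) ^ (2 ^ n) = ennreal (exp c)" using mult[of "1 / 2 ^ n" "2 ^ n"] g1 by simp
    have "g (1 / 2 ^ n) \<noteq> \<top>"
      using p power_eq_top_ennreal[of "g (1 / 2 ^ n)" "2 ^ n"] by auto
    then obtain r where r: "g (1 / 2 ^ n) = ennreal r" "0 \<le> r" by (cases "g (1 / 2 ^ n)") auto
    have "ennreal (r ^ 2 ^ n) = ennreal (exp c)" using p r by (simp add: ennreal_power)
    then have "r ^ 2 ^ n = exp c" using r(2) by (simp add: ennreal_inj)
    also have "\<dots> = exp (c / 2 ^ n) ^ 2 ^ n" by (simp add: exp_of_nat_mult[symmetric])
    finally have "r = exp (c / 2 ^ n)" using r(2) by (intro power_eq_imp_eq_base[of r "2 ^ n"]) auto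
    then have "g (real k * (1 / 2 ^ n)) = ennreal (exp (c / 2 ^ n) ^ k)"
      using mult[of "1 / 2 ^ n" k] r by (simp add: ennreal_power)
    then show ?thesis by (simp add: exp_of_nat_mult[symmetric] algebra_simps)
  qed
  have le: "g t \<le> ennreal (exp (c * t))" if t: "0 \<le> t" for t
  proof -
    have d: "0 \<le> dyadic_above n t" for n using dyadic_above_bounds(1)[OF t, of n] t by simp
    have gd: "g (dyadic_above n t) = ennreal (exp (c * dyadic_above n t))" for n
      using rat[of "nat \<lfloor>2 ^ n * t\<rfloor> + 1" n] by (simp add: dyadic_above_def add.commute)
    have lim: "(\<lambda>n. ennreal (exp (u * \<xi> (dyadic_above n t) \<omega>))) \<longlonglongrightarrow> ennreal (exp (u * \<xi> t \<omega>))" if "\<omega> \<in> space M" for \<omega>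
      using continuous_at_right_dyadic[OF t cadlag_in_right[OF levy_cadlag[OF \<xi> that] t]]
      by (intro tendsto_ennrealI tendsto_intros)
    have "g t = (\<integral>\<^sup>+\<omega>. liminf (\<lambda>n. ennreal (exp (u * \<xi> (dyadic_above n t) \<omega>))) \<partial>M)"
      unfolding g_def by (rule nn_integral_cong) (use lim_imp_Liminf[OF _ lim] in auto)
    also have "\<dots> \<le> liminf (\<lambda>n. g (dyadic_above n t))"
      unfolding g_def by (rule nn_integral_liminf) (use d in measurable)
    also have "\<dots> = ennreal (exp (c * t))"
      unfolding gd by (intro lim_imp_Liminf tendsto_ennrealI tendsto_intros dyadic_above_tendsto t) simp
    finally show ?thesis .
  qed
  define m where "m = nat \<lceil>t\<rceil>"
  have mt: "0 \<le> real m - t" using t by (simp add: m_def)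
  have gm: "g (real m) = ennreal (exp (c * real m))" using rat[of m 0] by simp
  have "ennreal (exp (c * real m)) = g t * g (real m - t)" using add[OF t mt] gm by simp
  also have "\<dots> \<le> g t * ennreal (exp (c * (real m - t)))" by (intro mult_left_mono le[OF mt]) simp
  finally have 1: "ennreal (exp (c * real m)) \<le> g t * ennreal (exp (c * (real m - t)))" .
  obtain r where r: "g t = ennreal r" "0 \<le> r" using le[OF t] by (cases "g t") (auto simp: top_unique)
  have "exp (c * real m) \<le> r * exp (c * (real m - t))"
    using 1 r by (simp add: ennreal_mult[symmetric] ennreal_le_iff)
  then have "exp (c * real m) * exp (- (c * (real m - t))) \<le> r * exp (c * (real m - t)) * exp (- (c * (real m - t)))"
    by (intro mult_right_mono) auto
  then have "exp (c * t) \<le> r" by (simp add: exp_add[symmetric] algebra_simps)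
  then have "ennreal (exp (c * t)) \<le> g t" using r by (simp add: ennreal_leI)
  then show ?thesis using le[OF t] unfolding g_def by (rule antisym[rotated])
qed

end

lemma levy_exp_moment_integral:
  assumes \<xi>: "levy_process M \<xi>" and i: "integrable M (\<lambda>\<omega>. exp (u * \<xi> 1 \<omega>))" and e: "(\<integral>\<omega>. exp (u * \<xi> 1 \<omega>) \<partial>M) = exp c"
    and t: "0 \<le> t"
  shows "(\<integral>\<^sup>+\<omega>. ennreal (exp (u * \<xi> t \<omega>)) \<partial>M) = ennreal (exp (c * t))"
    "integrable M (\<lambda>\<omega>. exp (u * \<xi> t \<omega>))" "(\<integral>\<omega>. exp (u * \<xi> t \<omega>) \<partial>M) = exp (c * t)"
proof -
  have [measurable]: "\<xi> t \<in> borel_measurable M" by (rule levy_measurable[OF \<xi> t])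
  show *: "(\<integral>\<^sup>+\<omega>. ennreal (exp (u * \<xi> t \<omega>)) \<partial>M) = ennreal (exp (c * t))"
    by (rule levy_exp_moment[OF \<xi> _ t]) (subst nn_integral_eq_integral[OF i], use e in auto)
  show "integrable M (\<lambda>\<omega>. exp (u * \<xi> t \<omega>))" by (rule integrableI_nonneg) (use * in auto)
  show "(\<integral>\<omega>. exp (u * \<xi> t \<omega>) \<partial>M) = exp (c * t)" by (subst integral_eq_nn_integral) (use * in auto)
qed

text \<open>Both laws have the transform \<open>exp ((\<psi> (u + \<gamma>) - q) * t)\<close> on
  \<open>u \<ge> 0\<close>: the tilt shifts the argument by \<open>\<gamma>\<close>, and
  \<open>\<psi> \<gamma> = q\<close> normalises its mass to 1.\<close>

lemma esscher_law:
  fixes \<psi> :: "real \<Rightarrow> real"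
  assumes \<xi>: "levy_process M \<xi>" and \<eta>: "levy_process N \<eta>" and \<gamma>: "0 \<le> \<gamma>" "\<psi> \<gamma> = q"
    and M: "\<And>u. 0 \<le> u \<Longrightarrow> integrable M (\<lambda>\<omega>. exp (u * \<xi> 1 \<omega>)) \<and> (\<integral>\<omega>. exp (u * \<xi> 1 \<omega>) \<partial>M) = exp (\<psi> u)"
    and N: "\<And>u. 0 \<le> u \<Longrightarrow> integrable N (\<lambda>\<omega>. exp (u * \<eta> 1 \<omega>)) \<and> (\<integral>\<omega>. exp (u * \<eta> 1 \<omega>) \<partial>N) = exp (\<psi> (u + \<gamma>) - q)"
    and t: "0 \<le> t"
  shows "distr N borel (\<eta> t) = distr (density M (\<lambda>\<omega>. ennreal (exp (\<gamma> * \<xi> t \<omega> - q * t)))) borel (\<xi> t)"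
    (is "_ = distr ?D _ _")
proof (rule laplace_transform_unique)
  interpret M: prob_space M by (rule levy_prob_space[OF \<xi>])
  interpret N: prob_space N by (rule levy_prob_space[OF \<eta>])
  have [measurable]: "\<xi> t \<in> borel_measurable M" "\<eta> t \<in> borel_measurable N"
    using levy_measurable[OF \<xi> t] levy_measurable[OF \<eta> t] by auto
  have exp_split: "exp (\<gamma> * \<xi> t \<omega> - q * t) * exp (u * \<xi> t \<omega>) = exp (- q * t) * exp ((u + \<gamma>) * \<xi> t \<omega>)" for u \<omega>
    by (simp add: exp_add[symmetric] algebra_simps)
  have mM: "integrable M (\<lambda>\<omega>. exp ((u + \<gamma>) * \<xi> t \<omega>))" "(\<integral>\<omega>. exp ((u + \<gamma>) * \<xi> t \<omega>) \<partial>M) = exp (\<psi> (u + \<gamma>) * t)"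
    if "0 \<le> u" for u using levy_exp_moment_integral[OF \<xi> _ _ t, of "u + \<gamma>" "\<psi> (u + \<gamma>)"] M[of "u + \<gamma>"] that \<gamma> by auto
  have mN: "integrable N (\<lambda>\<omega>. exp (u * \<eta> t \<omega>))" "(\<integral>\<omega>. exp (u * \<eta> t \<omega>) \<partial>N) = exp ((\<psi> (u + \<gamma>) - q) * t)"
    if "0 \<le> u" for u using levy_exp_moment_integral[OF \<eta> _ _ t, of u "\<psi> (u + \<gamma>) - q"] N[OF that] by auto
  show "prob_space (distr N borel (\<eta> t))" by (rule N.prob_space_distr) simp
  have "prob_space ?D"
  proof (rule prob_spaceI)
    have "emeasure ?D (space ?D) = (\<integral>\<^sup>+\<omega>. ennreal (exp (- q * t) * exp ((0 + \<gamma>) * \<xi> t \<omega>)) \<partial>M)"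
      by (subst emeasure_density) (auto intro!: nn_integral_cong simp: exp_add[symmetric] algebra_simps)
    also have "\<dots> = ennreal (\<integral>\<omega>. exp (- q * t) * exp ((0 + \<gamma>) * \<xi> t \<omega>) \<partial>M)"
      by (rule nn_integral_eq_integral) (use mM(1)[of 0] in auto)
    also have "(\<integral>\<omega>. exp (- q * t) * exp ((0 + \<gamma>) * \<xi> t \<omega>) \<partial>M) = exp (- q * t) * exp (\<psi> (0 + \<gamma>) * t)"
      unfolding integral_mult_right_zero mM(2)[OF order_refl] ..
    also have "ennreal \<dots> = 1" using \<gamma> by (simp add: exp_add[symmetric])
    finally show "emeasure ?D (space ?D) = 1" .
  qed
  then show "prob_space (distr ?D borel (\<xi> t))" by (rule prob_space.prob_space_distr) simp
  fix u :: real assume u: "0 \<le> u"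
  show "integrable (distr N borel (\<eta> t)) (\<lambda>x. exp (u * x))" by (subst integrable_distr_eq) (use mN(1)[OF u] in auto)
  show "integrable (distr ?D borel (\<xi> t)) (\<lambda>x. exp (u * x))"
    by (subst integrable_distr_eq) (use mM(1)[OF u] in \<open>auto simp: integrable_density exp_split\<close>)
  have "(\<integral>x. exp (u * x) \<partial>distr N borel (\<eta> t)) = exp ((\<psi> (u + \<gamma>) - q) * t)"
    by (subst integral_distr) (use mN(2)[OF u] in auto)
  moreover have "(\<integral>x. exp (u * x) \<partial>distr ?D borel (\<xi> t)) = exp (- q * t) * exp (\<psi> (u + \<gamma>) * t)"
    by (subst integral_distr) (use mM(2)[OF u] in \<open>auto simp: integral_density exp_split\<close>)
  ultimately show "(\<integral>x. exp (u * x) \<partial>distr N borel (\<eta> t)) = (\<integral>x. exp (u * x) \<partial>distr ?D borel (\<xi> t))"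
    by (simp add: exp_add[symmetric] algebra_simps)
qed auto

section \<open>Negatives of Levy processes\<close>

lemma levy_uminus:
  assumes "levy_process M \<xi>" shows "levy_process M (\<lambda>t \<omega>. - \<xi> t \<omega>)"
  unfolding levy_process_def
proof (intro conjI allI impI ballI)
  interpret prob_space M by (rule levy_prob_space[OF assms])
  show "prob_space M" by unfold_locales
  note m[measurable] = levy_measurable[OF assms]
  show "(\<lambda>\<omega>. - \<xi> t \<omega>) \<in> borel_measurable M" if "0 \<le> t" for t using m[OF that] by measurable
  show "AE \<omega> in M. - \<xi> 0 \<omega> = 0" using levy_zero[OF assms] by simp
  show "cadlag_in UNIV (\<lambda>t. - \<xi> t \<omega>)" if \<omega>: "\<omega> \<in> space M" for \<omega>
    unfolding cadlag_in_def
  proof (intro conjI allI impI)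
    fix t :: real assume "0 \<le> t"
    from cadlag_in_right[OF levy_cadlag[OF assms \<omega>] this]
    show "continuous (at_right t) (\<lambda>t. - \<xi> t \<omega>)" by (rule continuous_minus)
  next
    fix t :: real assume "0 < t"
    then obtain l where "((\<lambda>t. \<xi> t \<omega>) \<longlongrightarrow> l) (at_left t)"
      using levy_cadlag[OF assms \<omega>] unfolding cadlag_in_def by blast
    from tendsto_minus[OF this] show "\<exists>l\<in>UNIV. ((\<lambda>t. - \<xi> t \<omega>) \<longlongrightarrow> l) (at_left t)" by blast
  qed simp
  show "distr M borel (\<lambda>\<omega>. - \<xi> (s + t) \<omega> - - \<xi> s \<omega>) = distr M borel (\<lambda>\<omega>. - \<xi> t \<omega>)" if "0 \<le> s" "0 \<le> t" for s t
  proof -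
    have [measurable]: "\<xi> s \<in> borel_measurable M" "\<xi> t \<in> borel_measurable M" "\<xi> (s + t) \<in> borel_measurable M"
      using m that by auto
    have "distr M borel (\<lambda>\<omega>. - \<xi> (s + t) \<omega> - - \<xi> s \<omega>) = distr (distr M borel (\<lambda>\<omega>. \<xi> (s + t) \<omega> - \<xi> s \<omega>)) borel uminus"
      by (subst distr_distr) (auto simp: comp_def)
    also have "\<dots> = distr (distr M borel (\<xi> t)) borel uminus"
      using levy_stationary[OF assms, of s "s + t"] that by simp
    also have "\<dots> = distr M borel (\<lambda>\<omega>. - \<xi> t \<omega>)" by (subst distr_distr) (auto simp: comp_def)
    finally show ?thesis .
  qed
  show "indep_vars (\<lambda>_. borel) (\<lambda>i \<omega>. - \<xi> (\<tau> (Suc i)) \<omega> - - \<xi> (\<tau> i) \<omega>) {..<n}" if "0 \<le> \<tau> 0" "mono \<tau>" for \<tau> :: "nat \<Rightarrow> real" and n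
  proof -
    have "indep_vars (\<lambda>_. borel) (\<lambda>i. uminus \<circ> (\<lambda>\<omega>. \<xi> (\<tau> (Suc i)) \<omega> - \<xi> (\<tau> i) \<omega>)) {..<n}"
      by (rule indep_vars_compose[OF levy_indep[OF assms that]]) measurable
    then show ?thesis by (simp add: comp_def)
  qed
qed

text \<open>By stationarity all increments between neighbouring dyadic points are nonpositive
  outside a single null set; right-continuity extends the monotonicity to all times.\<close>

lemma subordinator_uminus:
  assumes \<xi>: "levy_process M \<xi>" and neg: "\<And>t. 0 \<le> t \<Longrightarrow> AE \<omega> in M. \<xi> t \<omega> \<le> 0"
  shows "subordinator M (\<lambda>t \<omega>. - \<xi> t \<omega>)"
  unfolding subordinator_def
proof (intro conjI levy_uminus[OF \<xi>])
  interpret prob_space M by (rule levy_prob_space[OF \<xi>])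
  note m = levy_measurable[OF \<xi>]
  have "AE \<omega> in M. \<xi> ((real k + 1) / 2 ^ n) \<omega> \<le> \<xi> (real k / 2 ^ n) \<omega>" for n k :: nat
  proof -
    have k: "0 \<le> real k / 2 ^ n" "real k / 2 ^ n \<le> (real k + 1) / 2 ^ n" by (auto intro: divide_right_mono)
    have [measurable]: "\<xi> (real k / 2 ^ n) \<in> borel_measurable M" "\<xi> ((real k + 1) / 2 ^ n) \<in> borel_measurable M"
      using m k by auto
    have d0: "0 \<le> (real k + 1) / 2 ^ n - real k / 2 ^ n" using k by simp
    have [measurable]: "\<xi> ((real k + 1) / 2 ^ n - real k / 2 ^ n) \<in> borel_measurable M" by (rule m[OF d0])
    have "AE y in distr M borel (\<xi> ((real k + 1) / 2 ^ n - real k / 2 ^ n)). y \<le> 0"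
      by (subst AE_distr_iff) (use neg[OF d0] in auto)
    then have "AE y in distr M borel (\<lambda>\<omega>. \<xi> ((real k + 1) / 2 ^ n) \<omega> - \<xi> (real k / 2 ^ n) \<omega>). y \<le> 0"
      unfolding levy_stationary[OF \<xi> k] .
    then show ?thesis by (subst (asm) AE_distr_iff) auto
  qed
  then have "AE \<omega> in M. \<forall>n k :: nat. \<xi> ((real k + 1) / 2 ^ n) \<omega> \<le> \<xi> (real k / 2 ^ n) \<omega>"
    by (simp add: AE_all_countable)
  then show "AE \<omega> in M. mono_on {0..} (\<lambda>t. - \<xi> t \<omega>)"
    using AE_space
  proof eventually_elim
    case (elim \<omega>)
    have dec: "\<xi> (real (k + j) / 2 ^ n) \<omega> \<le> \<xi> (real k / 2 ^ n) \<omega>" for n k j :: nat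
    proof (induction j)
      case (Suc j)
      have "\<xi> (real (k + Suc j) / 2 ^ n) \<omega> \<le> \<xi> (real (k + j) / 2 ^ n) \<omega>"
        using elim(1)[rule_format, of "k + j" n] by (simp add: ac_simps)
      then show ?case using Suc by simp
    qed simp
    have c: "cadlag_in UNIV (\<lambda>t. \<xi> t \<omega>)" by (rule levy_cadlag[OF \<xi> elim(2)])
    show ?case
    proof (rule mono_onI)
      fix s t :: real assume st: "s \<in> {0..}" "t \<in> {0..}" "s \<le> t"
      have "\<xi> t \<omega> \<le> \<xi> s \<omega>"
      proof (rule LIMSEQ_le)
        show "(\<lambda>n. \<xi> (dyadic_above n t) \<omega>) \<longlonglongrightarrow> \<xi> t \<omega>" "(\<lambda>n. \<xi> (dyadic_above n s) \<omega>) \<longlonglongrightarrow> \<xi> s \<omega>"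
          using continuous_at_right_dyadic[OF _ cadlag_in_right[OF c]] st by auto
        have "\<xi> (dyadic_above n t) \<omega> \<le> \<xi> (dyadic_above n s) \<omega>" for n
        proof -
          have "\<lfloor>2 ^ n * s\<rfloor> \<le> \<lfloor>2 ^ n * t\<rfloor>" using st by (intro floor_mono) auto
          then obtain j where "nat \<lfloor>2 ^ n * t\<rfloor> = nat \<lfloor>2 ^ n * s\<rfloor> + j" using le_Suc_ex nat_mono by blast
          then show ?thesis using dec[of "nat \<lfloor>2 ^ n * s\<rfloor> + 1" j n] by (simp add: dyadic_above_def ac_simps)
        qed
        then show "\<exists>N. \<forall>n\<ge>N. \<xi> (dyadic_above n t) \<omega> \<le> \<xi> (dyadic_above n s) \<omega>" by blast
      qed
      then show "- \<xi> s \<omega> \<le> - \<xi> t \<omega>" by simp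
    qed
  qed
qed

section \<open>The Laplace exponent and its right inverse\<close>

context
  fixes M :: "'a measure" and \<xi> :: "real \<Rightarrow> 'a \<Rightarrow> real"
  assumes \<xi>: "levy_process M \<xi>" and moments: "finite_exp_moments M \<xi>"
begin

lemma laplace_exponent_exp:
  assumes "0 \<le> u"
  shows "integrable M (\<lambda>\<omega>. exp (u * \<xi> 1 \<omega>))" "(\<integral>\<omega>. exp (u * \<xi> 1 \<omega>) \<partial>M) = exp (laplace_exponent M \<xi> u)"
proof -
  interpret prob_space M by (rule levy_prob_space[OF \<xi>])
  show i: "integrable M (\<lambda>\<omega>. exp (u * \<xi> 1 \<omega>))" using moments assms unfolding finite_exp_moments_def by blast
  have "0 < (\<integral>\<omega>. exp (u * \<xi> 1 \<omega>) \<partial>M)"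
    using integral_less_AE_space[of "\<lambda>_. 0" "\<lambda>\<omega>. exp (u * \<xi> 1 \<omega>)"] i by (simp add: emeasure_space_1)
  then show "(\<integral>\<omega>. exp (u * \<xi> 1 \<omega>) \<partial>M) = exp (laplace_exponent M \<xi> u)" by (simp add: laplace_exponent_def)
qed

lemma laplace_exponent_continuous: "continuous_on {0..} (laplace_exponent M \<xi>)"
  unfolding continuous_on_sequentially
proof (intro allI ballI impI, elim conjE)
  interpret prob_space M by (rule levy_prob_space[OF \<xi>])
  have [measurable]: "\<xi> 1 \<in> borel_measurable M" by (rule levy_measurable[OF \<xi>]) simp
  fix X :: "nat \<Rightarrow> real" and a assume a: "a \<in> {0..}" and X: "\<forall>n. X n \<in> {0..}" "X \<longlonglongrightarrow> a"
  obtain b where b: "\<And>n. X n \<le> b" using convergent_imp_Bseq[OF convergentI[OF X(2)]] unfolding Bseq_def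
    by (metis abs_le_D1 real_norm_def)
  have b0: "0 \<le> b" using b[of 0] X(1) by (metis atLeast_iff order_trans)
  have "(\<lambda>n. \<integral>\<omega>. exp (X n * \<xi> 1 \<omega>) \<partial>M) \<longlonglongrightarrow> (\<integral>\<omega>. exp (a * \<xi> 1 \<omega>) \<partial>M)"
  proof (rule integral_dominated_convergence[where w="\<lambda>\<omega>. exp (0 * \<xi> 1 \<omega>) + exp (b * \<xi> 1 \<omega>)"])
    show "integrable M (\<lambda>\<omega>. exp (0 * \<xi> 1 \<omega>) + exp (b * \<xi> 1 \<omega>))"
      by (intro Bochner_Integration.integrable_add laplace_exponent_exp(1)) (use b0 in auto)
    show "AE \<omega> in M. (\<lambda>n. exp (X n * \<xi> 1 \<omega>)) \<longlonglongrightarrow> exp (a * \<xi> 1 \<omega>)"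
      by (intro AE_I2 tendsto_intros X(2))
    show "AE \<omega> in M. norm (exp (X n * \<xi> 1 \<omega>)) \<le> exp (0 * \<xi> 1 \<omega>) + exp (b * \<xi> 1 \<omega>)" for n
    proof (rule AE_I2)
      fix \<omega>
      have "X n * \<xi> 1 \<omega> \<le> (if 0 \<le> \<xi> 1 \<omega> then b else 0) * \<xi> 1 \<omega>"
        using b[of n] X(1) by (auto intro: mult_right_mono mult_nonneg_nonpos)
      then have "exp (X n * \<xi> 1 \<omega>) \<le> exp ((if 0 \<le> \<xi> 1 \<omega> then b else 0) * \<xi> 1 \<omega>)" by simp
      also have "\<dots> \<le> exp (0 * \<xi> 1 \<omega>) + exp (b * \<xi> 1 \<omega>)" by (simp add: add_increasing add_increasing2)
      finally show "norm (exp (X n * \<xi> 1 \<omega>)) \<le> exp (0 * \<xi> 1 \<omega>) + exp (b * \<xi> 1 \<omega>)" by simp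
    qed
  qed measurable
  then have "(\<lambda>n. exp (laplace_exponent M \<xi> (X n))) \<longlonglongrightarrow> exp (laplace_exponent M \<xi> a)"
    using laplace_exponent_exp(2) X(1) a by simp
  then have "(\<lambda>n. ln (exp (laplace_exponent M \<xi> (X n)))) \<longlonglongrightarrow> ln (exp (laplace_exponent M \<xi> a))"
    by (rule tendsto_ln) simp
  then show "(laplace_exponent M \<xi> \<circ> X) \<longlonglongrightarrow> laplace_exponent M \<xi> a" by (simp add: comp_def)
qed

text \<open>If \<open>\<psi>\<close> stays bounded along a sequence tending to infinity, Markov's inequality forces \<open>\<xi> t \<le> 0\<close>.\<close>

lemma laplace_exponent_unbounded:
  assumes "\<not> subordinator M (\<lambda>t \<omega>. - \<xi> t \<omega>)"
  shows "\<exists>u0\<ge>0. \<forall>u\<ge>u0. C < laplace_exponent M \<xi> u"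
proof (rule ccontr)
  interpret prob_space M by (rule levy_prob_space[OF \<xi>])
  assume "\<not> (\<exists>u0\<ge>0. \<forall>u\<ge>u0. C < laplace_exponent M \<xi> u)"
  then have C: "\<exists>u\<ge>u0. laplace_exponent M \<xi> u \<le> C" if "0 \<le> u0" for u0 using that by (meson not_le)
  have "AE \<omega> in M. \<xi> t \<omega> \<le> 0" if t: "0 \<le> t" for t
  proof -
    have [measurable]: "\<xi> t \<in> borel_measurable M" by (rule levy_measurable[OF \<xi> t])
    have "prob {\<omega>\<in>space M. inverse (real (Suc n)) \<le> \<xi> t \<omega>} = 0" (is "prob ?A = 0") for n
    proof (rule ccontr)
      assume "prob ?A \<noteq> 0"
      then have p: "0 < prob ?A" using measure_nonneg[of M ?A] by linarith
      define e where "e = inverse (real (Suc n))"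
      have e: "0 < e" by (simp add: e_def)
      \<comment> \<open>The second entry solves \<open>ln (prob A) + u * e = C * t + 1\<close>,
        which oversteps by 1 the bound that Markov's inequality will give.\<close>
      define u0 where "u0 = max 0 ((C * t - ln (prob ?A) + 1) / e)"
      obtain u where u: "u0 \<le> u" "laplace_exponent M \<xi> u \<le> C" using C[of u0] by (auto simp: u0_def)
      have u_nonneg: "0 \<le> u" using u(1) by (simp add: u0_def)
      note mom = levy_exp_moment_integral[OF \<xi> laplace_exponent_exp[OF u_nonneg] t]
      have "prob ?A * exp (u * e) = (\<integral>\<omega>. indicator ?A \<omega> * exp (u * e) \<partial>M)" by simp
      also have "\<dots> \<le> (\<integral>\<omega>. exp (u * \<xi> t \<omega>) \<partial>M)"
      proof (rule integral_mono)
        show "integrable M (\<lambda>\<omega>. indicator ?A \<omega> * exp (u * e))"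
          by (intro integrable_mult_left integrable_real_indicator) (auto simp: emeasure_eq_measure)
        show "indicator ?A \<omega> * exp (u * e) \<le> exp (u * \<xi> t \<omega>)" for \<omega>
          using u_nonneg by (auto simp: indicator_def e_def intro: mult_left_mono)
      qed (rule mom(2))
      also have "\<dots> \<le> exp (C * t)" unfolding mom(3) using u(2) t by (simp add: mult_right_mono)
      finally have "ln (prob ?A * exp (u * e)) \<le> ln (exp (C * t))" using p by (subst ln_le_cancel_iff) auto
      then have "ln (prob ?A) + u * e \<le> C * t" using p by (simp add: ln_mult)
      moreover have "C * t - ln (prob ?A) + 1 \<le> u * e"
        using u(1) e by (simp add: u0_def pos_divide_le_eq)
      ultimately show False by linarith
    qed
    then have "AE \<omega> in M. \<not> inverse (real (Suc n)) \<le> \<xi> t \<omega>" for n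
      by (subst AE_iff_measurable[OF _ refl]) (auto simp: emeasure_eq_measure)
    then have "AE \<omega> in M. \<forall>n. \<not> inverse (real (Suc n)) \<le> \<xi> t \<omega>" by (subst AE_all_countable) (intro allI)
    then show ?thesis
    proof eventually_elim
      case (elim \<omega>)
      show ?case
      proof (rule ccontr)
        assume "\<not> \<xi> t \<omega> \<le> 0"
        then obtain n where "inverse (real (Suc n)) < \<xi> t \<omega>" using reals_Archimedean[of "\<xi> t \<omega>"] by auto
        then show False using elim by (meson less_imp_le)
      qed
    qed
  qed
  then show False using subordinator_uminus[OF \<xi>] assms by blast
qed

text \<open>By continuity and growth the nonnegative roots form a compact set, which contains 0, so
  a largest root exists. The intermediate value theorem between this root and a point where
  \<open>\<psi>\<close> exceeds \<open>q\<close> shows that \<open>q\<close> is attained, and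
  \<open>inv_into\<close> returns a genuine preimage.\<close>

lemma exponent_inverse_spec:
  assumes nd: "\<not> subordinator M (\<lambda>t \<omega>. - \<xi> t \<omega>)" and q: "0 < q"
  shows "0 \<le> exponent_inverse (laplace_exponent M \<xi>) q"
    "laplace_exponent M \<xi> (exponent_inverse (laplace_exponent M \<xi>) q) = q"
proof -
  let ?\<psi> = "laplace_exponent M \<xi>"
  interpret prob_space M by (rule levy_prob_space[OF \<xi>])
  have \<psi>0: "?\<psi> 0 = 0" by (simp add: laplace_exponent_def prob_space)
  obtain u0 where u0: "0 \<le> u0" "\<And>u. u0 \<le> u \<Longrightarrow> q < ?\<psi> u" using laplace_exponent_unbounded[OF nd, of q] by blast
  let ?R = "{u. 0 \<le> u \<and> ?\<psi> u = 0}"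
  have R: "?R = {u\<in>{0..u0}. ?\<psi> u = 0}"
  proof -
    have "u \<le> u0" if "?\<psi> u = 0" for u using u0(2)[of u] that q by (cases "u \<le> u0") auto
    then show ?thesis by auto
  qed
  have "closed {u\<in>{0..u0}. ?\<psi> u = 0}"
    by (rule continuous_closed_preimage_constant) (auto intro: continuous_on_subset[OF laplace_exponent_continuous])
  then have "compact ?R" unfolding R
    using bounded_subset[OF compact_imp_bounded[OF compact_Icc[of 0 u0]], of "{u\<in>{0..u0}. ?\<psi> u = 0}"]
    unfolding compact_eq_bounded_closed by blast
  moreover have "?R \<noteq> {}" using \<psi>0 by auto
  ultimately obtain \<theta> where \<theta>: "\<theta> \<in> ?R" "\<forall>u\<in>?R. u \<le> \<theta>" using compact_attains_sup by blast
  have root: "largest_root ?\<psi> = \<theta>" unfolding largest_root_def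
    by (rule Greatest_equality) (use \<theta> in auto)
  have "\<theta> \<le> u0" using \<theta>(1) R by auto
  have "\<exists>u. \<theta> \<le> u \<and> u \<le> u0 \<and> ?\<psi> u = q"
    by (rule IVT') (use \<theta>(1) q u0(2)[OF order_refl] \<open>\<theta> \<le> u0\<close> in
      \<open>auto intro!: continuous_on_subset[OF laplace_exponent_continuous]\<close>)
  then have q_in: "q \<in> ?\<psi> ` {\<theta>..}" by auto
  show "0 \<le> exponent_inverse ?\<psi> q"
    using inv_into_into[OF q_in] \<theta>(1) by (simp add: exponent_inverse_def root)
  show "?\<psi> (exponent_inverse ?\<psi> q) = q"
    using f_inv_into_f[OF q_in] by (simp add: exponent_inverse_def root)
qed

end

section \<open>Change of measure at a debut\<close>

definition debut :: "(real \<Rightarrow> (real \<Rightarrow> real) \<Rightarrow> bool) \<Rightarrow> (real \<Rightarrow> real) \<Rightarrow> ereal" where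
  "debut D f = Inf {ereal u |u. 0 \<le> u \<and> D u f}"

definition adapted :: "(real \<Rightarrow> (real \<Rightarrow> real) \<Rightarrow> 'b) \<Rightarrow> bool" where
  "adapted k \<longleftrightarrow> (\<forall>u f g. 0 \<le> u \<longrightarrow> (\<forall>v. 0 \<le> v \<longrightarrow> v \<le> u \<longrightarrow> f v = g v) \<longrightarrow> k u f = k u g)"

lemma adaptedD: "adapted k \<Longrightarrow> 0 \<le> u \<Longrightarrow> (\<And>v. 0 \<le> v \<Longrightarrow> v \<le> u \<Longrightarrow> f v = g v) \<Longrightarrow> k u f = k u g"
  unfolding adapted_def by blast

lemma debut_nonneg: "0 \<le> debut D f"
  unfolding debut_def by (rule Inf_greatest) auto

lemma debut_finite: "debut D f < \<infinity> \<Longrightarrow> ereal (real_of_ereal (debut D f)) = debut D f \<and> 0 \<le> real_of_ereal (debut D f)"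
  using debut_nonneg[of D f] by (cases "debut D f") auto

lemma debut_less_iff: "debut D f < ereal c \<longleftrightarrow> (\<exists>u\<ge>0. u < c \<and> D u f)"
  unfolding debut_def Inf_less_iff by auto

text \<open>The strict inequality provides a time before \<open>s\<close> at which \<open>D\<close>
  holds, and this is decided by the path on \<open>[0, s]\<close>. At later times \<open>D\<close>
  may differ between the two paths, but these do not lower the infimum.\<close>

lemma debut_local:
  assumes D: "adapted D" and fg: "\<And>v. 0 \<le> v \<Longrightarrow> v \<le> s \<Longrightarrow> f v = g v" and g: "debut D g < ereal s"
  shows "debut D f \<le> debut D g"
proof -
  have DD: "D u f" if "0 \<le> u" "u < s" "D u g" for u
    using adaptedD[OF D that(1), of f g] fg that by auto
  obtain u0 where u0: "0 \<le> u0" "u0 < s" "D u0 g" using g unfolding debut_less_iff by blast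
  have le: "debut D f \<le> ereal u" if "0 \<le> u" "D u f" for u unfolding debut_def using that by (intro Inf_lower) auto
  show ?thesis unfolding debut_def[of D g]
  proof (rule Inf_greatest, clarify)
    fix u assume u: "0 \<le> u" "D u g"
    show "debut D f \<le> ereal u"
    proof (cases "u < s")
      case True then show ?thesis using le[OF u(1) DD] u by simp
    next
      case False
      then have "ereal u0 \<le> ereal u" using u0 by simp
      then show ?thesis using le[OF u0(1) DD[OF u0]] order_trans by blast
    qed
  qed
qed

lemma debut_local_eq:
  assumes D: "adapted D" and fg: "\<And>v. 0 \<le> v \<Longrightarrow> v \<le> s \<Longrightarrow> f v = g v"
  shows "debut D f < ereal s \<longleftrightarrow> debut D g < ereal s" "debut D f < ereal s \<Longrightarrow> debut D f = debut D g"
proof -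
  note 1 = debut_local[OF D, of s f g, OF fg] and 2 = debut_local[OF D, of s g f, OF fg[symmetric]]
  show iff: "debut D f < ereal s \<longleftrightarrow> debut D g < ereal s" using 1 2 le_less_trans by blast
  show "debut D f < ereal s \<Longrightarrow> debut D f = debut D g" using 1 2 iff antisym by blast
qed

lemma debut_global_eq:
  assumes D: "adapted D" and fg: "\<And>v. 0 \<le> v \<Longrightarrow> f v = g v"
  shows "debut D f = debut D g"
proof -
  have "D u f = D u g" if "0 \<le> u" for u by (rule adaptedD[OF D that fg])
  then have "{ereal u |u. 0 \<le> u \<and> D u f} = {ereal u |u. 0 \<le> u \<and> D u g}" by blast
  then show ?thesis unfolding debut_def by simp
qed

text \<open>A time strictly before \<open>c\<close> lies in some
  \<open>[0, c - 1 / (n + 1)]\<close>, so the event \<open>debut < c\<close> is a countable union of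
  projections along compact time intervals, each of which the projection theorem places in the
  completion.\<close>

lemma debut_measurable:
  assumes K: "finite_measure K" and g[measurable]: "g \<in> K \<rightarrow>\<^sub>M path_space"
    and D: "Measurable.pred (borel \<Otimes>\<^sub>M path_space) (\<lambda>p. D (fst p) (path (snd p)))"
  shows "(\<lambda>\<omega>. debut D (path (g \<omega>))) \<in> borel_measurable (completion K)"
proof -
  interpret finite_measure K by fact
  have "(\<lambda>p. (fst p, g (snd p))) \<in> borel \<Otimes>\<^sub>M K \<rightarrow>\<^sub>M borel \<Otimes>\<^sub>M path_space" by measurable
  from measurable_compose[OF this D]
  have A: "{p \<in> space (borel \<Otimes>\<^sub>M K). D (fst p) (path (g (snd p)))} \<in> sets (borel \<Otimes>\<^sub>M K)" (is "?A \<in> _")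
    by (simp add: pred_def)
  have less: "{\<omega>\<in>space (completion K). debut D (path (g \<omega>)) < ereal c} \<in> sets (completion K)" for c
  proof -
    have "{\<omega>\<in>space (completion K). debut D (path (g \<omega>)) < ereal c} =
       (\<Union>n::nat. {\<omega>\<in>space K. \<exists>u\<in>{0..c - inverse (real (Suc n))}. (u, \<omega>) \<in> ?A})" (is "?L = ?R")
    proof (intro set_eqI iffI)
      fix \<omega> assume "\<omega> \<in> ?L"
      then obtain u where u: "\<omega> \<in> space K" "0 \<le> u" "u < c" "D u (path (g \<omega>))" by (auto simp: debut_less_iff)
      then obtain n where "inverse (real (Suc n)) < c - u" using reals_Archimedean[of "c - u"] by auto
      then have "u \<in> {0..c - inverse (real (Suc n))}" using u by auto
      moreover have "(u, \<omega>) \<in> ?A" using u by (simp add: space_pair_measure)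
      ultimately show "\<omega> \<in> ?R" using u(1) by blast
    next
      fix \<omega> assume "\<omega> \<in> ?R"
      then obtain n :: nat and u where u: "\<omega> \<in> space K" "u \<in> {0..c - inverse (real (Suc n))}" "(u, \<omega>) \<in> ?A" by blast
      have "0 < inverse (real (Suc n))" by simp
      then have "0 \<le> u" "u < c" using u(2) by (auto simp del: inverse_positive_iff_positive)
      then show "\<omega> \<in> ?L" using u by (auto simp: debut_less_iff)
    qed
    also have "\<dots> \<in> sets (completion K)" by (intro sets.countable_UN) (use measurable_projection[OF A] in blast)
    finally show ?thesis .
  qed
  show ?thesis
  proof (rule borel_measurableI_less)
    fix y :: ereal
    show "{\<omega>\<in>space (completion K). debut D (path (g \<omega>)) < y} \<in> sets (completion K)"
    proof (cases y)
      case PInf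
      have "{\<omega>\<in>space (completion K). debut D (path (g \<omega>)) < \<infinity>} =
         (\<Union>n::nat. {\<omega>\<in>space (completion K). debut D (path (g \<omega>)) < ereal (real n)})"
      proof (intro set_eqI iffI)
        fix \<omega> assume *: "\<omega> \<in> {\<omega>\<in>space (completion K). debut D (path (g \<omega>)) < \<infinity>}"
        then obtain n where "debut D (path (g \<omega>)) \<le> ereal (real n)"
          using debut_finite[of D "path (g \<omega>)"] real_arch_simple[of "real_of_ereal (debut D (path (g \<omega>)))"]
          by (metis (no_types, lifting) ereal_less_eq(3) mem_Collect_eq)
        also have "\<dots> < ereal (real (Suc n))" by simp
        finally show "\<omega> \<in> (\<Union>n::nat. {\<omega>\<in>space (completion K). debut D (path (g \<omega>)) < ereal (real n)})" using * by blast
      next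
        fix \<omega> assume "\<omega> \<in> (\<Union>n::nat. {\<omega>\<in>space (completion K). debut D (path (g \<omega>)) < ereal (real n)})"
        then show "\<omega> \<in> {\<omega>\<in>space (completion K). debut D (path (g \<omega>)) < \<infinity>}" by auto
      qed
      then show ?thesis using less PInf by simp
    qed (use less in auto)
  qed
qed

definition debut_value :: "(real \<Rightarrow> (real \<Rightarrow> real) \<Rightarrow> bool) \<Rightarrow> (real \<Rightarrow> (real \<Rightarrow> real) \<Rightarrow> real) \<Rightarrow> (real \<Rightarrow> real) \<Rightarrow> real" where
  "debut_value D k f = k (real_of_ereal (debut D f)) f"

lemma debut_value_measurable:
  assumes K: "finite_measure K" and g: "g \<in> K \<rightarrow>\<^sub>M path_space"
    and D: "Measurable.pred (borel \<Otimes>\<^sub>M path_space) (\<lambda>p. D (fst p) (path (snd p)))"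
    and k: "(\<lambda>p. k (fst p) (path (snd p))) \<in> borel_measurable (borel \<Otimes>\<^sub>M path_space)"
  shows "(\<lambda>\<omega>. debut_value D k (path (g \<omega>))) \<in> borel_measurable (completion K)"
proof -
  note [measurable] = debut_measurable[OF K g D] measurable_completion[OF g]
  have "(\<lambda>\<omega>. (real_of_ereal (debut D (path (g \<omega>))), g \<omega>)) \<in> completion K \<rightarrow>\<^sub>M borel \<Otimes>\<^sub>M path_space"
    by measurable
  from measurable_compose[OF this k] show ?thesis by (simp add: debut_value_def)
qed

text \<open>A functional measurable only in the completion cannot be pushed through an image measure
  directly; a Borel version that agrees with it almost everywhere both on the path space and along
  \<open>R\<close> can.\<close>

lemma nn_integral_completion_distr:
  assumes R: "R \<in> M \<rightarrow>\<^sub>M S" and f: "f \<in> borel_measurable (completion (distr M S R))"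
  shows "\<exists>g\<in>borel_measurable S. (AE \<omega> in M. f (R \<omega>) = g (R \<omega>)) \<and> (AE x in distr M S R. f x = (g x :: ennreal))"
proof -
  obtain g where g: "g \<in> borel_measurable (distr M S R)" "AE x in distr M S R. f x = g x"
    using completion_ex_borel_measurable[OF f] by blast
  then show ?thesis using AE_distrD[OF R g(2)] by auto
qed

context
  fixes M :: "'a measure" and N :: "'b measure" and \<xi> :: "real \<Rightarrow> 'a \<Rightarrow> real" and \<eta> :: "real \<Rightarrow> 'b \<Rightarrow> real"
    and \<gamma> q :: real and D :: "real \<Rightarrow> (real \<Rightarrow> real) \<Rightarrow> bool" and k :: "real \<Rightarrow> (real \<Rightarrow> real) \<Rightarrow> real"
  assumes \<xi>: "levy_process M \<xi>" and \<eta>: "levy_process N \<eta>"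
    and tilt: "\<And>t. 0 \<le> t \<Longrightarrow> distr N borel (\<eta> t) = distr (density M (\<lambda>\<omega>. ennreal (exp (\<gamma> * \<xi> t \<omega> - q * t)))) borel (\<xi> t)"
    and D: "adapted D" "Measurable.pred (borel \<Otimes>\<^sub>M path_space) (\<lambda>p. D (fst p) (path (snd p)))"
    and k: "adapted k" "(\<lambda>p. k (fst p) (path (snd p))) \<in> borel_measurable (borel \<Otimes>\<^sub>M path_space)"
    and k_nonneg: "\<And>u f. 0 \<le> u \<Longrightarrow> 0 \<le> k u f"
begin

text \<open>The interval is open on the right so that the event \<open>debut D f < b\<close>, and
  with it the whole functional, is decided by the path up to \<open>b\<close>.\<close>

definition debut_block :: "real \<Rightarrow> real \<Rightarrow> (real \<Rightarrow> real) \<Rightarrow> ennreal" where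
  "debut_block a b f = (if ereal a \<le> debut D f \<and> debut D f < ereal b then ennreal (debut_value D k f) else 0)"

lemma debut_value_local:
  assumes fg: "\<And>v. 0 \<le> v \<Longrightarrow> v \<le> s \<Longrightarrow> f v = g v" and less: "debut D f < ereal s"
  shows "debut_value D k f = debut_value D k g"
proof -
  have eq: "debut D f = debut D g" by (rule debut_local_eq(2)[OF D(1) fg less])
  have fin: "ereal (real_of_ereal (debut D f)) = debut D f \<and> 0 \<le> real_of_ereal (debut D f)"
    by (rule debut_finite) (use less in auto)
  then have "real_of_ereal (debut D f) < s" using less by (metis less_ereal.simps(1))
  then show ?thesis unfolding debut_value_def eq[symmetric]
    using fin by (intro adaptedD[OF k(1)] fg) auto
qed

lemma debut_block_local:
  assumes fg: "\<And>v. 0 \<le> v \<Longrightarrow> v \<le> b \<Longrightarrow> f v = g v"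
  shows "debut_block a b f = debut_block a b g"
proof (cases "debut D f < ereal b")
  case True
  have "debut D f = debut D g" by (rule debut_local_eq(2)[OF D(1) fg True])
  then show ?thesis using debut_value_local[OF fg True] by (simp add: debut_block_def)
next
  case False
  then show ?thesis using debut_local_eq(1)[OF D(1) fg] by (simp add: debut_block_def)
qed

lemma debut_block_global:
  assumes fg: "\<And>v. 0 \<le> v \<Longrightarrow> f v = g v"
  shows "debut_block a b f = debut_block a b g"
  by (rule debut_block_local) (rule fg)

lemma debut_block_measurable:
  assumes "finite_measure K" "g \<in> K \<rightarrow>\<^sub>M path_space"
  shows "(\<lambda>\<omega>. debut_block a b (path (g \<omega>))) \<in> borel_measurable (completion K)"
proof -
  note [measurable] = debut_measurable[OF assms D(2)] debut_value_measurable[OF assms D(2) k(2)]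
  show ?thesis unfolding debut_block_def by measurable
qed

lemma stopped_sample_path:
  assumes "levy_process K X" "\<omega> \<in> space K" "0 \<le> v" "v \<le> s"
  shows "path (sample (\<lambda>t. X (min t s) \<omega>)) v = X v \<omega>"
proof -
  have "cadlag_in UNIV (\<lambda>t. X (min t s) \<omega>)"
    by (rule cadlag_in_stopped[OF levy_cadlag[OF assms(1,2)]]) (use assms in auto)
  from path_sample[OF assms(3) cadlag_in_right[OF this assms(3)]] show ?thesis using assms(4) by (simp add: min_absorb1)
qed

text \<open>The block functional sees only the path stopped at \<open>b\<close>, and the laws of the
  two stopped paths are related by the density at the fixed time \<open>b\<close>. The transfer goes
  through a Borel version on the path space.\<close>

lemma debut_block_tilt:
  assumes "0 \<le> b"
  shows "(\<integral>\<^sup>+\<omega>. debut_block a b (\<lambda>t. \<eta> t \<omega>) \<partial>N) =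
     (\<integral>\<^sup>+\<omega>. ennreal (exp (\<gamma> * \<xi> b \<omega> - q * b)) * debut_block a b (\<lambda>t. \<xi> t \<omega>) \<partial>M)"
proof -
  interpret N: prob_space N by (rule levy_prob_space[OF \<eta>])
  let ?R = "\<lambda>\<omega>. sample (\<lambda>t. \<eta> (min t b) \<omega>)" and ?Q = "\<lambda>\<omega>. sample (\<lambda>t. \<xi> (min t b) \<omega>)"
  let ?L = "\<lambda>\<omega>. ennreal (exp (\<gamma> * \<xi> b \<omega> - q * b))"
  have R[measurable]: "?R \<in> N \<rightarrow>\<^sub>M path_space" by (rule levy_sample_measurable(1)[OF \<eta> assms])
  have Q[measurable]: "?Q \<in> M \<rightarrow>\<^sub>M path_space" by (rule levy_sample_measurable(1)[OF \<xi> assms])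
  have [measurable]: "\<xi> b \<in> borel_measurable M" by (rule levy_measurable[OF \<xi> assms])
  have law: "distr N path_space ?R = distr (density M ?L) path_space ?Q" by (rule levy_path_law[OF \<xi> \<eta> tilt assms])
  have fin: "finite_measure (distr N path_space ?R)"
    by (rule prob_space.finite_measure, rule N.prob_space_distr) measurable
  have "(\<lambda>y. debut_block a b (path y)) \<in> borel_measurable (completion (distr N path_space ?R))"
    by (rule debut_block_measurable[OF fin]) simp
  from nn_integral_completion_distr[OF R this]
  obtain g where g[measurable]: "g \<in> borel_measurable path_space" and g1: "AE \<omega> in N. debut_block a b (path (?R \<omega>)) = g (?R \<omega>)"
    and g2: "AE y in distr N path_space ?R. debut_block a b (path y) = g y" by blast
  have "(\<integral>\<^sup>+\<omega>. debut_block a b (\<lambda>t. \<eta> t \<omega>) \<partial>N) = (\<integral>\<^sup>+\<omega>. g (?R \<omega>) \<partial>N)" (is "nn_integral _ ?l = nn_integral _ ?r")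
  proof (rule nn_integral_cong_AE)
    show "AE \<omega> in N. ?l \<omega> = ?r \<omega>"
      using g1 AE_space
    proof eventually_elim
      case (elim \<omega>)
      have "debut_block a b (path (?R \<omega>)) = debut_block a b (\<lambda>t. \<eta> t \<omega>)"
        by (rule debut_block_local) (rule stopped_sample_path[OF \<eta> elim(2)])
      then show ?case using elim(1) by simp
    qed
  qed
  also have "\<dots> = (\<integral>\<^sup>+y. g y \<partial>distr N path_space ?R)" by (rule nn_integral_distr[symmetric]) measurable
  also have "\<dots> = (\<integral>\<^sup>+\<omega>. g (?Q \<omega>) \<partial>density M ?L)" unfolding law by (rule nn_integral_distr) measurable
  also have "\<dots> = (\<integral>\<^sup>+\<omega>. ?L \<omega> * g (?Q \<omega>) \<partial>M)" by (rule nn_integral_density) measurable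
  also have "\<dots> = (\<integral>\<^sup>+\<omega>. ?L \<omega> * debut_block a b (\<lambda>t. \<xi> t \<omega>) \<partial>M)"
  proof (rule nn_integral_cong_AE)
    have Q': "?Q \<in> density M ?L \<rightarrow>\<^sub>M path_space" by measurable
    \<comment> \<open>The exceptional set is null for the tilted measure; since the density is
      positive everywhere, it is null for \<open>M\<close> too.\<close>
    have "AE \<omega> in density M ?L. debut_block a b (path (?Q \<omega>)) = g (?Q \<omega>)"
      using AE_distrD[OF Q' g2[unfolded law]] .
    then have "AE \<omega> in M. debut_block a b (path (?Q \<omega>)) = g (?Q \<omega>)"
      by (subst (asm) AE_density) auto
    then show "AE \<omega> in M. ?L \<omega> * g (?Q \<omega>) = ?L \<omega> * debut_block a b (\<lambda>t. \<xi> t \<omega>)"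
      using AE_space
    proof eventually_elim
      case (elim \<omega>)
      have "debut_block a b (path (?Q \<omega>)) = debut_block a b (\<lambda>t. \<xi> t \<omega>)"
        by (rule debut_block_local) (rule stopped_sample_path[OF \<xi> elim(2)])
      then show ?case using elim(1) by simp
    qed
  qed
  finally show ?thesis .
qed

text \<open>The dyadic blocks partition \<open>[0, \<infinity>)\<close>, so a finite debut selects
  one index. The weight \<open>F\<close> will be the density at the right end of the block for
  \<open>\<xi>\<close>, and 1 for \<open>\<eta>\<close>.\<close>

lemma dyadic_block_suminf:
  fixes F :: "nat \<Rightarrow> ennreal"
  shows "(\<Sum>m. F m * debut_block (real m / 2 ^ n) ((real m + 1) / 2 ^ n) f) =
    (if debut D f < \<infinity> then F (nat \<lfloor>2 ^ n * real_of_ereal (debut D f)\<rfloor>) * ennreal (debut_value D k f) else 0)"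
proof (cases "debut D f < \<infinity>")
  case True
  define T where "T = real_of_ereal (debut D f)"
  have T: "debut D f = ereal T" "0 \<le> T" using debut_finite[OF True] by (auto simp: T_def)
  define i where "i = nat \<lfloor>2 ^ n * T\<rfloor>"
  have "real m / 2 ^ n \<le> T \<and> T < (real m + 1) / 2 ^ n \<longleftrightarrow> m = i" for m
  proof -
    have "real m / 2 ^ n \<le> T \<and> T < (real m + 1) / 2 ^ n \<longleftrightarrow> real m \<le> 2 ^ n * T \<and> 2 ^ n * T < real m + 1"
      by (simp add: field_simps)
    also have "\<dots> \<longleftrightarrow> \<lfloor>2 ^ n * T\<rfloor> = int m" by (simp add: floor_eq_iff)
    also have "\<dots> \<longleftrightarrow> m = i" using T(2) by (auto simp: i_def)
    finally show ?thesis .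
  qed
  then have "F m * debut_block (real m / 2 ^ n) ((real m + 1) / 2 ^ n) f = (if m = i then F m * ennreal (debut_value D k f) else 0)" for m
    by (simp add: debut_block_def T(1))
  then have "(\<Sum>m. F m * debut_block (real m / 2 ^ n) ((real m + 1) / 2 ^ n) f) = F i * ennreal (debut_value D k f)"
    using sums_single[of i "\<lambda>m. F m * ennreal (debut_value D k f)"] by (simp add: sums_iff)
  then show ?thesis using True by (simp add: i_def T_def)
next
  case False
  then have "debut_block a b f = 0" for a b by (auto simp: debut_block_def)
  then show ?thesis using False by simp
qed

lemma debut_integrand_measurable:
  "(\<lambda>\<omega>. if debut D (\<lambda>t. \<eta> t \<omega>) < \<infinity> then ennreal (debut_value D k (\<lambda>t. \<eta> t \<omega>)) else 0) \<in> borel_measurable (completion N)"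
proof -
  have fin: "finite_measure N" using levy_prob_space[OF \<eta>] by (rule prob_space.finite_measure)
  have g: "(\<lambda>\<omega>. sample (\<lambda>t. \<eta> t \<omega>)) \<in> N \<rightarrow>\<^sub>M path_space" by (rule levy_sample_measurable(2)[OF \<eta> order_refl])
  note [measurable] = debut_measurable[OF fin g D(2)] debut_value_measurable[OF fin g D(2) k(2)]
  have "(\<lambda>\<omega>. if debut D (path (sample (\<lambda>t. \<eta> t \<omega>))) < \<infinity> then ennreal (debut_value D k (path (sample (\<lambda>t. \<eta> t \<omega>)))) else 0) \<in> borel_measurable (completion N)"
    by measurable
  then show ?thesis
  proof (rule measurable_cong[THEN iffD1, rotated])
    fix \<omega> assume "\<omega> \<in> space (completion N)"
    then have eq: "path (sample (\<lambda>t. \<eta> t \<omega>)) v = \<eta> v \<omega>" if "0 \<le> v" for v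
      using path_sample[OF that cadlag_in_right[OF levy_cadlag[OF \<eta>] that]] by simp
    have "debut D (path (sample (\<lambda>t. \<eta> t \<omega>))) = debut D (\<lambda>t. \<eta> t \<omega>)"
      by (rule debut_global_eq[OF D(1) eq])
    moreover have "debut_value D k (path (sample (\<lambda>t. \<eta> t \<omega>))) = debut_value D k (\<lambda>t. \<eta> t \<omega>)" if "debut D (\<lambda>t. \<eta> t \<omega>) < \<infinity>"
      unfolding debut_value_def calculation using debut_finite[OF that] by (intro adaptedD[OF k(1)] eq) auto
    ultimately show "(if debut D (path (sample (\<lambda>t. \<eta> t \<omega>))) < \<infinity> then ennreal (debut_value D k (path (sample (\<lambda>t. \<eta> t \<omega>)))) else 0) =
      (if debut D (\<lambda>t. \<eta> t \<omega>) < \<infinity> then ennreal (debut_value D k (\<lambda>t. \<eta> t \<omega>)) else 0)"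
      by auto
  qed
qed

text \<open>The tilt is exact on each event \<open>{i \<le> 2\<^sup>n T < i + 1}\<close>, which is determined by the path up to the
  right endpoint, with density evaluated there.  As \<open>n \<rightarrow> \<infinity>\<close> the endpoints decrease to \<open>T\<close>, and
  Fatou's lemma gives one inequality.\<close>

lemma debut_tilt_le:
  "(\<integral>\<^sup>+\<omega>. (if debut D (\<lambda>t. \<xi> t \<omega>) < \<infinity> then
       ennreal (exp (\<gamma> * \<xi> (real_of_ereal (debut D (\<lambda>t. \<xi> t \<omega>))) \<omega> - q * real_of_ereal (debut D (\<lambda>t. \<xi> t \<omega>))) * debut_value D k (\<lambda>t. \<xi> t \<omega>)) else 0) \<partial>M)
   \<le> (\<integral>\<^sup>+\<omega>. (if debut D (\<lambda>t. \<eta> t \<omega>) < \<infinity> then ennreal (debut_value D k (\<lambda>t. \<eta> t \<omega>)) else 0) \<partial>N)"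
  (is "?lhs \<le> ?rhs")
proof -
  interpret M: prob_space M by (rule levy_prob_space[OF \<xi>])
  interpret N: prob_space N by (rule levy_prob_space[OF \<eta>])
  have path_eq: "path (sample (\<lambda>t. X t \<omega>)) v = X v \<omega>" if "levy_process K X" "\<omega> \<in> space K" "0 \<le> v" for K :: "'z measure" and X \<omega> v
    by (rule path_sample[OF that(3) cadlag_in_right[OF levy_cadlag[OF that(1,2)] that(3)]])
  have block_meas: "(\<lambda>\<omega>. debut_block a b (\<lambda>t. X t \<omega>)) \<in> borel_measurable (completion K)"
    if X: "levy_process K X" for K :: "'z measure" and X a b
  proof -
    have fin: "finite_measure K" using levy_prob_space[OF X] by (rule prob_space.finite_measure)
    have "(\<lambda>\<omega>. debut_block a b (path (sample (\<lambda>t. X t \<omega>)))) \<in> borel_measurable (completion K)"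
      by (rule debut_block_measurable[OF fin levy_sample_measurable(2)[OF X order_refl]])
    then show ?thesis
      by (rule measurable_cong[THEN iffD1, rotated])
        (rule debut_block_global, rule path_eq[OF X], auto)
  qed
  let ?T = "\<lambda>\<omega>. real_of_ereal (debut D (\<lambda>t. \<xi> t \<omega>))"
  let ?L = "\<lambda>t \<omega>. ennreal (exp (\<gamma> * \<xi> t \<omega> - q * t))"
  \<comment> \<open>The density is evaluated at the right end of the dyadic block containing the
    debut, a random time with countably many values; the functional itself stays at the
    debut.\<close>
  define F where "F n \<omega> = (if debut D (\<lambda>t. \<xi> t \<omega>) < \<infinity> then ?L (dyadic_above n (?T \<omega>)) \<omega> * ennreal (debut_value D k (\<lambda>t. \<xi> t \<omega>)) else 0)" for n \<omega>
  have F_sum: "F n \<omega> = (\<Sum>m. ?L ((real m + 1) / 2 ^ n) \<omega> * debut_block (real m / 2 ^ n) ((real m + 1) / 2 ^ n) (\<lambda>t. \<xi> t \<omega>))" for n \<omega>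
    unfolding dyadic_block_suminf F_def dyadic_above_def ..
  have term_meas: "(\<lambda>\<omega>. ?L ((real m + 1) / 2 ^ n) \<omega> * debut_block (real m / 2 ^ n) ((real m + 1) / 2 ^ n) (\<lambda>t. \<xi> t \<omega>)) \<in> borel_measurable (completion M)" for m n
  proof -
    have "\<xi> ((real m + 1) / 2 ^ n) \<in> borel_measurable M" by (rule levy_measurable[OF \<xi>]) simp
    note [measurable] = measurable_completion[OF this] block_meas[OF \<xi>]
    show ?thesis by measurable
  qed
  have F_meas: "F n \<in> borel_measurable (completion M)" for n
    unfolding F_sum[abs_def] using term_meas by measurable
  \<comment> \<open>Level \<open>n\<close> introduces no error, so the integrals form a constant
    sequence and their limit inferior is the integral under \<open>\<eta>\<close>.\<close>
  have F_int: "(\<integral>\<^sup>+\<omega>. F n \<omega> \<partial>M) = ?rhs" for n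
  proof -
    have "(\<integral>\<^sup>+\<omega>. F n \<omega> \<partial>M) = (\<integral>\<^sup>+\<omega>. F n \<omega> \<partial>completion M)" by (rule nn_integral_completion[symmetric])
    also have "\<dots> = (\<Sum>m. \<integral>\<^sup>+\<omega>. ?L ((real m + 1) / 2 ^ n) \<omega> * debut_block (real m / 2 ^ n) ((real m + 1) / 2 ^ n) (\<lambda>t. \<xi> t \<omega>) \<partial>completion M)"
      unfolding F_sum by (rule nn_integral_suminf) (rule term_meas)
    also have "\<dots> = (\<Sum>m. \<integral>\<^sup>+\<omega>. debut_block (real m / 2 ^ n) ((real m + 1) / 2 ^ n) (\<lambda>t. \<eta> t \<omega>) \<partial>completion N)"
      unfolding nn_integral_completion by (intro suminf_cong debut_block_tilt[symmetric]) simp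
    also have "\<dots> = (\<integral>\<^sup>+\<omega>. (\<Sum>m. debut_block (real m / 2 ^ n) ((real m + 1) / 2 ^ n) (\<lambda>t. \<eta> t \<omega>)) \<partial>completion N)"
      by (rule nn_integral_suminf[symmetric]) (rule block_meas[OF \<eta>])
    also have "\<dots> = ?rhs" unfolding nn_integral_completion
      by (simp only: dyadic_block_suminf[of "\<lambda>_. 1" n, unfolded mult_1])
    finally show ?thesis .
  qed
  have "?lhs = (\<integral>\<^sup>+\<omega>. liminf (\<lambda>n. F n \<omega>) \<partial>M)"
  proof (rule nn_integral_cong)
    fix \<omega> assume \<omega>: "\<omega> \<in> space M"
    show "(if debut D (\<lambda>t. \<xi> t \<omega>) < \<infinity> then
       ennreal (exp (\<gamma> * \<xi> (?T \<omega>) \<omega> - q * ?T \<omega>) * debut_value D k (\<lambda>t. \<xi> t \<omega>)) else 0) = liminf (\<lambda>n. F n \<omega>)"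
    proof (cases "debut D (\<lambda>t. \<xi> t \<omega>) < \<infinity>")
      case True
      have T: "0 \<le> ?T \<omega>" using debut_finite[OF True] by simp
      have v: "0 \<le> debut_value D k (\<lambda>t. \<xi> t \<omega>)" unfolding debut_value_def by (rule k_nonneg[OF T])
      have "(\<lambda>n. \<xi> (dyadic_above n (?T \<omega>)) \<omega>) \<longlonglongrightarrow> \<xi> (?T \<omega>) \<omega>"
        by (rule continuous_at_right_dyadic[OF T cadlag_in_right[OF levy_cadlag[OF \<xi> \<omega>] T]])
      then have "(\<lambda>n. exp (\<gamma> * \<xi> (dyadic_above n (?T \<omega>)) \<omega> - q * dyadic_above n (?T \<omega>)) * debut_value D k (\<lambda>t. \<xi> t \<omega>))
         \<longlonglongrightarrow> exp (\<gamma> * \<xi> (?T \<omega>) \<omega> - q * ?T \<omega>) * debut_value D k (\<lambda>t. \<xi> t \<omega>)"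
        by (intro tendsto_intros dyadic_above_tendsto T)
      from tendsto_ennrealI[OF this]
      have "(\<lambda>n. F n \<omega>) \<longlonglongrightarrow> ennreal (exp (\<gamma> * \<xi> (?T \<omega>) \<omega> - q * ?T \<omega>) * debut_value D k (\<lambda>t. \<xi> t \<omega>))"
        using True v by (simp add: F_def ennreal_mult)
      from lim_imp_Liminf[OF _ this] show ?thesis using True by simp
    next
      case False
      then have "F n \<omega> = 0" for n by (simp add: F_def)
      then show ?thesis using False by (simp add: Liminf_const)
    qed
  qed
  also have "\<dots> = (\<integral>\<^sup>+\<omega>. liminf (\<lambda>n. F n \<omega>) \<partial>completion M)" by (rule nn_integral_completion[symmetric])
  also have "\<dots> \<le> liminf (\<lambda>n. \<integral>\<^sup>+\<omega>. F n \<omega> \<partial>completion M)" by (rule nn_integral_liminf) (rule F_meas)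
  also have "\<dots> = ?rhs" unfolding nn_integral_completion F_int by (simp add: Liminf_const)
  finally show ?thesis .
qed

end

text \<open>The density is positive and a function of \<open>\<xi> t\<close> alone, so at a fixed
  time it can be divided out after passing to the image law.\<close>

lemma tilt_inverse:
  assumes \<xi>: "levy_process M \<xi>" and \<eta>: "levy_process N \<eta>" and t: "0 \<le> t"
    and tilt: "distr N borel (\<eta> t) = distr (density M (\<lambda>\<omega>. ennreal (exp (\<gamma> * \<xi> t \<omega> - q * t)))) borel (\<xi> t)"
  shows "distr M borel (\<xi> t) = distr (density N (\<lambda>\<omega>. ennreal (exp ((- \<gamma>) * \<eta> t \<omega> - (- q) * t)))) borel (\<eta> t)"
proof (rule measure_eqI)
  fix A assume "A \<in> sets (distr M borel (\<xi> t))"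
  then have A[measurable]: "A \<in> sets borel" by simp
  have [measurable]: "\<xi> t \<in> borel_measurable M" "\<eta> t \<in> borel_measurable N" using levy_measurable \<xi> \<eta> t by auto
  let ?g = "\<lambda>y. ennreal (exp ((- \<gamma>) * y - (- q) * t)) * indicator A y"
  have "emeasure (distr (density N (\<lambda>\<omega>. ennreal (exp ((- \<gamma>) * \<eta> t \<omega> - (- q) * t)))) borel (\<eta> t)) A =
     emeasure (density N (\<lambda>\<omega>. ennreal (exp ((- \<gamma>) * \<eta> t \<omega> - (- q) * t)))) (\<eta> t -` A \<inter> space N)"
    by (subst emeasure_distr) auto
  also have "\<dots> = (\<integral>\<^sup>+\<omega>. ?g (\<eta> t \<omega>) \<partial>N)"
    by (subst emeasure_density) (auto intro!: nn_integral_cong simp: indicator_def)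
  also have "\<dots> = (\<integral>\<^sup>+y. ?g y \<partial>distr N borel (\<eta> t))" by (rule nn_integral_distr[symmetric]) measurable
  also have "\<dots> = (\<integral>\<^sup>+\<omega>. ?g (\<xi> t \<omega>) \<partial>density M (\<lambda>\<omega>. ennreal (exp (\<gamma> * \<xi> t \<omega> - q * t))))"
    unfolding tilt by (rule nn_integral_distr) measurable
  also have "\<dots> = (\<integral>\<^sup>+\<omega>. ennreal (exp (\<gamma> * \<xi> t \<omega> - q * t)) * ?g (\<xi> t \<omega>) \<partial>M)"
    by (rule nn_integral_density) measurable
  also have "\<dots> = (\<integral>\<^sup>+\<omega>. indicator (\<xi> t -` A \<inter> space M) \<omega> \<partial>M)"
    by (rule nn_integral_cong)
      (auto simp: indicator_def ennreal_mult[symmetric] exp_add[symmetric] mult.assoc[symmetric])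
  also have "\<dots> = emeasure (distr M borel (\<xi> t)) A"
    by (subst nn_integral_indicator) (auto simp: emeasure_distr)
  finally show "emeasure (distr M borel (\<xi> t)) A = emeasure (distr (density N (\<lambda>\<omega>. ennreal (exp ((- \<gamma>) * \<eta> t \<omega> - (- q) * t)))) borel (\<eta> t)) A"
    by simp
qed simp

text \<open>The relation between \<open>\<xi>\<close> and \<open>\<eta>\<close> is symmetric, with \<open>(\<gamma>, q)\<close> replaced by \<open>(-\<gamma>, -q)\<close>, so that
  Fatou's lemma yields the opposite inequality as well.\<close>

lemma debut_tilt:
  assumes \<xi>: "levy_process M \<xi>" and \<eta>: "levy_process N \<eta>"
    and tilt: "\<And>t. 0 \<le> t \<Longrightarrow> distr N borel (\<eta> t) = distr (density M (\<lambda>\<omega>. ennreal (exp (\<gamma> * \<xi> t \<omega> - q * t)))) borel (\<xi> t)"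
    and D: "adapted D" "Measurable.pred (borel \<Otimes>\<^sub>M path_space) (\<lambda>p. D (fst p) (path (snd p)))"
    and k: "adapted k" "(\<lambda>p. k (fst p) (path (snd p))) \<in> borel_measurable (borel \<Otimes>\<^sub>M path_space)"
    and k_nonneg: "\<And>u f. 0 \<le> u \<Longrightarrow> 0 \<le> k u f"
  shows "(\<integral>\<^sup>+\<omega>. (if debut D (\<lambda>t. \<xi> t \<omega>) < \<infinity> then
       ennreal (exp (\<gamma> * \<xi> (real_of_ereal (debut D (\<lambda>t. \<xi> t \<omega>))) \<omega> - q * real_of_ereal (debut D (\<lambda>t. \<xi> t \<omega>))) * debut_value D k (\<lambda>t. \<xi> t \<omega>)) else 0) \<partial>M)
   = (\<integral>\<^sup>+\<omega>. (if debut D (\<lambda>t. \<eta> t \<omega>) < \<infinity> then ennreal (debut_value D k (\<lambda>t. \<eta> t \<omega>)) else 0) \<partial>N)"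
proof (rule antisym)
  \<comment> \<open>The reverse tilt is applied to \<open>k\<close> already multiplied by the
    forward density; at the debut the two densities cancel and leave \<open>k\<close>.\<close>
  let ?k = "\<lambda>u f. exp (\<gamma> * f u - q * u) * k u f"
  have k': "adapted ?k" unfolding adapted_def
  proof (intro allI impI)
    fix u :: real and f g :: "real \<Rightarrow> real" assume u: "0 \<le> u" and fg: "\<forall>v. 0 \<le> v \<longrightarrow> v \<le> u \<longrightarrow> f v = g v"
    show "?k u f = ?k u g" using adaptedD[OF k(1) u, of f g] fg u by simp
  qed
  have k'm: "(\<lambda>p. ?k (fst p) (path (snd p))) \<in> borel_measurable (borel \<Otimes>\<^sub>M path_space)"
    using k(2) by measurable
  have cancel: "exp ((- \<gamma>) * a - (- q) * b) * (exp (\<gamma> * a - q * b) * c) = c" for a b c :: real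
    by (simp add: exp_add[symmetric] mult.assoc[symmetric])
  show "(\<integral>\<^sup>+\<omega>. (if debut D (\<lambda>t. \<eta> t \<omega>) < \<infinity> then ennreal (debut_value D k (\<lambda>t. \<eta> t \<omega>)) else 0) \<partial>N) \<le>
    (\<integral>\<^sup>+\<omega>. (if debut D (\<lambda>t. \<xi> t \<omega>) < \<infinity> then
       ennreal (exp (\<gamma> * \<xi> (real_of_ereal (debut D (\<lambda>t. \<xi> t \<omega>))) \<omega> - q * real_of_ereal (debut D (\<lambda>t. \<xi> t \<omega>))) * debut_value D k (\<lambda>t. \<xi> t \<omega>)) else 0) \<partial>M)"
    using debut_tilt_le[OF \<eta> \<xi> tilt_inverse[OF \<xi> \<eta> _ tilt] D k' k'm] k_nonneg
    by (simp only: debut_value_def cancel) simp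
  show "(\<integral>\<^sup>+\<omega>. (if debut D (\<lambda>t. \<xi> t \<omega>) < \<infinity> then
       ennreal (exp (\<gamma> * \<xi> (real_of_ereal (debut D (\<lambda>t. \<xi> t \<omega>))) \<omega> - q * real_of_ereal (debut D (\<lambda>t. \<xi> t \<omega>))) * debut_value D k (\<lambda>t. \<xi> t \<omega>)) else 0) \<partial>M)
    \<le> (\<integral>\<^sup>+\<omega>. (if debut D (\<lambda>t. \<eta> t \<omega>) < \<infinity> then ennreal (debut_value D k (\<lambda>t. \<eta> t \<omega>)) else 0) \<partial>N)"
    by (rule debut_tilt_le[OF \<xi> \<eta> tilt D k k_nonneg])
qed

section \<open>The semi-stable Ornstein-Uhlenbeck process\<close>

lemma exit_time_cong:
  assumes "\<And>t. 0 \<le> t \<Longrightarrow> f t \<in> A \<longleftrightarrow> g t \<in> B"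
  shows "exit_time A f = exit_time B g"
proof -
  have "{ereal t |t. 0 \<le> t \<and> f t \<notin> A} = {ereal t |t. 0 \<le> t \<and> g t \<notin> B}" using assms by auto
  then show ?thesis unfolding exit_time_def by simp
qed

lemma exit_time_finite:
  assumes "exit_time B f < \<infinity>" shows "0 \<le> real_of_ereal (exit_time B f)"
proof -
  have "0 \<le> exit_time B f" unfolding exit_time_def by (rule Inf_greatest) auto
  then show ?thesis by (rule real_of_ereal_pos)
qed

lemma cadlag_in_add_const:
  assumes "cadlag_in UNIV f" shows "cadlag_in UNIV (\<lambda>t. c + f t)"
  unfolding cadlag_in_def
proof (intro conjI allI impI)
  fix t :: real assume "0 \<le> t"
  from cadlag_in_right[OF assms this] show "continuous (at_right t) (\<lambda>t. c + f t)"
    by (intro continuous_intros)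
next
  fix t :: real assume "0 < t"
  then obtain l where "(f \<longlongrightarrow> l) (at_left t)" using assms unfolding cadlag_in_def by blast
  then have "((\<lambda>t. c + f t) \<longlongrightarrow> c + l) (at_left t)" by (intro tendsto_intros)
  then show "\<exists>l\<in>UNIV. ((\<lambda>t. c + f t) \<longlongrightarrow> l) (at_left t)" by blast
qed simp

text \<open>In the recurrent case the extension follows the Lamperti path up to its first zero and
  does not jump into 0, which brings it to the same description as the killed path.\<close>

lemma semistable_OU_time_changed:
  assumes \<alpha>: "0 < \<alpha>" and lam: "0 < lam" and \<xi>: "levy_process M \<xi>" and U: "semistable_OU M \<alpha> lam \<xi> x U"
  shows "AE \<omega> in M. time_changed_path \<alpha> lam (\<lambda>s. ln x + \<xi> s \<omega>) (\<lambda>s. U s \<omega>)"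
proof -
  obtain X where X: "semistable_process M \<alpha> \<xi> x X"
    and UX: "\<And>\<omega> t. \<omega> \<in> space M \<Longrightarrow> 0 \<le> t \<Longrightarrow> U t \<omega> = OU_transform \<alpha> lam (\<lambda>s. X s \<omega>) t"
    using U unfolding semistable_OU_def by blast
  have f: "cadlag_in UNIV (\<lambda>s. ln x + \<xi> s \<omega>)" if "\<omega> \<in> space M" for \<omega>
    by (rule cadlag_in_add_const[OF levy_cadlag[OF \<xi> that]])
  show ?thesis
  proof (cases "recurrent_case M \<alpha> \<xi>")
    case True
    then have rec: "recurrent_extension M \<alpha> \<xi> x X" using X unfolding semistable_process_def by simp
    have 1: "AE \<omega> in M. \<forall>t\<ge>0. ereal t \<le> hit_zero (\<lambda>s. lamperti_process \<alpha> \<xi> x s \<omega>) \<longrightarrow> X t \<omega> = lamperti_process \<alpha> \<xi> x t \<omega>"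
      and 2: "AE \<omega> in M. \<forall>t>0. X t \<omega> = 0 \<longleftrightarrow> ((\<lambda>s. X s \<omega>) \<longlongrightarrow> 0) (at_left t)"
      using rec unfolding recurrent_extension_def by blast+
    show ?thesis
      using 1 2 AE_space
    proof eventually_elim
      case (elim \<omega>)
      have eq: "(\<lambda>s. lamperti_process \<alpha> \<xi> x s \<omega>) = lamperti \<alpha> (\<lambda>s. ln x + \<xi> s \<omega>)"
        by (simp add: lamperti_process_def fun_eq_iff)
      show ?case
      proof (rule time_changed_path_recurrent[OF \<alpha> lam f[OF elim(3)]])
        show "X t \<omega> = lamperti \<alpha> (\<lambda>s. ln x + \<xi> s \<omega>) t"
          if "0 \<le> t" "ereal t \<le> hit_zero (lamperti \<alpha> (\<lambda>s. ln x + \<xi> s \<omega>))" for t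
          using elim(1) that unfolding eq by (simp add: lamperti_process_def)
        show "((\<lambda>s. X s \<omega>) \<longlongrightarrow> 0) (at_left t)" if "0 < t" "X t \<omega> = 0" for t
          using elim(2) that by blast
      qed (rule UX[OF elim(3)])
    qed
  next
    case False
    then have "AE \<omega> in M. \<forall>t\<ge>0. X t \<omega> = lamperti_process \<alpha> \<xi> x t \<omega>" using X unfolding semistable_process_def by simp
    then show ?thesis
      using AE_space
    proof eventually_elim
      case (elim \<omega>)
      show ?case
      proof (rule time_changed_path_lamperti[OF \<alpha> lam f[OF elim(2)]])
        show "X t \<omega> = lamperti \<alpha> (\<lambda>s. ln x + \<xi> s \<omega>) t" if "0 \<le> t" for t
          using elim(1) that by (simp add: lamperti_process_def)
      qed (rule UX[OF elim(2)])
    qed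
  qed
qed

text \<open>\<open>lamperti_A\<close> is an infimum over uncountably many times; since
  \<open>lamperti_V\<close> increases strictly, a witness can always be moved right to a rational
  one.\<close>

lemma lamperti_process_measurable:
  assumes \<alpha>: "0 < \<alpha>" and \<xi>: "levy_process M \<xi>"
  shows "lamperti_process \<alpha> \<xi> x t \<in> borel_measurable M"
proof -
  let ?f = "\<lambda>\<omega> s. ln x + \<xi> s \<omega>"
  define g where "g \<omega> = sample (?f \<omega>)" for \<omega>
  have g[measurable]: "g \<in> M \<rightarrow>\<^sub>M path_space" unfolding g_def
    by (rule sample_measurable) (use levy_measurable[OF \<xi>] in measurable)
  have f: "cadlag_in UNIV (?f \<omega>)" if "\<omega> \<in> space M" for \<omega>
    by (rule cadlag_in_add_const[OF levy_cadlag[OF \<xi> that]])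
  have p: "path (g \<omega>) s = ?f \<omega> s" if "\<omega> \<in> space M" "0 \<le> s" for \<omega> s
    unfolding g_def by (rule path_sample[OF that(2) cadlag_in_right[OF f[OF that(1)] that(2)]])
  have V: "lamperti_V \<alpha> (path (g \<omega>)) u = lamperti_V \<alpha> (?f \<omega>) u" if "\<omega> \<in> space M" for \<omega> u
    by (rule lamperti_V_cong) (rule p[OF that])
  have less: "lamperti_A \<alpha> (?f \<omega>) t < y \<longleftrightarrow> (\<exists>u\<in>\<rat>. 0 \<le> u \<and> ereal u < y \<and> t < lamperti_V \<alpha> (?f \<omega>) u)"
    if \<omega>: "\<omega> \<in> space M" for \<omega> y
  proof
    assume "lamperti_A \<alpha> (?f \<omega>) t < y"
    then obtain u where u: "0 \<le> u" "ereal u < y" "t < lamperti_V \<alpha> (?f \<omega>) u"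
      unfolding lamperti_A_def Inf_less_iff by auto
    obtain z where z: "u < z" "ereal z < y" using ereal_dense2[OF u(2)] by auto
    obtain r where r: "r \<in> \<rat>" "u < r" "r < z" using Rats_dense_in_real[OF z(1)] by blast
    have "lamperti_V \<alpha> (?f \<omega>) u < lamperti_V \<alpha> (?f \<omega>) r"
      by (rule lamperti_V_strict[OF \<alpha> \<alpha> f[OF \<omega>] u(1) r(2)])
    moreover have "ereal r < y" using r(3) z(2) by (meson less_ereal.simps(1) less_trans)
    ultimately show "\<exists>u\<in>\<rat>. 0 \<le> u \<and> ereal u < y \<and> t < lamperti_V \<alpha> (?f \<omega>) u"
      using r u by (intro bexI[of _ r]) auto
  next
    assume "\<exists>u\<in>\<rat>. 0 \<le> u \<and> ereal u < y \<and> t < lamperti_V \<alpha> (?f \<omega>) u"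
    then show "lamperti_A \<alpha> (?f \<omega>) t < y" unfolding lamperti_A_def Inf_less_iff by blast
  qed
  have A[measurable]: "(\<lambda>\<omega>. lamperti_A \<alpha> (?f \<omega>) t) \<in> borel_measurable M"
  proof (rule borel_measurableI_less)
    fix y :: ereal
    have "{\<omega>\<in>space M. lamperti_A \<alpha> (?f \<omega>) t < y} =
      (\<Union>u\<in>{u\<in>\<rat>. 0 \<le> u \<and> ereal u < y}. {\<omega>\<in>space M. t < lamperti_V \<alpha> (path (g \<omega>)) u})"
      using less V by auto
    also have "\<dots> \<in> sets M"
      by (intro sets.countable_UN'' countable_subset[OF _ countable_rat]) auto
    finally show "{\<omega>\<in>space M. lamperti_A \<alpha> (?f \<omega>) t < y} \<in> sets M" .
  qed
  have "lamperti_process \<alpha> \<xi> x t \<in> borel_measurable M \<longleftrightarrow>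
    (\<lambda>\<omega>. if lamperti_A \<alpha> (?f \<omega>) t = \<infinity> then 0 else exp (path (g \<omega>) (real_of_ereal (lamperti_A \<alpha> (?f \<omega>) t)))) \<in> borel_measurable M"
  proof (rule measurable_cong)
    fix \<omega> assume \<omega>: "\<omega> \<in> space M"
    have "0 \<le> lamperti_A \<alpha> (?f \<omega>) t" unfolding lamperti_A_def by (rule Inf_greatest) auto
    then have "0 \<le> real_of_ereal (lamperti_A \<alpha> (?f \<omega>) t)" by (rule real_of_ereal_pos)
    then show "lamperti_process \<alpha> \<xi> x t \<omega> = (if lamperti_A \<alpha> (?f \<omega>) t = \<infinity> then 0 else exp (path (g \<omega>) (real_of_ereal (lamperti_A \<alpha> (?f \<omega>) t))))"
      using p[OF \<omega>] by (simp add: lamperti_process_def lamperti_def)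
  qed
  also have "\<dots>" by measurable
  finally show ?thesis .
qed

lemma semistable_OU_exists:
  assumes \<alpha>: "0 < \<alpha>" and \<xi>: "levy_process M \<xi>"
    and rec: "recurrent_case M \<alpha> \<xi> \<longrightarrow> (\<exists>X. recurrent_extension M \<alpha> \<xi> 1 X)"
  shows "\<exists>U. semistable_OU M \<alpha> lam \<xi> 1 U"
proof -
  have "\<exists>X. semistable_process M \<alpha> \<xi> 1 X"
  proof (cases "recurrent_case M \<alpha> \<xi>")
    case True
    then obtain X where X: "recurrent_extension M \<alpha> \<xi> 1 X" using rec by blast
    then have "\<forall>t\<ge>0. X t \<in> borel_measurable M" unfolding recurrent_extension_def feller_process_def by blast
    then show ?thesis unfolding semistable_process_def using X True by auto
  next
    case False
    then show ?thesis unfolding semistable_process_def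
      by (intro exI[of _ "lamperti_process \<alpha> \<xi> 1"]) (simp add: lamperti_process_measurable[OF \<alpha> \<xi>])
  qed
  then obtain X where "semistable_process M \<alpha> \<xi> 1 X" by blast
  then have "semistable_OU M \<alpha> lam \<xi> 1 (\<lambda>t \<omega>. OU_transform \<alpha> lam (\<lambda>s. X s \<omega>) t)"
    unfolding semistable_OU_def by blast
  then show ?thesis by blast
qed

context
  fixes \<alpha> lam :: real and f U :: "real \<Rightarrow> real"
  assumes \<alpha>: "0 < \<alpha>" and lam: "0 < lam" and f: "cadlag_in UNIV f" and tc: "time_changed_path \<alpha> lam f U"
begin

lemma time_changed_value:
  "0 \<le> u \<Longrightarrow> U (ou_clock \<alpha> lam f u) = exp (f u) * (1 + \<alpha> * lam * lamperti_V \<alpha> f u) powr (- 1 / \<alpha>)"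
  using tc unfolding time_changed_path_def by blast

lemma time_changed_lifetime: "0 \<le> s \<Longrightarrow> ereal s < hit_zero U \<longleftrightarrow> s \<in> ou_clock \<alpha> lam f ` {0..}"
  using tc unfolding time_changed_path_def by blast

lemma time_changed_powr:
  assumes "0 \<le> u"
  shows "U (ou_clock \<alpha> lam f u) powr \<alpha> = exp (\<alpha> * f u) / (1 + \<alpha> * lam * lamperti_V \<alpha> f u)"
proof -
  have c: "0 < 1 + \<alpha> * lam * lamperti_V \<alpha> f u" by (rule chi_V_pos[OF \<alpha> lam f])
  have "U (ou_clock \<alpha> lam f u) powr \<alpha> = exp (f u) powr \<alpha> * ((1 + \<alpha> * lam * lamperti_V \<alpha> f u) powr (- 1 / \<alpha>)) powr \<alpha>"
    unfolding time_changed_value[OF assms] by (simp add: powr_mult)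
  also have "\<dots> = exp (\<alpha> * f u) * (1 + \<alpha> * lam * lamperti_V \<alpha> f u) powr (- 1)"
    using \<alpha> by (simp add: powr_powr) (simp add: powr_def)
  also have "\<dots> = exp (\<alpha> * f u) / (1 + \<alpha> * lam * lamperti_V \<alpha> f u)"
    using c by (simp add: powr_minus_divide)
  finally show ?thesis .
qed

lemma time_changed_pos: "0 \<le> u \<Longrightarrow> 0 < U (ou_clock \<alpha> lam f u)"
  unfolding time_changed_value using chi_V_pos[OF \<alpha> lam f, of u] by simp

text \<open>With \<open>\<tau>\<close> the exit time in Levy time, \<open>up_clock\<close> at the
  exit of \<open>U\<close> equals \<open>\<tau>\<close>, and the exit time of \<open>U\<close>
  itself equals the clock at \<open>\<tau>\<close>. One kind of harmonicity thus discounts at rate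
  \<open>q\<close> in Levy time, the other by the clock.\<close>

lemma time_changed_integrand:
  fixes B :: "real set"
  defines "W \<equiv> \<lambda>u. U (ou_clock \<alpha> lam f u)"
  defines "\<tau> \<equiv> real_of_ereal (exit_time B W)"
  shows "(let T = exit_time B U; s = real_of_ereal T in if T < hit_zero U then ennreal (exp (- q * up_clock \<alpha> U s) * H (U s)) else 0)
     = (if exit_time B W < \<infinity> then ennreal (exp (- q * \<tau>) * H (W \<tau>)) else 0)"
    and "(let T = exit_time B U; s = real_of_ereal T in if T < hit_zero U then ennreal (exp (- q * s) * H (U s)) else 0)
     = (if exit_time B W < \<infinity> then ennreal (exp (- q * ou_clock \<alpha> lam f \<tau>) * H (W \<tau>)) else 0)"
proof -
  note et = exit_time_time_change[OF \<alpha> lam f tc, of B, folded W_def]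
  show "(let T = exit_time B U; s = real_of_ereal T in if T < hit_zero U then ennreal (exp (- q * up_clock \<alpha> U s) * H (U s)) else 0)
     = (if exit_time B W < \<infinity> then ennreal (exp (- q * \<tau>) * H (W \<tau>)) else 0)"
  proof (cases "exit_time B W < \<infinity>")
    case True
    have "0 \<le> \<tau>" and s: "real_of_ereal (exit_time B U) = ou_clock \<alpha> lam f \<tau>" using et(2)[OF True] by (auto simp: \<tau>_def)
    then have "up_clock \<alpha> U (ou_clock \<alpha> lam f \<tau>) = \<tau>"
      by (intro up_clock_ou_clock[OF \<alpha> lam f] time_changed_value)
    then show ?thesis using True et(1) s by (simp add: Let_def W_def)
  qed (use et(1) in \<open>simp add: Let_def\<close>)
  show "(let T = exit_time B U; s = real_of_ereal T in if T < hit_zero U then ennreal (exp (- q * s) * H (U s)) else 0)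
     = (if exit_time B W < \<infinity> then ennreal (exp (- q * ou_clock \<alpha> lam f \<tau>) * H (W \<tau>)) else 0)"
  proof (cases "exit_time B W < \<infinity>")
    case True
    have s: "real_of_ereal (exit_time B U) = ou_clock \<alpha> lam f \<tau>" using et(2)[OF True] by (auto simp: \<tau>_def)
    then show ?thesis using True et(1) by (simp add: Let_def W_def)
  qed (use et(1) in \<open>simp add: Let_def\<close>)
qed

text \<open>The choice \<open>\<beta> = \<alpha> * lam * x\<close> lets \<open>x\<close> factor out
  of the denominator, which leaves the denominator of \<open>U powr \<alpha>\<close>.\<close>

lemma recip_OU_time_changed:
  assumes "0 \<le> t" and "(\<lambda>t. \<xi> t \<omega>) = f"
  shows "recip_OU \<alpha> (\<alpha> * lam * x) x \<xi> t \<omega> = inverse x * U (ou_clock \<alpha> lam f t) powr \<alpha>"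
proof -
  have "x + \<alpha> * lam * x * lamperti_V \<alpha> f t = x * (1 + \<alpha> * lam * lamperti_V \<alpha> f t)" by (simp add: algebra_simps)
  moreover have "\<xi> t \<omega> = f t" by (simp add: assms(2)[symmetric])
  ultimately show ?thesis
    unfolding time_changed_powr[OF assms(1)] recip_OU_V assms(2)
    by (simp add: divide_inverse)
qed

lemma recip_OU_clock:
  assumes "0 \<le> t" "(\<lambda>t. \<xi> t \<omega>) = f" "x \<noteq> 0"
  shows "x * (LBINT s:{0..t}. recip_OU \<alpha> (\<alpha> * lam * x) x \<xi> s \<omega>) = ou_clock \<alpha> lam f t"
proof -
  have "x * (LBINT s:{0..t}. recip_OU \<alpha> (\<alpha> * lam * x) x \<xi> s \<omega>) = (LBINT s:{0..t}. x * recip_OU \<alpha> (\<alpha> * lam * x) x \<xi> s \<omega>)"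
    by simp
  also have "\<dots> = (LBINT s:{0..t}. exp (\<alpha> * f s) / (1 + \<alpha> * lam * lamperti_V \<alpha> f s))"
    by (rule set_lebesgue_integral_cong)
      (use recip_OU_time_changed[where \<xi>=\<xi> and \<omega>=\<omega>, OF _ assms(2)] time_changed_powr assms(3) in auto)
  also have "\<dots> = ou_clock \<alpha> lam f t" by (rule ou_clock_integral[OF \<alpha> lam f assms(1)])
  finally show ?thesis .
qed

end

section \<open>Harmonic functions under the time change\<close>

lemma powr_less_iff: "0 < \<alpha> \<Longrightarrow> 0 \<le> a \<Longrightarrow> 0 \<le> b \<Longrightarrow> a powr \<alpha> < b powr \<alpha> \<longleftrightarrow> a < (b :: real)"
  using powr_less_mono2[of \<alpha> a b] powr_less_mono2[of \<alpha> b a] by (cases a b rule: linorder_cases) auto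

lemma einterval_rpow_iff:
  fixes l u :: ereal and x w :: real
  assumes "0 < \<alpha>" "0 \<le> l" "l < u" "0 < x" "0 < w"
  shows "w powr \<alpha> \<in> einterval (ereal_rpow l \<alpha>) (ereal_rpow u \<alpha>) \<longleftrightarrow> x * w \<in> einterval (l * ereal x) (u * ereal x)" (is "?a \<longleftrightarrow> ?b")
    and "w powr \<alpha> \<in> einterval (ereal_rpow l \<alpha>) (ereal_rpow u \<alpha>) \<longleftrightarrow> x / w \<in> einterval (ereal x / u) (ereal x / l)" (is "?a \<longleftrightarrow> ?c")
proof -
  obtain l' where l: "l = ereal l'" "0 \<le> l'" using assms(2,3) by (cases l) auto
  have low: "ereal_rpow l \<alpha> < ereal (w powr \<alpha>) \<longleftrightarrow> l' < w"
    using l powr_less_iff[OF assms(1) l(2), of w] assms by (simp add: ereal_rpow_def)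
  have u0: "0 < u" using assms(2,3) by simp
  have up: "ereal (w powr \<alpha>) < ereal_rpow u \<alpha> \<longleftrightarrow> ereal w < u"
    using u0 powr_less_iff[OF assms(1), of w] assms by (cases u) (auto simp: ereal_rpow_def)
  have a: "?a \<longleftrightarrow> l' < w \<and> ereal w < u" using low up by (simp add: einterval_def)
  have "l * ereal x < ereal (x * w) \<longleftrightarrow> l' < w" using l assms by (simp add: mult.commute)
  moreover have "ereal (x * w) < u * ereal x \<longleftrightarrow> ereal w < u" using u0 assms by (cases u) (auto simp: mult.commute)
  ultimately show "?a \<longleftrightarrow> ?b" using a by (simp add: einterval_def)
  \<comment> \<open>For \<open>l = 0\<close> the upper end \<open>x / 0\<close> is infinite and the
    condition is void, in accordance with \<open>0 < w\<close>.\<close>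
  have "ereal (x / w) < ereal x / l \<longleftrightarrow> l' < w"
  proof (cases "l' = 0")
    case True
    then show ?thesis using l assms by (simp add: divide_ereal_def zero_ereal_def[symmetric])
  next
    case False
    then show ?thesis using l assms by (simp add: divide_less_cancel field_simps)
  qed
  moreover have "ereal x / u < ereal (x / w) \<longleftrightarrow> ereal w < u"
    using u0 assms by (cases u) (auto simp: field_simps)
  ultimately show "?a \<longleftrightarrow> ?c" using a by (auto simp: einterval_def)
qed

lemma recip_OU_scaled:
  fixes x w z \<alpha> :: real
  assumes "0 < x" "0 < \<alpha>" "0 < w" "z = inverse (x powr \<alpha>) * w powr \<alpha>"
  shows "x * z powr (1 / \<alpha>) = w" and "0 < z"
proof -
  have "z = (w / x) powr \<alpha>" using assms powr_divide[of w x \<alpha>] by (simp add: divide_inverse mult.commute)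
  then show "x * z powr (1 / \<alpha>) = w" "0 < z" using assms by (auto simp: powr_powr)
qed

text \<open>Let \<open>W\<close> be \<open>U\<close> in Levy time. Then Z is
  \<open>(W / x) powr \<alpha>\<close>, and its reciprocal, the dual OU process, is
  \<open>(x / W) powr \<alpha>\<close>. Each interval for \<open>W\<close> corresponds to the same
  \<open>I\<close>, so exits coincide and the two expectations have almost surely equal
  integrands.\<close>

theorem clock_harmonic_imp_harmonic:
  fixes l u :: ereal
  assumes \<alpha>: "0 < \<alpha>" and lam: "0 < lam" and \<xi>: "levy_process M \<xi>"
    and lu: "0 \<le> l" "l < u" "l < ereal x" and U: "semistable_OU M \<alpha> lam \<xi> 1 U"
  defines "\<beta> \<equiv> \<alpha> * lam * x powr \<alpha>"
  defines "I \<equiv> einterval (ereal_rpow l \<alpha>) (ereal_rpow u \<alpha>)"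
  shows "clock_harmonic \<alpha> M U 1 q (einterval (l * ereal x) (u * ereal x)) H \<Longrightarrow>
      harmonic M (recip_OU \<alpha> \<beta> (x powr \<alpha>) \<xi>) (x powr (-\<alpha>)) q I (\<lambda>z. H (x * z powr (1 / \<alpha>)))"
    and "clock_harmonic \<alpha> M U 1 q (einterval (ereal x / u) (ereal x / l)) H \<Longrightarrow>
      harmonic M (levy_OU \<alpha> \<beta> (x powr \<alpha>) (\<lambda>t \<omega>. - \<xi> t \<omega>)) (x powr \<alpha>) q I (\<lambda>y. H (x * y powr (- 1 / \<alpha>)))"
proof -
  have "(0 :: ereal) < ereal x" using lu by (rule_tac le_less_trans[OF lu(1) lu(3)])
  then have x: "0 < x" by simp
  have tc: "AE \<omega> in M. time_changed_path \<alpha> lam (\<lambda>s. \<xi> s \<omega>) (\<lambda>s. U s \<omega>)"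
    using semistable_OU_time_changed[OF \<alpha> lam \<xi> U] by simp
  note f = levy_cadlag[OF \<xi>]
  show "harmonic M (recip_OU \<alpha> \<beta> (x powr \<alpha>) \<xi>) (x powr (-\<alpha>)) q I (\<lambda>z. H (x * z powr (1 / \<alpha>)))"
    if har: "clock_harmonic \<alpha> M U 1 q (einterval (l * ereal x) (u * ereal x)) H"
    unfolding harmonic_def harmonic_for_def
  proof (intro conjI ballI)
    let ?B = "einterval (l * ereal x) (u * ereal x)"
    have H: "\<And>y. 0 \<le> y \<Longrightarrow> 0 \<le> H y" "H \<in> borel_measurable (restrict_space borel {0..})"
      using har unfolding clock_harmonic_def harmonic_for_def by auto
    show "0 \<le> H (x * z powr (1 / \<alpha>))" if "z \<in> {0<..}" for z using H(1) x by simp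
    show "(\<lambda>z. H (x * z powr (1 / \<alpha>))) \<in> borel_measurable (restrict_space borel {0<..})"
    proof (rule measurable_compose[OF _ H(2)], rule measurable_restrict_space3)
      show "(\<lambda>z. x * z powr (1 / \<alpha>)) \<in> borel_measurable borel" by measurable
    qed (use x in auto)
    have "(\<integral>\<^sup>+\<omega>. (let f = (\<lambda>t. recip_OU \<alpha> \<beta> (x powr \<alpha>) \<xi> t \<omega>); T = exit_time I f; \<tau> = real_of_ereal T in
            if T < \<infinity> then ennreal (exp (- q * \<tau>) * H (x * (f \<tau>) powr (1 / \<alpha>))) else 0) \<partial>M) =
       (\<integral>\<^sup>+\<omega>. (let f = (\<lambda>t. U t \<omega>); T = exit_time ?B f; \<tau> = real_of_ereal T in
            if T < hit_zero f then ennreal (exp (- q * up_clock \<alpha> f \<tau>) * H (f \<tau>)) else 0) \<partial>M)" (is "nn_integral _ ?l = nn_integral _ ?r")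
    proof (rule nn_integral_cong_AE)
      show "AE \<omega> in M. ?l \<omega> = ?r \<omega>"
        using tc AE_space
      proof eventually_elim
        case (elim \<omega>)
        note t = f[OF elim(2)] elim(1)
        let ?W = "\<lambda>u. U (ou_clock \<alpha> lam (\<lambda>s. \<xi> s \<omega>) u) \<omega>"
        have W: "0 < ?W v" if "0 \<le> v" for v by (rule time_changed_pos[OF \<alpha> lam t that])
        have Z: "recip_OU \<alpha> \<beta> (x powr \<alpha>) \<xi> v \<omega> = inverse (x powr \<alpha>) * ?W v powr \<alpha>" if "0 \<le> v" for v
          unfolding \<beta>_def by (rule recip_OU_time_changed[where \<xi>=\<xi> and \<omega>=\<omega>, OF \<alpha> lam t that refl])
        have inv: "x * recip_OU \<alpha> \<beta> (x powr \<alpha>) \<xi> v \<omega> powr (1 / \<alpha>) = ?W v" if "0 \<le> v" for v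
          by (rule recip_OU_scaled(1)[OF x \<alpha> W[OF that] Z[OF that]])
        have mem: "recip_OU \<alpha> \<beta> (x powr \<alpha>) \<xi> v \<omega> \<in> I \<longleftrightarrow> ?W v \<in> ?B" if "0 \<le> v" for v
        proof -
          have "recip_OU \<alpha> \<beta> (x powr \<alpha>) \<xi> v \<omega> = (?W v / x) powr \<alpha>"
            using Z[OF that] x W[OF that] powr_divide[of "?W v" x \<alpha>] by (simp add: divide_inverse mult.commute)
          then show ?thesis unfolding I_def
            using einterval_rpow_iff(1)[OF \<alpha> lu(1,2) x, of "?W v / x"] W[OF that] x by simp
        qed
        have "exit_time I (\<lambda>t. recip_OU \<alpha> \<beta> (x powr \<alpha>) \<xi> t \<omega>) = exit_time ?B ?W" by (rule exit_time_cong[OF mem])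
        then show ?case
          using time_changed_integrand(1)[OF \<alpha> lam t, of ?B q H] inv exit_time_finite[of ?B ?W]
          by (simp add: Let_def)
      qed
    qed
    also have "\<dots> = ennreal (H 1)" using har unfolding clock_harmonic_def harmonic_for_def by simp
    \<comment> \<open>The starting point \<open>x powr (-\<alpha>)\<close> of Z corresponds to
      \<open>W = 1\<close>.\<close>
    also have "H 1 = H (x * (x powr (-\<alpha>)) powr (1 / \<alpha>))"
      using x \<alpha> by (simp only: powr_powr) (simp add: powr_minus)
    finally show "(\<integral>\<^sup>+\<omega>. (let f = (\<lambda>t. recip_OU \<alpha> \<beta> (x powr \<alpha>) \<xi> t \<omega>); T = exit_time I f; \<tau> = real_of_ereal T in
            if T < \<infinity> then ennreal (exp (- q * \<tau>) * H (x * (f \<tau>) powr (1 / \<alpha>))) else 0) \<partial>M) =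
       ennreal (H (x * (x powr (-\<alpha>)) powr (1 / \<alpha>)))" .
  qed
  show "harmonic M (levy_OU \<alpha> \<beta> (x powr \<alpha>) (\<lambda>t \<omega>. - \<xi> t \<omega>)) (x powr \<alpha>) q I (\<lambda>y. H (x * y powr (- 1 / \<alpha>)))"
    if har: "clock_harmonic \<alpha> M U 1 q (einterval (ereal x / u) (ereal x / l)) H"
    unfolding harmonic_def harmonic_for_def
  proof (intro conjI ballI)
    let ?B = "einterval (ereal x / u) (ereal x / l)"
    let ?Y = "levy_OU \<alpha> \<beta> (x powr \<alpha>) (\<lambda>t \<omega>. - \<xi> t \<omega>)"
    have H: "\<And>y. 0 \<le> y \<Longrightarrow> 0 \<le> H y" "H \<in> borel_measurable (restrict_space borel {0..})"
      using har unfolding clock_harmonic_def harmonic_for_def by auto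
    show "0 \<le> H (x * z powr (- 1 / \<alpha>))" if "z \<in> {0<..}" for z using H(1) x by simp
    show "(\<lambda>z. H (x * z powr (- 1 / \<alpha>))) \<in> borel_measurable (restrict_space borel {0<..})"
    proof (rule measurable_compose[OF _ H(2)], rule measurable_restrict_space3)
      show "(\<lambda>z. x * z powr (- 1 / \<alpha>)) \<in> borel_measurable borel" by measurable
    qed (use x in auto)
    have "(\<integral>\<^sup>+\<omega>. (let f = (\<lambda>t. ?Y t \<omega>); T = exit_time I f; \<tau> = real_of_ereal T in
            if T < \<infinity> then ennreal (exp (- q * \<tau>) * H (x * (f \<tau>) powr (- 1 / \<alpha>))) else 0) \<partial>M) =
       (\<integral>\<^sup>+\<omega>. (let f = (\<lambda>t. U t \<omega>); T = exit_time ?B f; \<tau> = real_of_ereal T in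
            if T < hit_zero f then ennreal (exp (- q * up_clock \<alpha> f \<tau>) * H (f \<tau>)) else 0) \<partial>M)" (is "nn_integral _ ?l = nn_integral _ ?r")
    proof (rule nn_integral_cong_AE)
      show "AE \<omega> in M. ?l \<omega> = ?r \<omega>"
        using tc AE_space
      proof eventually_elim
        case (elim \<omega>)
        note t = f[OF elim(2)] elim(1)
        let ?W = "\<lambda>u. U (ou_clock \<alpha> lam (\<lambda>s. \<xi> s \<omega>) u) \<omega>"
        have W: "0 < ?W v" if "0 \<le> v" for v by (rule time_changed_pos[OF \<alpha> lam t that])
        have Y: "?Y v \<omega> = (x / ?W v) powr \<alpha>" if "0 \<le> v" for v
        proof -
          have "?Y v \<omega> = inverse (recip_OU \<alpha> \<beta> (x powr \<alpha>) \<xi> v \<omega>)"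
            by (simp add: levy_OU_def recip_OU_def exp_minus)
          also have "\<dots> = inverse (inverse (x powr \<alpha>) * ?W v powr \<alpha>)"
            unfolding \<beta>_def by (subst recip_OU_time_changed[where \<xi>=\<xi> and \<omega>=\<omega>, OF \<alpha> lam t that refl]) simp
          also have "\<dots> = (x / ?W v) powr \<alpha>" using x W[OF that] powr_divide[of x "?W v" \<alpha>] by (simp add: divide_inverse mult.commute)
          finally show ?thesis .
        qed
        have inv: "x * ?Y v \<omega> powr (- 1 / \<alpha>) = ?W v" if "0 \<le> v" for v
          unfolding Y[OF that] using x W[OF that] \<alpha> by (simp add: powr_powr powr_minus)
        have mem: "?Y v \<omega> \<in> I \<longleftrightarrow> ?W v \<in> ?B" if "0 \<le> v" for v
          unfolding Y[OF that] I_def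
          using einterval_rpow_iff(2)[OF \<alpha> lu(1,2) x, of "x / ?W v"] W[OF that] x by simp
        have "exit_time I (\<lambda>t. ?Y t \<omega>) = exit_time ?B ?W" by (rule exit_time_cong[OF mem])
        then show ?case
          using time_changed_integrand(1)[OF \<alpha> lam t, of ?B q H] inv exit_time_finite[of ?B ?W]
          by (simp add: Let_def)
      qed
    qed
    also have "\<dots> = ennreal (H 1)" using har unfolding clock_harmonic_def harmonic_for_def by simp
    also have "H 1 = H (x * (x powr \<alpha>) powr (- 1 / \<alpha>))"
      using x \<alpha> by (simp add: powr_powr powr_minus)
    finally show "(\<integral>\<^sup>+\<omega>. (let f = (\<lambda>t. ?Y t \<omega>); T = exit_time I f; \<tau> = real_of_ereal T in
            if T < \<infinity> then ennreal (exp (- q * \<tau>) * H (x * (f \<tau>) powr (- 1 / \<alpha>))) else 0) \<partial>M) =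
       ennreal (H (x * (x powr \<alpha>) powr (- 1 / \<alpha>)))" .
  qed
qed

lemma lamperti_V_add_const:
  assumes "0 < x" shows "lamperti_V \<alpha> (\<lambda>s. ln x + f s) u = x powr \<alpha> * lamperti_V \<alpha> f u"
proof -
  have "exp (\<alpha> * (ln x + r)) = x powr \<alpha> * exp (\<alpha> * r)" for r
    using assms by (simp add: powr_def exp_add[symmetric] distrib_left)
  then show ?thesis by (simp add: lamperti_V_def)
qed

text \<open>Under \<open>\<eta>\<close> the discount \<open>exp (- lam * \<gamma> * s)\<close> at
  the clock time \<open>s\<close> is a power of the denominator \<open>c\<close>, and
  \<open>U powr \<gamma>\<close> contributes the same power under \<open>\<xi>\<close>. What remains
  of \<open>U powr \<gamma>\<close> and the discount at rate \<open>q\<close> is the Esscher density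
  at the debut, up to the constant \<open>x powr \<gamma>\<close>.\<close>

theorem time_harmonic_imp_clock_harmonic:
  fixes M :: "'a measure" and N :: "'b measure" and q x :: real
  assumes \<alpha>: "0 < \<alpha>" and lam: "0 < lam" and \<xi>: "levy_process M \<xi>" and moments: "finite_exp_moments M \<xi>"
    and nd: "\<not> subordinator M (\<lambda>t \<omega>. - \<xi> t \<omega>)"
  defines "\<psi> \<equiv> laplace_exponent M \<xi>"
  defines "\<gamma> \<equiv> exponent_inverse \<psi> q"
  assumes q: "0 < q" and x: "0 < x" and B[measurable]: "B \<in> sets borel"
    and U: "semistable_OU M \<alpha> lam \<xi> x U" and \<eta>: "levy_process N \<eta>"
    and le: "has_laplace_exponent N \<eta> (\<lambda>v. \<psi> (v + \<gamma>) - \<psi> \<gamma>)"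
    and U': "semistable_OU N \<alpha> lam \<eta> x U'"
    and har: "time_harmonic N U' x (lam * \<gamma>) B H"
  shows "clock_harmonic \<alpha> M U x q B (\<lambda>y. y powr \<gamma> * H y)"
proof -
  have \<gamma>: "0 \<le> \<gamma>" "\<psi> \<gamma> = q"
    using exponent_inverse_spec[OF \<xi> moments nd q] unfolding \<gamma>_def \<psi>_def by auto
  have tilt: "distr N borel (\<eta> t) = distr (density M (\<lambda>\<omega>. ennreal (exp (\<gamma> * \<xi> t \<omega> - q * t)))) borel (\<xi> t)" if "0 \<le> t" for t
  proof (rule esscher_law[where \<psi>=\<psi> and \<gamma>=\<gamma> and q=q, OF \<xi> \<eta> \<gamma> _ _ that])
    show "integrable M (\<lambda>\<omega>. exp (u * \<xi> 1 \<omega>)) \<and> (\<integral>\<omega>. exp (u * \<xi> 1 \<omega>) \<partial>M) = exp (\<psi> u)" if "0 \<le> u" for u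
      unfolding \<psi>_def using laplace_exponent_exp[OF \<xi> moments that] by blast
    show "integrable N (\<lambda>\<omega>. exp (u * \<eta> 1 \<omega>)) \<and> (\<integral>\<omega>. exp (u * \<eta> 1 \<omega>) \<partial>N) = exp (\<psi> (u + \<gamma>) - q)" if "0 \<le> u" for u
      using le that unfolding has_laplace_exponent_def \<gamma>(2) by blast
  qed
  have H: "\<And>y. 0 \<le> y \<Longrightarrow> 0 \<le> H y" "H \<in> borel_measurable (restrict_space borel {0..})"
    using har unfolding time_harmonic_def harmonic_for_def by auto
  \<comment> \<open>\<open>H\<close> is measurable only on \<open>[0, \<infinity>)\<close>; its
    extension by 0 is Borel on the line and agrees with it at the positive values of
    \<open>W\<close>.\<close>
  define H' where "H' y = H y * indicator {0..} y" for y
  have H'm[measurable]: "H' \<in> borel_measurable borel"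
    using H(2) unfolding H'_def by (subst (asm) borel_measurable_restrict_space_iff) (auto simp: mult.commute)
  have H'_nonneg: "0 \<le> H' y" for y using H(1) by (simp add: H'_def indicator_def)
  \<comment> \<open>All functionals refer to the process started from 0, on which the tilt acts; the
    starting point enters as the scale \<open>x powr \<alpha>\<close> of
    \<open>lamperti_V\<close>.\<close>
  define c where "c u f = 1 + \<alpha> * lam * (x powr \<alpha> * lamperti_V \<alpha> f u)" for u and f :: "real \<Rightarrow> real"
  define W where "W u f = x * exp (f u) * c u f powr (- 1 / \<alpha>)" for u and f :: "real \<Rightarrow> real"
  define D where "D u f \<longleftrightarrow> W u f \<notin> B" for u and f :: "real \<Rightarrow> real"
  \<comment> \<open>\<open>k0\<close> is the integrand of the hypothesis under
    \<open>\<eta>\<close>; \<open>k\<close> below adds the factor \<open>x powr \<gamma>\<close>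
    that \<open>U powr \<gamma>\<close> produces under \<open>\<xi>\<close>.\<close>
  define k0 where "k0 u f = c u f powr (- \<gamma> / \<alpha>) * H' (W u f)" for u and f :: "real \<Rightarrow> real"
  define k where "k u f = x powr \<gamma> * k0 u f" for u and f :: "real \<Rightarrow> real"
  have c_pos: "0 < c u f" for u f
    unfolding c_def using \<alpha> lam lamperti_V_nonneg[of \<alpha> f u] by (intro add_pos_nonneg) auto
  have W_pos: "0 < W u f" for u f using x c_pos[of u f] by (simp add: W_def)
  have ad_c: "c u f = c u g" if "0 \<le> u" "\<forall>v. 0 \<le> v \<longrightarrow> v \<le> u \<longrightarrow> f v = g v" for u f g
    using lamperti_V_cong[of u f g \<alpha>] that by (simp add: c_def)
  have ad_W: "W u f = W u g" if "0 \<le> u" "\<forall>v. 0 \<le> v \<longrightarrow> v \<le> u \<longrightarrow> f v = g v" for u f g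
    using ad_c[OF that] that by (simp add: W_def)
  have D_ad: "adapted D" unfolding adapted_def D_def using ad_W by metis
  have k0_ad: "adapted k0" unfolding adapted_def k0_def using ad_W ad_c by metis
  have k_ad: "adapted k" unfolding adapted_def k_def using adaptedD[OF k0_ad] by metis
  have c_meas[measurable]: "(\<lambda>p. c (fst p) (path (snd p))) \<in> borel_measurable (borel \<Otimes>\<^sub>M path_space)"
    unfolding c_def by measurable
  have W_meas[measurable]: "(\<lambda>p. W (fst p) (path (snd p))) \<in> borel_measurable (borel \<Otimes>\<^sub>M path_space)"
    unfolding W_def by measurable
  have D_meas: "Measurable.pred (borel \<Otimes>\<^sub>M path_space) (\<lambda>p. D (fst p) (path (snd p)))"
    unfolding D_def by measurable
  have k0_meas[measurable]: "(\<lambda>p. k0 (fst p) (path (snd p))) \<in> borel_measurable (borel \<Otimes>\<^sub>M path_space)"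
    unfolding k0_def by measurable
  have k_meas: "(\<lambda>p. k (fst p) (path (snd p))) \<in> borel_measurable (borel \<Otimes>\<^sub>M path_space)"
    unfolding k_def by measurable
  have k0_nonneg: "0 \<le> k0 u f" for u f unfolding k0_def using H'_nonneg by simp
  have k_nonneg: "0 \<le> k u f" for u f unfolding k_def using k0_nonneg by simp
  have exit: "exit_time B (\<lambda>u. X (ou_clock \<alpha> lam (\<lambda>s. ln x + f s) u)) = debut D f"
    and val: "\<And>u. 0 \<le> u \<Longrightarrow> X (ou_clock \<alpha> lam (\<lambda>s. ln x + f s) u) = W u f"
    if X: "cadlag_in UNIV f" "time_changed_path \<alpha> lam (\<lambda>s. ln x + f s) X" for f X
  proof -
    show val: "X (ou_clock \<alpha> lam (\<lambda>s. ln x + f s) u) = W u f" if "0 \<le> u" for u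
      using time_changed_value[OF \<alpha> lam cadlag_in_add_const[OF X(1)] X(2) that] x
      unfolding lamperti_V_add_const[OF x] W_def c_def by (simp add: exp_add)
    have "{ereal t |t. 0 \<le> t \<and> X (ou_clock \<alpha> lam (\<lambda>s. ln x + f s) t) \<notin> B} = {ereal u |u. 0 \<le> u \<and> D u f}"
      using val by (auto simp: D_def)
    then show "exit_time B (\<lambda>u. X (ou_clock \<alpha> lam (\<lambda>s. ln x + f s) u)) = debut D f"
      unfolding exit_time_def debut_def by simp
  qed
  have "(\<integral>\<^sup>+\<omega>. (let f = (\<lambda>t. U' t \<omega>); T = exit_time B f; \<tau> = real_of_ereal T in
      if T < hit_zero f then ennreal (exp (- (lam * \<gamma>) * \<tau>) * H (f \<tau>)) else 0) \<partial>N) = ennreal (H x)"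
    using har unfolding time_harmonic_def harmonic_for_def by blast
  also have "(\<integral>\<^sup>+\<omega>. (let f = (\<lambda>t. U' t \<omega>); T = exit_time B f; \<tau> = real_of_ereal T in
      if T < hit_zero f then ennreal (exp (- (lam * \<gamma>) * \<tau>) * H (f \<tau>)) else 0) \<partial>N) =
    (\<integral>\<^sup>+\<omega>. (if debut D (\<lambda>t. \<eta> t \<omega>) < \<infinity> then ennreal (debut_value D k0 (\<lambda>t. \<eta> t \<omega>)) else 0) \<partial>N)" (is "nn_integral _ ?l = nn_integral _ ?r")
  proof (rule nn_integral_cong_AE)
    show "AE \<omega> in N. ?l \<omega> = ?r \<omega>"
      using semistable_OU_time_changed[OF \<alpha> lam \<eta> U'] AE_space
    proof eventually_elim
      case (elim \<omega>)
      note f = levy_cadlag[OF \<eta> elim(2)]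
      let ?\<tau> = "real_of_ereal (debut D (\<lambda>t. \<eta> t \<omega>))"
      have "exp (- (lam * \<gamma>) * ou_clock \<alpha> lam (\<lambda>s. ln x + \<eta> s \<omega>) ?\<tau>) = c ?\<tau> (\<lambda>t. \<eta> t \<omega>) powr (- \<gamma> / \<alpha>)"
        using c_pos[of ?\<tau> "\<lambda>t. \<eta> t \<omega>"] \<alpha> lam
        unfolding ou_clock_def lamperti_V_add_const[OF x] c_def by (simp add: powr_def)
      moreover have "H (W ?\<tau> (\<lambda>t. \<eta> t \<omega>)) = H' (W ?\<tau> (\<lambda>t. \<eta> t \<omega>))"
        using W_pos[of ?\<tau> "\<lambda>t. \<eta> t \<omega>"] by (simp add: H'_def)
      ultimately show ?case
        using time_changed_integrand(2)[OF \<alpha> lam cadlag_in_add_const[OF f] elim(1), of B "lam * \<gamma>" H]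
          debut_finite[of D "\<lambda>t. \<eta> t \<omega>"]
        unfolding exit[OF f elim(1)] by (simp add: Let_def val[OF f elim(1)] debut_value_def k0_def)
    qed
  qed
  finally have N0: "(\<integral>\<^sup>+\<omega>. (if debut D (\<lambda>t. \<eta> t \<omega>) < \<infinity> then ennreal (debut_value D k0 (\<lambda>t. \<eta> t \<omega>)) else 0) \<partial>N) = ennreal (H x)" .
  have N1: "(\<integral>\<^sup>+\<omega>. (if debut D (\<lambda>t. \<eta> t \<omega>) < \<infinity> then ennreal (debut_value D k (\<lambda>t. \<eta> t \<omega>)) else 0) \<partial>N) = ennreal (x powr \<gamma> * H x)"
  proof -
    let ?F = "\<lambda>\<omega>. if debut D (\<lambda>t. \<eta> t \<omega>) < \<infinity> then ennreal (debut_value D k0 (\<lambda>t. \<eta> t \<omega>)) else 0"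
    \<comment> \<open>Pulling out the constant uses measurability of the integrand, which for a
      general Borel \<open>B\<close> is at hand in the completion.\<close>
    have "?F \<in> borel_measurable (completion N)"
      by (rule debut_integrand_measurable[OF \<xi> \<eta> tilt D_ad D_meas k0_ad k0_meas k0_nonneg])
    then have "(\<integral>\<^sup>+\<omega>. ennreal (x powr \<gamma>) * ?F \<omega> \<partial>N) = ennreal (x powr \<gamma>) * (\<integral>\<^sup>+\<omega>. ?F \<omega> \<partial>N)"
      using nn_integral_cmult[of ?F "completion N" "ennreal (x powr \<gamma>)"] unfolding nn_integral_completion by simp
    moreover have "ennreal (x powr \<gamma>) * ?F \<omega> = (if debut D (\<lambda>t. \<eta> t \<omega>) < \<infinity> then ennreal (debut_value D k (\<lambda>t. \<eta> t \<omega>)) else 0)" for \<omega>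
      by (simp add: debut_value_def k_def ennreal_mult k0_nonneg)
    ultimately show ?thesis using N0 H(1)[of x] x by (simp add: ennreal_mult)
  qed
  show ?thesis
    unfolding clock_harmonic_def harmonic_for_def
  proof (intro conjI ballI)
    show "0 \<le> y powr \<gamma> * H y" if "y \<in> {0..}" for y using H(1) that by simp
    show "(\<lambda>y. y powr \<gamma> * H y) \<in> borel_measurable (restrict_space borel {0..})"
      by (intro borel_measurable_times H(2) measurable_restrict_space1) measurable
    have "(\<integral>\<^sup>+\<omega>. (let f = (\<lambda>t. U t \<omega>); T = exit_time B f; \<tau> = real_of_ereal T in
        if T < hit_zero f then ennreal (exp (- q * up_clock \<alpha> f \<tau>) * (f \<tau> powr \<gamma> * H (f \<tau>))) else 0) \<partial>M) =
      (\<integral>\<^sup>+\<omega>. (if debut D (\<lambda>t. \<xi> t \<omega>) < \<infinity> then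
       ennreal (exp (\<gamma> * \<xi> (real_of_ereal (debut D (\<lambda>t. \<xi> t \<omega>))) \<omega> - q * real_of_ereal (debut D (\<lambda>t. \<xi> t \<omega>))) * debut_value D k (\<lambda>t. \<xi> t \<omega>)) else 0) \<partial>M)" (is "nn_integral _ ?l = nn_integral _ ?r")
    proof (rule nn_integral_cong_AE)
      show "AE \<omega> in M. ?l \<omega> = ?r \<omega>"
        using semistable_OU_time_changed[OF \<alpha> lam \<xi> U] AE_space
      proof eventually_elim
        case (elim \<omega>)
        note f = levy_cadlag[OF \<xi> elim(2)]
        let ?f = "\<lambda>t. \<xi> t \<omega>"
        let ?\<tau> = "real_of_ereal (debut D ?f)"
        have "W ?\<tau> ?f powr \<gamma> = x powr \<gamma> * exp (\<xi> ?\<tau> \<omega>) powr \<gamma> * (c ?\<tau> ?f powr (- 1 / \<alpha>)) powr \<gamma>"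
          unfolding W_def using x by (simp add: powr_mult)
        also have "(c ?\<tau> ?f powr (- 1 / \<alpha>)) powr \<gamma> = c ?\<tau> ?f powr (- \<gamma> / \<alpha>)" by (simp add: powr_powr)
        also have "exp (\<xi> ?\<tau> \<omega>) powr \<gamma> = exp (\<gamma> * \<xi> ?\<tau> \<omega>)" by (simp add: powr_def)
        finally have Wp: "W ?\<tau> ?f powr \<gamma> = x powr \<gamma> * exp (\<gamma> * \<xi> ?\<tau> \<omega>) * c ?\<tau> ?f powr (- \<gamma> / \<alpha>)" .
        have "H (W ?\<tau> ?f) = H' (W ?\<tau> ?f)" using W_pos[of ?\<tau> ?f] by (simp add: H'_def)
        then have key: "exp (- q * ?\<tau>) * (W ?\<tau> ?f powr \<gamma> * H (W ?\<tau> ?f)) = exp (\<gamma> * \<xi> ?\<tau> \<omega> - q * ?\<tau>) * debut_value D k ?f"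
          unfolding Wp debut_value_def k_def k0_def by (simp add: exp_diff exp_minus divide_inverse)
        show ?case
          using time_changed_integrand(1)[OF \<alpha> lam cadlag_in_add_const[OF f] elim(1), of B q "\<lambda>y. y powr \<gamma> * H y"]
            debut_finite[of D ?f] key
          unfolding exit[OF f elim(1)] by (simp add: Let_def val[OF f elim(1)])
      qed
    qed
    also have "\<dots> = (\<integral>\<^sup>+\<omega>. (if debut D (\<lambda>t. \<eta> t \<omega>) < \<infinity> then ennreal (debut_value D k (\<lambda>t. \<eta> t \<omega>)) else 0) \<partial>N)"
      by (rule debut_tilt[OF \<xi> \<eta> tilt D_ad D_meas k_ad k_meas k_nonneg])
    also have "\<dots> = ennreal (x powr \<gamma> * H x)" by (rule N1)
    finally show "(\<integral>\<^sup>+\<omega>. (let f = (\<lambda>t. U t \<omega>); T = exit_time B f; \<tau> = real_of_ereal T in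
        if T < hit_zero f then ennreal (exp (- q * up_clock \<alpha> f \<tau>) * (f \<tau> powr \<gamma> * H (f \<tau>))) else 0) \<partial>M) = ennreal (x powr \<gamma> * H x)" .
  qed
qed

text \<open>The integrand \<open>x * Z\<close> is the density of the clock, so \<open>down\<close>
  is the clock itself; its inverse is \<open>up_clock\<close>, and its range consists of the times
  before the first zero.\<close>

theorem recip_OU_time_change:
  fixes M :: "'a measure" and x :: real
  assumes \<alpha>: "0 < \<alpha>" and lam: "0 < lam" and \<xi>: "levy_process M \<xi>" and x: "x \<noteq> 0"
    and U: "semistable_OU M \<alpha> lam \<xi> 1 U"
  defines "Z \<equiv> recip_OU \<alpha> (\<alpha> * lam * x) x \<xi>"
  defines "down \<equiv> (\<lambda>\<omega> t. x * (LBINT s:{0..t}. Z s \<omega>))"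
  shows "AE \<omega> in M. (\<forall>t\<ge>0. Z t \<omega> = inverse x * U (down \<omega> t) \<omega> powr \<alpha>) \<and>
    (\<forall>t\<ge>0. 0 \<le> down \<omega> t \<and> ereal (down \<omega> t) < hit_zero (\<lambda>s. U s \<omega>) \<and> up_clock \<alpha> (\<lambda>s. U s \<omega>) (down \<omega> t) = t) \<and>
    (\<forall>s\<ge>0. ereal s < hit_zero (\<lambda>s. U s \<omega>) \<longrightarrow> 0 \<le> up_clock \<alpha> (\<lambda>s. U s \<omega>) s \<and> down \<omega> (up_clock \<alpha> (\<lambda>s. U s \<omega>) s) = s)"
  using semistable_OU_time_changed[OF \<alpha> lam \<xi> U] AE_space
proof eventually_elim
  case (elim \<omega>)
  let ?f = "\<lambda>s. \<xi> s \<omega>" and ?U = "\<lambda>s. U s \<omega>"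
  have f: "cadlag_in UNIV ?f" by (rule levy_cadlag[OF \<xi> elim(2)])
  have tc: "time_changed_path \<alpha> lam ?f ?U" using elim(1) by simp
  let ?D = "ou_clock \<alpha> lam ?f"
  have down: "down \<omega> t = ?D t" if "0 \<le> t" for t
    unfolding down_def Z_def by (rule recip_OU_clock[where \<xi>=\<xi> and \<omega>=\<omega>, OF \<alpha> lam f tc that refl x])
  have up: "up_clock \<alpha> ?U (?D t) = t" if "0 \<le> t" for t
    by (rule up_clock_ou_clock[OF \<alpha> lam f time_changed_value[OF \<alpha> lam f tc] that])
  have life: "ereal s < hit_zero ?U \<longleftrightarrow> s \<in> ?D ` {0..}" if "0 \<le> s" for s
    by (rule time_changed_lifetime[OF \<alpha> lam f tc that])
  have D0: "0 \<le> ?D t" if "0 \<le> t" for t by (rule ou_clock_nonneg[OF \<alpha> lam f that])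
  show ?case
  proof (intro conjI allI impI)
    fix t :: real assume t: "0 \<le> t"
    show "Z t \<omega> = inverse x * U (down \<omega> t) \<omega> powr \<alpha>"
      unfolding down[OF t] Z_def by (rule recip_OU_time_changed[where \<xi>=\<xi> and \<omega>=\<omega>, OF \<alpha> lam f tc t refl])
    show "0 \<le> down \<omega> t" "ereal (down \<omega> t) < hit_zero ?U" "up_clock \<alpha> ?U (down \<omega> t) = t"
      unfolding down[OF t] using D0[OF t] life[OF D0[OF t]] up[OF t] t by auto
  next
    fix s :: real assume s: "0 \<le> s" "ereal s < hit_zero ?U"
    then obtain u where u: "0 \<le> u" "s = ?D u" using life[OF s(1)] by auto
    show "0 \<le> up_clock \<alpha> ?U s" "down \<omega> (up_clock \<alpha> ?U s) = s"
      unfolding u(2) up[OF u(1)] using u down by auto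
  qed
qed

theorem theorem1p4:
  fixes M :: "'a measure" and \<xi> :: "real \<Rightarrow> 'a \<Rightarrow> real" and \<alpha> lam :: real
  assumes "0 < \<alpha>" and "0 < lam"
    and "levy_process M \<xi>" and "non_arithmetic M \<xi>" and "integrable M (\<xi> 1)"
  shows
    "(\<forall>x::real. x \<noteq> 0 \<longrightarrow>
        (let Z = recip_OU \<alpha> (\<alpha> * lam * x) x \<xi>;
             down = (\<lambda>\<omega> t. x * (LBINT s:{0..t}. Z s \<omega>))
         in (AE \<omega> in M. Z 0 \<omega> = 1 / x) \<and>
            ((recurrent_case M \<alpha> \<xi> \<longrightarrow> (\<exists>X. recurrent_extension M \<alpha> \<xi> 1 X)) \<longrightarrow>
              (\<exists>U. semistable_OU M \<alpha> lam \<xi> 1 U \<and>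
                (AE \<omega> in M.
                  let up = up_clock \<alpha> (\<lambda>s. U s \<omega>); T0 = hit_zero (\<lambda>s. U s \<omega>)
                  in (\<forall>t\<ge>0. ereal t < T0 \<longrightarrow> Z t \<omega> = inverse x * U (down \<omega> t) \<omega> powr \<alpha>) \<and>
                     (0 < (\<integral>\<omega>'. \<xi> 1 \<omega>' \<partial>M) \<longrightarrow>
                        (\<forall>t\<ge>0. Z t \<omega> = inverse x * U (down \<omega> t) \<omega> powr \<alpha>)) \<and>
                     (\<forall>t\<ge>0. 0 \<le> down \<omega> t \<and> ereal (down \<omega> t) < T0 \<and> up (down \<omega> t) = t) \<and>
                     (\<forall>s\<ge>0. ereal s < T0 \<longrightarrow> 0 \<le> up s \<and> down \<omega> (up s) = s)))) \<and>
            (0 < x \<longrightarrow>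
              feller_process M {0<..}
                (\<lambda>t z. distr M (restrict_space borel {0<..}) (recip_OU \<alpha> (\<alpha> * lam * x) (1 / z) \<xi> t))
                Z)))
     \<and>
     (\<forall>(q::real) (l::ereal) (u::ereal) (x::real) U H.
        0 < q \<longrightarrow> 0 \<le> l \<longrightarrow> l < u \<longrightarrow> l < ereal x \<longrightarrow> ereal x < u \<longrightarrow>
        semistable_OU M \<alpha> lam \<xi> 1 U \<longrightarrow>
        (let \<beta> = \<alpha> * lam * x powr \<alpha>;
             Z = recip_OU \<alpha> \<beta> (x powr \<alpha>) \<xi>;
             Yhat = levy_OU \<alpha> \<beta> (x powr \<alpha>) (\<lambda>t \<omega>. - \<xi> t \<omega>);
             I = einterval (ereal_rpow l \<alpha>) (ereal_rpow u \<alpha>)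
         in (clock_harmonic \<alpha> M U 1 q (einterval (l * ereal x) (u * ereal x)) H \<longrightarrow>
               harmonic M Z (x powr (-\<alpha>)) q I (\<lambda>z. H (x * z powr (1 / \<alpha>)))) \<and>
            (clock_harmonic \<alpha> M U 1 q (einterval (ereal x / u) (ereal x / l)) H \<longrightarrow>
               harmonic M Yhat (x powr \<alpha>) q I (\<lambda>y. H (x * y powr (- 1 / \<alpha>))))))
     \<and>
     (finite_exp_moments M \<xi> \<longrightarrow> spectrally_negative M \<xi> \<longrightarrow> nondegenerate M \<xi> \<longrightarrow>
        (\<forall>(q::real) (x::real) B U H (N::'b measure) \<eta> U'.
           let \<psi> = laplace_exponent M \<xi>; \<gamma> = exponent_inverse \<psi> q
           in 0 < q \<longrightarrow> 0 < x \<longrightarrow> B \<in> sets borel \<longrightarrow> B \<subseteq> {0..} \<longrightarrow>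
              semistable_OU M \<alpha> lam \<xi> x U \<longrightarrow>
              levy_process N \<eta> \<longrightarrow> has_laplace_exponent N \<eta> (\<lambda>v. \<psi> (v + \<gamma>) - \<psi> \<gamma>) \<longrightarrow>
              semistable_OU N \<alpha> lam \<eta> x U' \<longrightarrow>
              time_harmonic N U' x (lam * \<gamma>) B H \<longrightarrow>
              clock_harmonic \<alpha> M U x q B (\<lambda>y. y powr \<gamma> * H y)))"
proof (intro conjI allI impI, goal_cases)
  case (1 x)
  show ?case
    unfolding Let_def
  proof (intro conjI impI, goal_cases)
    case 1
    show ?case by (rule recip_OU_start[OF assms(1,3)])
  next
    case 2
    then obtain U where U: "semistable_OU M \<alpha> lam \<xi> 1 U" using semistable_OU_exists[OF assms(1,3)] by blast
    show ?case
      by (rule exI[of _ U], rule conjI[OF U])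
        (use recip_OU_time_change[OF assms(1-3) \<open>x \<noteq> 0\<close> U] in \<open>eventually_elim, blast\<close>)
  next
    case 3
    \<comment> \<open>The kernel is parametrised by starting points and Z starts from
      \<open>1 / x\<close>, hence the double reciprocal.\<close>
    have "feller_process M {0<..} (recip_kernel M \<xi> \<alpha> (\<alpha> * lam * x)) (recip_OU \<alpha> (\<alpha> * lam * x) (1 / (1 / x)) \<xi>)"
      by (rule recip_OU_feller) (use assms 3 in auto)
    moreover have "recip_kernel M \<xi> \<alpha> (\<alpha> * lam * x) =
       (\<lambda>t z. distr M (restrict_space borel {0<..}) (recip_OU \<alpha> (\<alpha> * lam * x) (1 / z) \<xi> t))"
      by (intro ext, rule recip_kernel_def) (use assms 3 in auto)
    ultimately show ?case by simp
  qed
next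
  case (2 q l u x U H)
  then show ?case unfolding Let_def using clock_harmonic_imp_harmonic[OF assms(1-3)] by blast
next
  case (3 q x B U H N \<eta> U')
  then show ?case
    unfolding Let_def nondegenerate_def using time_harmonic_imp_clock_harmonic[OF assms(1-3)] by blast
qed

end
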